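(* For all but finitely many nonzero ideals $I$ of $O_K=\mathbb{Z}[\sqrt2]$, the principal congruence subgroup $\mathcal{Q}_B^1(I)$ of the maximal order $\mathcal{Q}_B$ satisfies the systolic bound $$\operatorname{sys}(X_I)>\tfrac43\log g(X_I),$$ where $X_I=\mathcal{H}^2/\mathcal{Q}_B^1(I)$ and $g(X_I)$ is its genus.
   Context: $K=\mathbb{Q}(\sqrt2)$, $O_K=\mathbb{Z}[\sqrt2]$. $D_B$ is the quaternion algebra over $K$ with basis $1,i,j,ij$ and relations $i^2=-3$, $j^2=\sqrt2$, $ji=-ij$. Put $\alpha=\frac12(1+i)$ and $\beta=\frac16\bigl(3+(1+2\sqrt2)i-2ij\bigr)$; $\mathcal{Q}_B=O_K[\alpha,\beta]$ is the $O_K$-subalgebra of $D_B$ generated by $\alpha,\beta$; it is a maximal order of $D_B$. $\mathcal{Q}_B^1$ is the group of elements of reduced norm $1$ in $\mathcal{Q}_B$; via an isomorphism $D_B\otimes_K\mathbb{R}\cong M_2(\mathbb{R})$ (for the real embedding of $K$ with $\sqrt2>0$) it is a cocompact lattice in $SL_2(\mathbb{R})$ and acts on the hyperbolic plane $\mathcal{H}^2$. For an ideal $I$ of $O_K$, $\mathcal{Q}_B^1(I)$ is the kernel of the natural map $\mathcal{Q}_B^1\to(\mathcal{Q}_B/I\mathcal{Q}_B)^\times$. $\operatorname{sys}(X)$ denotes the systole of $X$, i.e. the least length of a closed geodesic (for a torsion-free Fuchsian group, the least translation length of a nonidentity element). *)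

theory Defs
  imports "HOL-Analysis.Analysis" "HOL-Homology.Homology"
begin

text \<open>The field \<open>K\<close> is taken inside the reals through the embedding with \<open>sqrt 2 > 0\<close>, the one that
  makes the arithmetic group act on the hyperbolic plane.\<close>

definition K_field :: "real set" where
  "K_field = {real_of_rat a + real_of_rat b * sqrt 2 | a b. True}"

definition OK :: "real ring" where
  "OK = \<lparr>carrier = {real_of_int a + real_of_int b * sqrt 2 | a b. True},
         mult = (*), one = 1, zero = 0, add = (+)\<rparr>"

lemma cring_OK: "cring OK"
proof (rule cringI)
  have eq: "x \<in> carrier OK \<longleftrightarrow> (\<exists>a b. x = real_of_int a + real_of_int b * sqrt 2)" for x
    by (simp add: OK_def)
  have memI: "x \<in> carrier OK" if "x = real_of_int a + real_of_int b * sqrt 2" for x a b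
    using that eq by blast
  have add: "x + y \<in> carrier OK" if x: "x \<in> carrier OK" and y: "y \<in> carrier OK" for x y
  proof -
    obtain a b where 1: "x = real_of_int a + real_of_int b * sqrt 2" using x eq by blast
    obtain c d where 2: "y = real_of_int c + real_of_int d * sqrt 2" using y eq by blast
    show ?thesis by (rule memI[of _ "a + c" "b + d"]) (simp add: 1 2 algebra_simps)
  qed
  have mult: "x * y \<in> carrier OK" if x: "x \<in> carrier OK" and y: "y \<in> carrier OK" for x y
  proof -
    obtain a b where 1: "x = real_of_int a + real_of_int b * sqrt 2" using x eq by blast
    obtain c d where 2: "y = real_of_int c + real_of_int d * sqrt 2" using y eq by blast
    show ?thesis
      by (rule memI[of _ "a * c + 2 * b * d" "a * d + b * c"]) (simp add: 1 2 algebra_simps)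
  qed
  have neg: "- x \<in> carrier OK" if x: "x \<in> carrier OK" for x
  proof -
    obtain a b where 1: "x = real_of_int a + real_of_int b * sqrt 2" using x eq by blast
    show ?thesis by (rule memI[of _ "- a" "- b"]) (simp add: 1)
  qed
  have zero: "0 \<in> carrier OK" by (rule memI[of _ 0 0]) simp
  have one: "1 \<in> carrier OK" by (rule memI[of _ 1 0]) simp
  have sel: "mult OK = (*)" "one OK = 1" "Ring.zero OK = 0" "Ring.add OK = (+)"
    by (simp_all add: OK_def)
  show "abelian_group OK"
  proof (rule abelian_groupI)
    fix x assume "x \<in> carrier OK"
    then show "\<exists>y\<in>carrier OK. y \<oplus>\<^bsub>OK\<^esub> x = \<zero>\<^bsub>OK\<^esub>"
      by (intro bexI[of _ "- x"]) (simp_all add: sel neg)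
  qed (simp_all add: sel add zero)
  show "comm_monoid OK"
    by (rule comm_monoidI) (simp_all add: sel mult one)
qed (simp add: OK_def algebra_simps)

text \<open>The type \<open>bquat\<close> is the real quaternion algebra with \<open>i\<^sup>2 = -3\<close>, \<open>j\<^sup>2 = sqrt 2\<close>, \<open>ji = -ij\<close>,
  that is, the algebra obtained from \<open>D\<^sub>B\<close> by extending scalars from \<open>K\<close> to the reals;
  \<open>BQ x0 x1 x2 x3\<close> stands for \<open>x0 + x1 i + x2 j + x3 ij\<close>. The algebra \<open>D\<^sub>B\<close> itself consists of the
  elements with coordinates in \<open>K\<close>.\<close>

datatype bquat = BQ (q0: real) (q1: real) (q2: real) (q3: real)

lemma bquat_eq_iff: "x = y \<longleftrightarrow> q0 x = q0 y \<and> q1 x = q1 y \<and> q2 x = q2 y \<and> q3 x = q3 y"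
  by (cases x; cases y) simp

instantiation bquat :: real_algebra_1
begin

definition "0 = BQ 0 0 0 0"
definition "1 = BQ 1 0 0 0"
definition "x + y = BQ (q0 x + q0 y) (q1 x + q1 y) (q2 x + q2 y) (q3 x + q3 y)"
definition "- x = BQ (- q0 x) (- q1 x) (- q2 x) (- q3 x)"
definition "x - y = BQ (q0 x - q0 y) (q1 x - q1 y) (q2 x - q2 y) (q3 x - q3 y)"
definition "r *\<^sub>R x = BQ (r * q0 x) (r * q1 x) (r * q2 x) (r * q3 x)"
definition "x * y = BQ
  (q0 x * q0 y - 3 * (q1 x * q1 y) + sqrt 2 * (q2 x * q2 y) + 3 * sqrt 2 * (q3 x * q3 y))
  (q0 x * q1 y + q1 x * q0 y - sqrt 2 * (q2 x * q3 y) + sqrt 2 * (q3 x * q2 y))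
  (q0 x * q2 y + q2 x * q0 y - 3 * (q1 x * q3 y) + 3 * (q3 x * q1 y))
  (q0 x * q3 y + q3 x * q0 y + q1 x * q2 y - q2 x * q1 y)"

lemmas bquat_defs = zero_bquat_def one_bquat_def plus_bquat_def uminus_bquat_def
  minus_bquat_def scaleR_bquat_def times_bquat_def

instance
  by standard (simp_all add: bquat_defs bquat_eq_iff algebra_simps)

end

definition bi :: bquat where "bi = BQ 0 1 0 0"
definition bj :: bquat where "bj = BQ 0 0 1 0"

lemma bquat_relations:
  "bi * bi = -3" "bj * bj = of_real (sqrt 2)" "bj * bi = - (bi * bj)"
proof -
  have 3: "(-3 :: bquat) = of_real (-3)" by simp
  show "bi * bi = -3" unfolding 3 of_real_def by (simp add: bi_def bquat_defs)
qed (simp_all add: bi_def bj_def of_real_def bquat_defs)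

lemma bquat_expand:
  "x = of_real (q0 x) + q1 x *\<^sub>R bi + q2 x *\<^sub>R bj + q3 x *\<^sub>R (bi * bj)"
  by (simp add: bi_def bj_def of_real_def bquat_defs)

definition DB :: "bquat set" where
  "DB = {x. q0 x \<in> K_field \<and> q1 x \<in> K_field \<and> q2 x \<in> K_field \<and> q3 x \<in> K_field}"

definition qconj :: "bquat \<Rightarrow> bquat" where
  "qconj x = BQ (q0 x) (- q1 x) (- q2 x) (- q3 x)"

definition nrd :: "bquat \<Rightarrow> real" where
  "nrd x = (q0 x)\<^sup>2 + 3 * (q1 x)\<^sup>2 - sqrt 2 * (q2 x)\<^sup>2 - 3 * sqrt 2 * (q3 x)\<^sup>2"

lemma nrd_conj: "x * qconj x = of_real (nrd x)" "qconj x * x = of_real (nrd x)"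
  by (simp_all add: nrd_def qconj_def of_real_def bquat_defs power2_eq_square)

definition OK_subalgebra :: "bquat set \<Rightarrow> bool" where
  "OK_subalgebra S \<longleftrightarrow> S \<subseteq> DB \<and> 1 \<in> S \<and> (\<forall>x\<in>S. \<forall>y\<in>S. x + y \<in> S \<and> x * y \<in> S)
     \<and> (\<forall>a\<in>carrier OK. \<forall>x\<in>S. a *\<^sub>R x \<in> S)"

definition alphaB :: bquat where
  "alphaB = (1/2) *\<^sub>R (1 + bi)"

definition betaB :: bquat where
  "betaB = (1/6) *\<^sub>R (3 + (1 + 2 * sqrt 2) *\<^sub>R bi - 2 *\<^sub>R (bi * bj))"

definition QB :: "bquat set" where
  "QB = OK_subalgebra hull {alphaB, betaB}"

definition QB1 :: "bquat set" where
  "QB1 = {x \<in> QB. nrd x = 1}"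

text \<open>\<open>ideal_QB I\<close> is the two-sided ideal \<open>I Q\<^sub>B\<close> of finite sums of products; an element of \<open>Q\<^sub>B\<^sup>1\<close> lies
  in the kernel of reduction modulo it exactly when its difference from \<open>1\<close> belongs to it.\<close>

inductive_set ideal_QB :: "real set \<Rightarrow> bquat set" for I :: "real set" where
  zero: "0 \<in> ideal_QB I"
| add: "a \<in> I \<Longrightarrow> x \<in> QB \<Longrightarrow> y \<in> ideal_QB I \<Longrightarrow> a *\<^sub>R x + y \<in> ideal_QB I"

definition QB1_cong :: "real set \<Rightarrow> bquat set" where
  "QB1_cong I = {x \<in> QB1. x - 1 \<in> ideal_QB I}"

lemma DB_subalgebra: "OK_subalgebra DB"
proof -
  have K0: "0 \<in> K_field" and K1: "1 \<in> K_field" and K3: "3 \<in> K_field"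
    and Ks: "sqrt 2 \<in> K_field"
    unfolding K_field_def mem_Collect_eq
    by (rule exI[of _ 0], rule exI[of _ 0], simp, rule exI[of _ 1], rule exI[of _ 0], simp,
        rule exI[of _ 3], rule exI[of _ 0], simp, rule exI[of _ 0], rule exI[of _ 1], simp)
  have Kadd: "x + y \<in> K_field" if x: "x \<in> K_field" and y: "y \<in> K_field" for x y
  proof -
    obtain a b where "x = real_of_rat a + real_of_rat b * sqrt 2"
      using x unfolding K_field_def by blast
    moreover obtain c d where "y = real_of_rat c + real_of_rat d * sqrt 2"
      using y unfolding K_field_def by blast
    ultimately have "x + y = real_of_rat (a + c) + real_of_rat (b + d) * sqrt 2"
      by (simp add: of_rat_add algebra_simps)
    then show ?thesis unfolding K_field_def by blast
  qed
  have Kmult: "x * y \<in> K_field" if x: "x \<in> K_field" and y: "y \<in> K_field" for x y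
  proof -
    obtain a b where "x = real_of_rat a + real_of_rat b * sqrt 2"
      using x unfolding K_field_def by blast
    moreover obtain c d where "y = real_of_rat c + real_of_rat d * sqrt 2"
      using y unfolding K_field_def by blast
    ultimately have "x * y = real_of_rat (a * c + 2 * b * d) + real_of_rat (a * d + b * c) * sqrt 2"
      by (simp add: of_rat_add of_rat_mult algebra_simps)
    then show ?thesis unfolding K_field_def by blast
  qed
  have Kneg: "- x \<in> K_field" if x: "x \<in> K_field" for x
  proof -
    obtain a b where "x = real_of_rat a + real_of_rat b * sqrt 2"
      using x unfolding K_field_def by blast
    then have "- x = real_of_rat (- a) + real_of_rat (- b) * sqrt 2"
      by (simp add: of_rat_minus)
    then show ?thesis unfolding K_field_def by blast
  qed
  have Kdiff: "x - y \<in> K_field" if "x \<in> K_field" "y \<in> K_field" for x y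
    using Kadd[OF that(1) Kneg[OF that(2)]] by simp
  have OKK: "a \<in> K_field" if a: "a \<in> carrier OK" for a
  proof -
    obtain m n where "a = real_of_int m + real_of_int n * sqrt 2"
      using a unfolding OK_def by auto
    then have "a = real_of_rat (of_int m) + real_of_rat (of_int n) * sqrt 2" by simp
    then show ?thesis unfolding K_field_def by blast
  qed
  show ?thesis
    unfolding OK_subalgebra_def DB_def
    by (auto simp: bquat_defs intro!: K0 K1 K3 Ks Kadd Kmult Kdiff dest!: OKK)
qed

lemma alphaB_betaB_DB: "alphaB \<in> DB" "betaB \<in> DB"
proof -
  have *: "real_of_rat a + real_of_rat b * sqrt 2 \<in> K_field" for a b
    unfolding K_field_def by blast
  have 3: "(3 :: bquat) = of_real 3" by simp
  have K: "0 \<in> K_field" "1/2 \<in> K_field" "- (1/3) \<in> K_field" "1/6 + 1/3 * sqrt 2 \<in> K_field"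
    using *[of 0 0] *[of "1/2" 0] *[of "-1/3" 0] *[of "1/6" "1/3"]
    by (simp_all add: of_rat_divide of_rat_minus)
  have a: "alphaB = BQ (1/2) (1/2) 0 0"
    by (simp add: alphaB_def bi_def bquat_defs)
  have b: "betaB = BQ (1/2) (1/6 + 1/3 * sqrt 2) 0 (- (1/3))"
    unfolding betaB_def 3 of_real_def by (simp add: bi_def bj_def bquat_defs field_simps)
  show "alphaB \<in> DB" "betaB \<in> DB"
    unfolding DB_def mem_Collect_eq a b bquat.sel using K by blast+
qed

lemma QB_subalgebra: "OK_subalgebra QB" and QB_gens: "alphaB \<in> QB" "betaB \<in> QB"
proof -
  show "alphaB \<in> QB" "betaB \<in> QB"
    using hull_subset[of "{alphaB, betaB}" OK_subalgebra] by (auto simp: QB_def)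
  have "QB \<subseteq> DB"
    unfolding QB_def by (rule hull_minimal) (use alphaB_betaB_DB DB_subalgebra in auto)
  then show "OK_subalgebra QB"
    unfolding QB_def hull_def OK_subalgebra_def by blast
qed

text \<open>The real algebra isomorphism onto the two-by-two real matrices with
  \<open>i \<mapsto> (0, -3; 1, 0)\<close> and \<open>j \<mapsto> (s, 0; 0, -s)\<close>, where \<open>s\<close> is the positive fourth root of two. By
  Skolem-Noether, any other choice is conjugate to this one under real invertible matrices, so it
  gives isometric quotients.\<close>

definition matB :: "bquat \<Rightarrow> real^2^2" where
  "matB x = (let s = sqrt (sqrt 2) in
     vector [vector [q0 x + s * q2 x, - 3 * q1 x + 3 * s * q3 x],
             vector [q1 x + s * q3 x, q0 x - s * q2 x]])"

lemma matB_hom: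
  "matB 1 = mat 1" "matB (x + y) = matB x + matB y" "matB (r *\<^sub>R x) = r *\<^sub>R matB x"
  "matB (x * y) = matB x ** matB y"
proof -
  have s: "sqrt (sqrt 2) * (sqrt (sqrt 2) * a) = sqrt 2 * a" for a
    by (simp flip: mult.assoc)
  show "matB 1 = mat 1" "matB (x + y) = matB x + matB y" "matB (r *\<^sub>R x) = r *\<^sub>R matB x"
    "matB (x * y) = matB x ** matB y"
    by (simp_all add: matB_def Let_def bquat_defs vec_eq_iff forall_2 vector_2 mat_def
        matrix_matrix_mult_def sum_2 algebra_simps s)
qed

lemma det_matB: "det (matB x) = nrd x"
proof -
  have s: "sqrt (sqrt 2) * (sqrt (sqrt 2) * a) = sqrt 2 * a" for a
    by (simp flip: mult.assoc)
  show ?thesis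
    by (simp add: matB_def Let_def det_2 vector_2 nrd_def power2_eq_square algebra_simps s)
qed

lemma bij_matB: "bij matB"
proof (rule bijI)
  have s: "sqrt (sqrt 2) > (0::real)" by simp
  show "inj matB"
  proof (rule injI)
    fix x y assume "matB x = matB y"
    then have *: "q0 x + sqrt (sqrt 2) * q2 x = q0 y + sqrt (sqrt 2) * q2 y"
      "- 3 * q1 x + 3 * (sqrt (sqrt 2) * q3 x) = - 3 * q1 y + 3 * (sqrt (sqrt 2) * q3 y)"
      "q1 x + sqrt (sqrt 2) * q3 x = q1 y + sqrt (sqrt 2) * q3 y"
      "q0 x - sqrt (sqrt 2) * q2 x = q0 y - sqrt (sqrt 2) * q2 y"
      by (simp_all add: matB_def Let_def vec_eq_iff forall_2 vector_2 mult.assoc)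
    then have "sqrt (sqrt 2) * q2 x = sqrt (sqrt 2) * q2 y"
      "sqrt (sqrt 2) * q3 x = sqrt (sqrt 2) * q3 y" by linarith+
    then have "q2 x = q2 y" "q3 x = q3 y" using s by auto
    with * show "x = y" by (simp add: bquat_eq_iff)
  qed
  show "surj matB"
  proof (rule surjI)
    fix A :: "real^2^2"
    let ?s = "sqrt (sqrt 2)"
    show "matB (BQ ((A$1$1 + A$2$2) / 2) ((A$2$1 - A$1$2 / 3) / 2)
      ((A$1$1 - A$2$2) / (2 * ?s)) ((A$2$1 + A$1$2 / 3) / (2 * ?s))) = A"
      using s by (simp add: matB_def Let_def vec_eq_iff forall_2 vector_2 field_simps)
  qed
qed

definition hyp_plane :: "complex set" where
  "hyp_plane = {z. Im z > 0}"

definition hyp_dist :: "complex \<Rightarrow> complex \<Rightarrow> real" where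
  "hyp_dist z w = arcosh (1 + (cmod (z - w))\<^sup>2 / (2 * Im z * Im w))"

definition mact :: "real^2^2 \<Rightarrow> complex \<Rightarrow> complex" where
  "mact A = moebius (of_real (A$1$1)) (of_real (A$1$2)) (of_real (A$2$1)) (of_real (A$2$2))"

definition orbit_map :: "(real^2^2) set \<Rightarrow> complex \<Rightarrow> complex set" where
  "orbit_map \<Gamma> z = (\<lambda>A. mact A z) ` \<Gamma>"

definition hyp_quotient :: "(real^2^2) set \<Rightarrow> complex set topology" where
  "hyp_quotient \<Gamma> = topology (\<lambda>U. U \<subseteq> orbit_map \<Gamma> ` hyp_plane \<and>
     openin (top_of_set hyp_plane) {z \<in> hyp_plane. orbit_map \<Gamma> z \<in> U})"

lemma openin_hyp_quotient:
  "openin (hyp_quotient \<Gamma>) U \<longleftrightarrow> U \<subseteq> orbit_map \<Gamma> ` hyp_plane \<and>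
     openin (top_of_set hyp_plane) {z \<in> hyp_plane. orbit_map \<Gamma> z \<in> U}"
proof -
  let ?P = "\<lambda>U. U \<subseteq> orbit_map \<Gamma> ` hyp_plane \<and>
     openin (top_of_set hyp_plane) {z \<in> hyp_plane. orbit_map \<Gamma> z \<in> U}"
  have "istopology ?P"
    unfolding istopology_def
  proof safe
    fix S T
    assume "openin (top_of_set hyp_plane) {z \<in> hyp_plane. orbit_map \<Gamma> z \<in> S}"
      "openin (top_of_set hyp_plane) {z \<in> hyp_plane. orbit_map \<Gamma> z \<in> T}"
    moreover have "{z \<in> hyp_plane. orbit_map \<Gamma> z \<in> S \<inter> T}
      = {z \<in> hyp_plane. orbit_map \<Gamma> z \<in> S} \<inter> {z \<in> hyp_plane. orbit_map \<Gamma> z \<in> T}" by blast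
    ultimately show "openin (top_of_set hyp_plane) {z \<in> hyp_plane. orbit_map \<Gamma> z \<in> S \<inter> T}"
      by (simp only: openin_Int)
  next
    fix \<U> assume *: "\<forall>U\<in>\<U>. ?P U"
    have "{z \<in> hyp_plane. orbit_map \<Gamma> z \<in> \<Union>\<U>}
      = \<Union> ((\<lambda>U. {z \<in> hyp_plane. orbit_map \<Gamma> z \<in> U}) ` \<U>)" by blast
    moreover have "openin (top_of_set hyp_plane) \<dots>"
      by (rule openin_Union) (use * in auto)
    ultimately show "openin (top_of_set hyp_plane) {z \<in> hyp_plane. orbit_map \<Gamma> z \<in> \<Union>\<U>}"
      by simp
  qed blast+
  then show ?thesis unfolding hyp_quotient_def by simp
qed

lemma quotient_map_orbit: "quotient_map (top_of_set hyp_plane) (hyp_quotient \<Gamma>) (orbit_map \<Gamma>)"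
proof -
  have eq: "{z \<in> hyp_plane. orbit_map \<Gamma> z \<in> orbit_map \<Gamma> ` hyp_plane} = hyp_plane" by blast
  have "openin (hyp_quotient \<Gamma>) (orbit_map \<Gamma> ` hyp_plane)"
    unfolding openin_hyp_quotient eq by simp
  then have "topspace (hyp_quotient \<Gamma>) = orbit_map \<Gamma> ` hyp_plane"
    by (metis openin_hyp_quotient openin_subset openin_topspace subset_antisym)
  then show ?thesis unfolding quotient_map_def by (auto simp: openin_hyp_quotient)
qed

text \<open>A closed geodesic of length \<open>L\<close> on the quotient is given by a lift to a unit-speed geodesic
  line \<open>c\<close> whose translate by \<open>L\<close> is induced by an element of the group.\<close>

definition closed_geodesic_length :: "(real^2^2) set \<Rightarrow> real \<Rightarrow> bool" where
  "closed_geodesic_length \<Gamma> L \<longleftrightarrow> L > 0 \<and>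
     (\<exists>c :: real \<Rightarrow> complex. range c \<subseteq> hyp_plane \<and> (\<forall>s t. hyp_dist (c s) (c t) = \<bar>s - t\<bar>) \<and>
        (\<exists>A\<in>\<Gamma>. \<forall>t. mact A (c t) = c (t + L)))"

definition systole :: "(real^2^2) set \<Rightarrow> real" where
  "systole \<Gamma> = Inf {L. closed_geodesic_length \<Gamma> L}"

definition int_independent :: "('a, 'b) monoid_scheme \<Rightarrow> 'a set \<Rightarrow> bool" where
  "int_independent G S \<longleftrightarrow> S \<subseteq> carrier G \<and>
     (\<forall>f :: 'a \<Rightarrow> int. finprod G (\<lambda>x. x [^]\<^bsub>G\<^esub> f x) S = \<one>\<^bsub>G\<^esub> \<longrightarrow> (\<forall>x\<in>S. f x = 0))"

text \<open>The rank of an abelian group: the largest size of a finite subset that is linearly independent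
  over the integers. It is only meaningful when these sizes are bounded.\<close>

definition abelian_rank :: "('a, 'b) monoid_scheme \<Rightarrow> nat" where
  "abelian_rank G = Sup {card S | S. finite S \<and> int_independent G S}"

text \<open>The genus of a closed connected orientable surface: its first homology group is free abelian
  of rank twice the genus.\<close>

definition genus :: "'a topology \<Rightarrow> nat" where
  "genus X = abelian_rank (homology_group 1 X) div 2"

definition Gamma_B :: "real set \<Rightarrow> (real^2^2) set" where
  "Gamma_B I = matB ` QB1_cong I"

end

theory Submission
  imports Defs
begin

text \<open>Every nonzero ideal of \<open>\<int>[sqrt 2]\<close> is principal, say generated by \<open>d\<close>; let \<open>N\<close> be the absolute norm
of \<open>d\<close>. The congruence subgroup of level \<open>d\<close> has systole at least \<open>2 ln (N\<^sup>2/4 - 3)\<close> and its quotient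
surface has genus at most \<open>N\<^sup>3/12 + 1\<close>, as soon as \<open>N \<ge> 20\<close>. Since \<open>(N\<^sup>3/12 + 1)\<^sup>2 < (N\<^sup>2/4 - 3)\<^sup>3\<close>
in that range, only the finitely many ideals of norm below 20 can violate the inequality.

Under the conjugate embedding \<open>sqrt 2 \<mapsto> - sqrt 2\<close> the quaternion algebra becomes definite,
so traces of norm one elements have conjugates of absolute value at most 2. If \<open>x = 1 + d w \<noteq> 1\<close> has
norm one, then \<open>trd x - 2 = - d\<^sup>2 nrd w\<close>, whence \<open>N\<^sup>2 \<le> 4 \<bar>trd x - 2\<bar>\<close> (\<open>Gam_trd\<close>). Large traces mean large
displacement (\<open>rmob_displacement\<close>), which gives the length bound (\<open>systole_bound\<close>) and also shows that
the projection to the surface is injective on balls of a definite size.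

The group of norm one elements reduces modulo \<open>d\<close> to at most \<open>2 N\<^sup>3\<close> residues (\<open>idx_le\<close>). One
prime factor is added at a time. A repeated prime with residue field of size \<open>q\<close> contributes the trace
zero elements of the residue algebra, at most \<open>q\<^sup>3\<close>. A new prime not dividing \<open>sqrt 2\<close> contributes at
most \<open>q\<^sup>3\<close> because the residue algebra contains a nonzero isotropic vector \<open>v\<close>, and the fibres of
\<open>x \<mapsto> x v\<close> on norm one residues lie in translates of the trace zero part of the annihilator of \<open>v\<close>. For
the prime \<open>sqrt 2\<close> the trivial bound \<open>q\<^sup>4 = 2 q\<^sup>3\<close> suffices.

The element \<open>zB = alphaB * betaB\<close> is a rotation of order four modulo sign about a point
\<open>z0\<close>, and \<open>alphaB\<close> is a rotation of order three modulo sign. The group \<open>G0\<close> that they generate acts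
transitively on the whole orbit of \<open>z0\<close> (\<open>G0_reduction\<close>): moving a point of the orbit by \<open>G0\<close> as close to
\<open>z0\<close> as possible puts it into a regular octagon around \<open>z0\<close>, where the hyperbolic cosine of the distance
exceeds 1 by less than \<open>1/2\<close>. This excess is an integer of the field whose conjugate is at most 2 in
absolute value, so its norm is below 1 and it vanishes. The orbit is the vertex set of the tessellation
of the plane by equilateral triangles, eight around each vertex; the edges are the segments from \<open>g z0\<close>
to \<open>g alphaB z0\<close>.

Small singular simplices of the quotient lift to the half plane, where cycles bound. So each
one-cycle of the surface is homologous to a combination of the \<open>n \<le> 2 N\<^sup>3\<close> images of edges
(\<open>cycle_homologous_to_edges\<close>). Each edge lies on a triangle fixed by a conjugate of \<open>alphaB\<close> and on one
fixed by a conjugate of \<open>yB = alphaB * qconj zB\<close>, and triangles bound. A count in linear algebra over the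
edges replaces the Euler characteristic (\<open>rank_count\<close>): independent classes, triangles and coboundaries
of vertex functions are linearly independent up to one relation for each of the last two kinds; there
are at least \<open>2 n / 3\<close> triangles and \<open>n / 4\<close> vertices, so the rank is at most \<open>n / 12 + 2\<close> and the genus
at most \<open>n / 24 + 1\<close>.\<close>

section \<open>The ring of integers\<close>

abbreviation Zs :: "real set" where "Zs \<equiv> carrier OK"

lemma Zs_eq: "Zs = {real_of_int a + real_of_int b * sqrt 2 | a b. True}"
  by (simp add: OK_def)

lemma Zs_I: "x = real_of_int a + real_of_int b * sqrt 2 \<Longrightarrow> x \<in> Zs"
  by (auto simp: Zs_eq)

lemma Zs_E: assumes "x \<in> Zs" obtains a b where "x = real_of_int a + real_of_int b * sqrt 2"
  using assms by (auto simp: Zs_eq)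

lemma OK_sel: "mult OK = (*)" "one OK = 1" "Ring.zero OK = 0" "Ring.add OK = (+)"
  by (simp_all add: OK_def)

lemma Zs_mult: "x \<in> Zs \<Longrightarrow> y \<in> Zs \<Longrightarrow> x * y \<in> Zs"
  using cring.cring_simprules(5)[OF cring_OK] by (simp add: OK_sel)

lemma Zs_add: "x \<in> Zs \<Longrightarrow> y \<in> Zs \<Longrightarrow> x + y \<in> Zs"
  using cring.cring_simprules(1)[OF cring_OK] by (simp add: OK_sel)

lemma Zs_int [simp]: "of_int k \<in> Zs"
  by (rule Zs_I[of _ k 0]) simp

lemma Zs_numeral [simp]: "0 \<in> Zs" "1 \<in> Zs" "numeral n \<in> Zs" "sqrt 2 \<in> Zs"
  using Zs_int[of 0] Zs_int[of 1] Zs_int[of "numeral n"] Zs_I[of "sqrt 2" 0 1] by simp_all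

lemma Zs_uminus: "x \<in> Zs \<Longrightarrow> - x \<in> Zs"
  using Zs_mult[of "-1" x] Zs_int[of "-1"] by simp

lemma Zs_diff: "x \<in> Zs \<Longrightarrow> y \<in> Zs \<Longrightarrow> x - y \<in> Zs"
  using Zs_add[of x "-y"] Zs_uminus by simp

lemma Zs_power: "x \<in> Zs \<Longrightarrow> x ^ n \<in> Zs"
  by (induction n) (simp_all add: Zs_mult)

lemmas Zs_closed = Zs_mult Zs_add Zs_uminus Zs_diff Zs_power

lemma sqrt2_irrational: assumes "real_of_int a + real_of_int b * sqrt 2 = 0" shows "a = 0 \<and> b = 0"
proof -
  have b: "b = 0"
  proof (rule ccontr)
    assume "b \<noteq> 0"
    then have "sqrt 2 = - real_of_int a / real_of_int b" using assms by (simp add: field_simps)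
    then have "sqrt 2 \<in> \<rat>" by (metis Rats_divide Rats_minus_iff Rats_of_int)
    then obtain m n :: nat where n: "n \<noteq> 0" and sq: "\<bar>sqrt 2\<bar> = real m / real n" and cop: "coprime m n"
      by (rule Rats_abs_nat_div_natE)
    have "real m = sqrt 2 * real n" using n sq by (simp add: field_simps)
    then have "real (m\<^sup>2) = real (2 * n\<^sup>2)" by (simp add: power_mult_distrib)
    then have eq: "m\<^sup>2 = 2 * n\<^sup>2" by (simp only: of_nat_eq_iff)
    then have "even m" by (metis dvd_triv_left even_power)
    then obtain k where "m = 2 * k" by blast
    with eq have "n\<^sup>2 = 2 * k\<^sup>2" by (simp add: power2_eq_square)
    then have "even n" by (metis dvd_triv_left even_power)
    with \<open>even m\<close> cop show False by (meson coprime_common_divisor odd_one)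
  qed
  with assms show ?thesis by simp
qed

lemma Zs_unique:
  assumes "real_of_int a + real_of_int b * sqrt 2 = real_of_int c + real_of_int d * sqrt 2"
  shows "a = c" "b = d"
  using sqrt2_irrational[of "a - c" "b - d"] assms by (auto simp: algebra_simps)

text \<open>Conjugation \<open>sqrt 2 \<mapsto> - sqrt 2\<close> of the ring of integers, transported to the reals through its unique
  coordinates.\<close>

definition conj2 :: "real \<Rightarrow> real" where
  "conj2 x = (THE y. \<exists>a b. x = real_of_int a + real_of_int b * sqrt 2 \<and>
                        y = real_of_int a - real_of_int b * sqrt 2)"

lemma conj2_eq: "conj2 (real_of_int a + real_of_int b * sqrt 2) = real_of_int a - real_of_int b * sqrt 2"
  unfolding conj2_def
proof (rule the_equality)
  fix y assume "\<exists>c d. real_of_int a + real_of_int b * sqrt 2 = real_of_int c + real_of_int d * sqrt 2 \<and>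
                        y = real_of_int c - real_of_int d * sqrt 2"
  then obtain c d where 1: "real_of_int a + real_of_int b * sqrt 2 = real_of_int c + real_of_int d * sqrt 2"
     and 2: "y = real_of_int c - real_of_int d * sqrt 2" by blast
  from Zs_unique[OF 1] 2 show "y = real_of_int a - real_of_int b * sqrt 2" by simp
qed blast

lemma conj2_Zs: "x \<in> Zs \<Longrightarrow> conj2 x \<in> Zs"
  by (erule Zs_E) (simp only: conj2_eq, rule Zs_I[of _ _ "- _"], simp)

lemma conj2_int [simp]: "conj2 (of_int k) = of_int k"
  using conj2_eq[of k 0] by simp

lemma conj2_numeral [simp]: "conj2 0 = 0" "conj2 1 = 1" "conj2 (numeral n) = numeral n" "conj2 (sqrt 2) = - sqrt 2"
  using conj2_int[of 0] conj2_int[of 1] conj2_int[of "numeral n"] conj2_eq[of 0 1] by simp_all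

lemma conj2_add: assumes "x \<in> Zs" "y \<in> Zs" shows "conj2 (x + y) = conj2 x + conj2 y"
proof -
  obtain a b where x: "x = real_of_int a + real_of_int b * sqrt 2" using assms(1) by (rule Zs_E)
  obtain c d where y: "y = real_of_int c + real_of_int d * sqrt 2" using assms(2) by (rule Zs_E)
  have e: "x + y = real_of_int (a + c) + real_of_int (b + d) * sqrt 2" by (simp add: x y algebra_simps)
  show ?thesis unfolding e conj2_eq unfolding x y conj2_eq by (simp add: algebra_simps)
qed

lemma conj2_mult: assumes "x \<in> Zs" "y \<in> Zs" shows "conj2 (x * y) = conj2 x * conj2 y"
proof -
  obtain a b where x: "x = real_of_int a + real_of_int b * sqrt 2" using assms(1) by (rule Zs_E)
  obtain c d where y: "y = real_of_int c + real_of_int d * sqrt 2" using assms(2) by (rule Zs_E)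
  have e: "x * y = real_of_int (a * c + 2 * b * d) + real_of_int (a * d + b * c) * sqrt 2"
    by (simp add: x y algebra_simps)
  show ?thesis unfolding e conj2_eq unfolding x y conj2_eq by (simp add: algebra_simps)
qed

lemma conj2_uminus: assumes "x \<in> Zs" shows "conj2 (- x) = - conj2 x"
  using conj2_mult[of "-1" x] conj2_int[of "-1"] Zs_int[of "-1"] assms by simp

lemma conj2_diff: assumes "x \<in> Zs" "y \<in> Zs" shows "conj2 (x - y) = conj2 x - conj2 y"
  using conj2_add[of x "-y"] conj2_uminus[of y] assms Zs_uminus by simp

lemma conj2_power: "x \<in> Zs \<Longrightarrow> conj2 (x ^ n) = conj2 x ^ n"
  by (induction n) (simp_all add: conj2_mult Zs_power)

lemmas conj2_hom = conj2_add conj2_mult conj2_uminus conj2_diff conj2_power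

definition anorm :: "real \<Rightarrow> real" where "anorm x = \<bar>x * conj2 x\<bar>"

lemma anorm_eq: "anorm (real_of_int a + real_of_int b * sqrt 2) = of_int \<bar>a\<^sup>2 - 2 * b\<^sup>2\<bar>"
  unfolding anorm_def conj2_eq by (simp add: algebra_simps power2_eq_square)

lemma anorm_mult: "x \<in> Zs \<Longrightarrow> y \<in> Zs \<Longrightarrow> anorm (x * y) = anorm x * anorm y"
  by (simp add: anorm_def conj2_mult abs_mult)

lemma anorm_nat: assumes "x \<in> Zs" obtains n :: nat where "anorm x = real n"
proof -
  obtain a b where x: "x = real_of_int a + real_of_int b * sqrt 2" using assms by (rule Zs_E)
  show ?thesis by (rule that[of "nat \<bar>a\<^sup>2 - 2 * b\<^sup>2\<bar>"]) (simp only: x anorm_eq of_nat_nat abs_ge_zero)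
qed

lemma conj2_eq_0: assumes "x \<in> Zs" "conj2 x = 0" shows "x = 0"
proof -
  obtain a b where x: "x = real_of_int a + real_of_int b * sqrt 2" using assms by (meson Zs_E)
  with assms(2) have "real_of_int a + real_of_int (-b) * sqrt 2 = 0" by (simp add: x conj2_eq)
  from sqrt2_irrational[OF this] show ?thesis by (simp add: x)
qed

lemma anorm_ge_1: assumes "x \<in> Zs" "x \<noteq> 0" shows "anorm x \<ge> 1"
proof -
  obtain n where n: "anorm x = real n" using assms by (meson anorm_nat)
  have "anorm x \<noteq> 0" using assms conj2_eq_0 by (auto simp: anorm_def)
  with n show ?thesis by (cases n) auto
qed

lemma anorm_unit: assumes "x \<in> Zs" "anorm x = 1" shows "\<exists>u\<in>Zs. x * u = 1"
proof -
  have "x * conj2 x = 1 \<or> x * - conj2 x = 1" using assms by (auto simp: anorm_def abs_if split: if_splits)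
  then show ?thesis using assms conj2_Zs Zs_uminus by blast
qed

text \<open>Divisibility in the ring of integers; the predefined \<open>dvd\<close> on reals is trivial.\<close>

definition odvd :: "real \<Rightarrow> real \<Rightarrow> bool" where
  "odvd d x \<longleftrightarrow> (\<exists>y\<in>Zs. x = d * y)"

lemma odvd_Zs: "odvd d x \<Longrightarrow> d \<in> Zs \<Longrightarrow> x \<in> Zs" by (auto simp: odvd_def Zs_mult)
lemma odvd_0 [simp]: "odvd d 0" by (auto simp: odvd_def intro!: bexI[of _ 0])
lemma odvd_self [simp]: "odvd d d" by (auto simp: odvd_def intro!: bexI[of _ 1])
lemma odvd_multI: "y \<in> Zs \<Longrightarrow> odvd d (d * y)" by (auto simp: odvd_def)
lemma odvd_add: "odvd d x \<Longrightarrow> odvd d y \<Longrightarrow> odvd d (x + y)"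
  unfolding odvd_def by (metis Zs_add distrib_left)
lemma odvd_mult: "odvd d x \<Longrightarrow> y \<in> Zs \<Longrightarrow> odvd d (x * y)"
  unfolding odvd_def by (metis Zs_mult mult.assoc)
lemma odvd_mult2: "odvd d x \<Longrightarrow> y \<in> Zs \<Longrightarrow> odvd d (y * x)"
  using odvd_mult by (simp add: mult.commute)
lemma odvd_uminus: "odvd d x \<Longrightarrow> odvd d (- x)"
  using odvd_mult2[of d x "-1"] Zs_int[of "-1"] by simp
lemma odvd_diff: "odvd d x \<Longrightarrow> odvd d y \<Longrightarrow> odvd d (x - y)"
  using odvd_add[of d x "-y"] odvd_uminus by simp
lemma odvd_trans: "odvd d e \<Longrightarrow> odvd e x \<Longrightarrow> odvd d x"
  unfolding odvd_def by (metis Zs_mult mult.assoc)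

lemma odvd_anorm_le: assumes "d \<in> Zs" "odvd d x" "x \<noteq> 0" shows "anorm d \<le> anorm x"
proof -
  obtain y where y: "y \<in> Zs" "x = d * y" using assms by (auto simp: odvd_def)
  have "anorm x = anorm d * anorm y" using y assms anorm_mult by simp
  moreover have "anorm y \<ge> 1" using y assms by (intro anorm_ge_1) auto
  moreover have "anorm d \<ge> 0" by (simp add: anorm_def)
  ultimately show ?thesis by (simp add: mult_le_cancel_left1)
qed

lemma odvd_anorm_eq: assumes "d \<in> Zs" "odvd d x" "x \<noteq> 0" "anorm d = anorm x" shows "odvd x d"
proof -
  obtain y where y: "y \<in> Zs" "x = d * y" using assms by (auto simp: odvd_def)
  have "anorm x = anorm d * anorm y" using y assms anorm_mult by simp
  moreover have "anorm d \<ge> 1" using y assms by (intro anorm_ge_1) auto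
  ultimately have "anorm y = 1" using assms by simp
  then obtain u where "u \<in> Zs" "y * u = 1" using anorm_unit y by blast
  then show ?thesis using y by (auto simp: odvd_def mult.assoc intro!: bexI[of _ u])
qed

text \<open>The norm-Euclidean division: the rounding error of each coordinate of \<open>x/y\<close> is at most
  one half, and \<open>\<bar>u\<^sup>2 - 2v\<^sup>2\<bar> \<le> 1/2\<close> for such errors.\<close>

lemma Zs_euclid: assumes "x \<in> Zs" "y \<in> Zs" "y \<noteq> 0"
  shows "\<exists>q\<in>Zs. anorm (x - q * y) < anorm y"
proof -
  let ?N = "y * conj2 y"
  have N0: "?N \<noteq> 0" using assms conj2_eq_0 by auto
  obtain a b where xy: "x * conj2 y = real_of_int a + real_of_int b * sqrt 2"
    using assms conj2_Zs Zs_mult by (meson Zs_E)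
  obtain k where k: "?N = of_int k"
  proof -
    obtain c d where y: "y = real_of_int c + real_of_int d * sqrt 2" using assms by (meson Zs_E)
    show ?thesis by (rule that[of "c\<^sup>2 - 2*d\<^sup>2"]) (simp only: y conj2_eq, simp add: algebra_simps power2_eq_square)
  qed
  define m where "m = round (a / of_int k :: real)"
  define n where "n = round (b / of_int k :: real)"
  define u where "u = a / of_int k - real_of_int m"
  define v where "v = b / of_int k - real_of_int n"
  have u: "\<bar>u\<bar> \<le> 1/2" unfolding u_def m_def using of_int_round_abs_le by (metis abs_minus_commute)
  have v: "\<bar>v\<bar> \<le> 1/2" unfolding v_def n_def using of_int_round_abs_le by (metis abs_minus_commute)
  let ?q = "real_of_int m + real_of_int n * sqrt 2"
  have q: "?q \<in> Zs" by (rule Zs_I) simp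
  have "(x - ?q * y) * conj2 y = x * conj2 y - ?q * ?N" by (simp add: algebra_simps)
  also have "\<dots> = ?N * (u + v * sqrt 2)"
    unfolding xy k using N0 k by (simp add: u_def v_def field_simps)
  finally have e: "x - ?q * y = y * (u + v * sqrt 2)"
    using N0 mult_right_cancel[of "conj2 y" "x - ?q * y" "y * (u + v * sqrt 2)"] by (simp add: mult_ac)
  have e2: "real_of_int (a - k*m) + real_of_int (b - k * n) * sqrt 2 = (x - ?q * y) * conj2 y"
    by (simp add: algebra_simps xy flip: k)
  have z: "x - ?q * y \<in> Zs" using assms q Zs_closed by simp
  have "conj2 ((x - ?q * y) * conj2 y) = real_of_int (a - k*m) - real_of_int (b - k * n) * sqrt 2"
    unfolding e2[symmetric] conj2_eq ..
  moreover have "real_of_int (a - k*m) = of_int k * u" "real_of_int (b - k*n) = of_int k * v"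
    using N0 k by (simp_all add: u_def v_def field_simps)
  ultimately have c2: "conj2 ((x - ?q * y) * conj2 y) = of_int k * (u - v * sqrt 2)"
    by (simp add: algebra_simps)
  have cc: "conj2 (conj2 y) = y"
  proof -
    obtain c d where y: "y = real_of_int c + real_of_int d * sqrt 2" using assms by (meson Zs_E)
    show ?thesis using conj2_eq[of c "-d"] by (simp add: y conj2_eq)
  qed
  have "conj2 (x - ?q * y) * y = ?N * (u - v * sqrt 2)"
    using c2 conj2_mult[OF z conj2_Zs[OF assms(2)]] by (simp only: cc k)
  then have e3: "conj2 (x - ?q * y) = conj2 y * (u - v * sqrt 2)"
    using assms mult_right_cancel[of y "conj2 (x - ?q * y)" "conj2 y * (u - v * sqrt 2)"] by (simp add: mult_ac)
  have "(x - ?q * y) * conj2 (x - ?q * y) = ?N * (u\<^sup>2 - 2 * v\<^sup>2)"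
    unfolding e3 unfolding e by (simp add: algebra_simps power2_eq_square)
  then have nn: "anorm (x - ?q * y) = anorm y * \<bar>u\<^sup>2 - 2 * v\<^sup>2\<bar>" unfolding anorm_def by (simp only: abs_mult)
  have "u\<^sup>2 \<le> (1/2)\<^sup>2" "v\<^sup>2 \<le> (1/2)\<^sup>2" using u v abs_le_square_iff[of u "1/2"] abs_le_square_iff[of v "1/2"] by auto
  then have "\<bar>u\<^sup>2 - 2 * v\<^sup>2\<bar> \<le> 1/2" using zero_le_power2[of u] zero_le_power2[of v]
    unfolding abs_le_iff power_divide by (simp; linarith?)
  then have "anorm y * \<bar>u\<^sup>2 - 2 * v\<^sup>2\<bar> \<le> anorm y * (1/2)" by (intro mult_left_mono) (simp_all add: anorm_def)
  also have "\<dots> < anorm y" using anorm_ge_1[OF assms(2,3)] by simp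
  finally have "anorm (x - ?q * y) < anorm y" by (simp only: nn)
  with q show ?thesis by blast
qed

text \<open>By Euclidean division, an element of least norm divides all others.\<close>

lemma additive_ideal_principal:
  assumes I: "I \<subseteq> Zs" "\<And>x y. x \<in> I \<Longrightarrow> y \<in> I \<Longrightarrow> x - y \<in> I" "\<And>x y. x \<in> I \<Longrightarrow> y \<in> Zs \<Longrightarrow> y * x \<in> I"
    and "z \<in> I" "z \<noteq> 0"
  shows "\<exists>d\<in>I. d \<noteq> 0 \<and> I = {x. odvd d x}"
proof -
  define f where "f x = nat \<lfloor>anorm x\<rfloor>" for x
  have f: "real (f x) = anorm x" if "x \<in> Zs" for x using that by (metis f_def floor_of_nat nat_int anorm_nat)
  obtain d where d: "d \<in> I" "d \<noteq> 0" "\<And>y. y \<in> I \<Longrightarrow> y \<noteq> 0 \<Longrightarrow> f d \<le> f y"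
    using ex_has_least_nat[of "\<lambda>x. x \<in> I \<and> x \<noteq> 0" z f] assms(4,5) by blast
  have dZ: "d \<in> Zs" using d(1) I(1) by (rule rev_subsetD)
  have 1: "odvd d x" if x: "x \<in> I" for x
  proof -
    have xZ: "x \<in> Zs" using x I(1) by (rule rev_subsetD)
    obtain q where q: "q \<in> Zs" "anorm (x - q * d) < anorm d" using Zs_euclid[OF xZ dZ d(2)] by (elim bexE)
    have r: "x - q * d \<in> I" using x I(3)[OF d(1) q(1)] by (rule I(2))
    have rZ: "x - q * d \<in> Zs" using r I(1) by (rule rev_subsetD)
    have "\<not> f d \<le> f (x - q * d)" using q(2) f[OF dZ] f[OF rZ] by linarith
    then have "x - q * d = 0" using d(3)[OF r] by blast
    then show ?thesis using q(1) unfolding odvd_def by (intro bexI[of _ q]) simp_all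
  qed
  have 2: "x \<in> I" if x: "odvd d x" for x
  proof -
    obtain y where y: "y \<in> Zs" "x = d * y" using x unfolding odvd_def by (elim bexE)
    show ?thesis using I(3)[OF d(1) y(1)] unfolding y(2) by (simp only: mult.commute)
  qed
  have "I = {x. odvd d x}" using 1 2 by (intro equalityI subsetI CollectI) simp_all
  with d(2) have "d \<noteq> 0 \<and> I = {x. odvd d x}" by (rule conjI)
  then show ?thesis using d(1) by (rule bexI)
qed

definition lincomb :: "real \<Rightarrow> real \<Rightarrow> real set" where
  "lincomb x y = {a. \<exists>u\<in>Zs. \<exists>v\<in>Zs. a = u * x + v * y}"

lemma lincombI: "a = u * x + v * y \<Longrightarrow> u \<in> Zs \<Longrightarrow> v \<in> Zs \<Longrightarrow> a \<in> lincomb x y"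
  unfolding lincomb_def mem_Collect_eq by (rule bexI, rule bexI)

lemma lincombE: assumes "a \<in> lincomb x y" obtains u v where "a = u * x + v * y" "u \<in> Zs" "v \<in> Zs"
  using assms unfolding lincomb_def mem_Collect_eq by (elim bexE)

lemma Zs_bezout: assumes "x \<in> Zs" "y \<in> Zs" "x \<noteq> 0"
  shows "\<exists>g\<in>Zs. g \<noteq> 0 \<and> odvd g x \<and> odvd g y \<and> (\<exists>u\<in>Zs. \<exists>v\<in>Zs. g = u * x + v * y)"
proof -
  let ?I = "lincomb x y"
  have sub: "?I \<subseteq> Zs"
  proof
    fix a assume "a \<in> ?I"
    then show "a \<in> Zs" by (rule lincombE) (simp add: Zs_add Zs_mult assms)
  qed
  have dif: "a - b \<in> ?I" if ab: "a \<in> ?I" "b \<in> ?I" for a b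
  proof -
    obtain u v where 1: "a = u * x + v * y" "u \<in> Zs" "v \<in> Zs" using ab(1) by (rule lincombE)
    obtain u' v' where 2: "b = u' * x + v' * y" "u' \<in> Zs" "v' \<in> Zs" using ab(2) by (rule lincombE)
    show ?thesis by (rule lincombI[of _ "u - u'" _ "v - v'"]) (simp_all add: 1 2 algebra_simps Zs_diff)
  qed
  have mul: "c * a \<in> ?I" if ab: "a \<in> ?I" "c \<in> Zs" for a c
  proof -
    obtain u v where 1: "a = u * x + v * y" "u \<in> Zs" "v \<in> Zs" using ab(1) by (rule lincombE)
    show ?thesis by (rule lincombI[of _ "c * u" _ "c * v"]) (simp_all add: 1 ab(2) algebra_simps Zs_mult)
  qed
  have xI: "x \<in> ?I" by (rule lincombI[of _ 1 _ 0]) simp_all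
  have yI: "y \<in> ?I" by (rule lincombI[of _ 0 _ 1]) simp_all
  have "\<exists>d\<in>?I. d \<noteq> 0 \<and> ?I = {x. odvd d x}"
    by (rule additive_ideal_principal[where z = x]) (fact sub, erule (1) dif, erule (1) mul, fact xI, fact)
  then obtain d where d: "d \<in> ?I" "d \<noteq> 0" "?I = {x. odvd d x}" by (elim bexE conjE)
  have dv: "odvd d x" "odvd d y" using xI yI unfolding d(3) by simp_all
  obtain u v where uv: "d = u * x + v * y" "u \<in> Zs" "v \<in> Zs"
    using d(1) by (rule lincombE)
  have dZ: "d \<in> Zs" unfolding uv(1) using uv(2,3) assms by (simp add: Zs_closed)
  have "\<exists>v\<in>Zs. d = u * x + v * y" using uv(1,3) by (rule bexI)
  then have "\<exists>u\<in>Zs. \<exists>v\<in>Zs. d = u * x + v * y" using uv(2) by (rule bexI)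
  then have "d \<noteq> 0 \<and> odvd d x \<and> odvd d y \<and> (\<exists>u\<in>Zs. \<exists>v\<in>Zs. d = u * x + v * y)"
    using d(2) dv by (intro conjI)
  then show ?thesis using dZ by (rule bexI)
qed

lemma ideal_OK_closed:
  assumes "ideal I OK"
  shows "I \<subseteq> Zs" "0 \<in> I" "\<And>x y. x \<in> I \<Longrightarrow> y \<in> Zs \<Longrightarrow> y * x \<in> I" "\<And>x y. x \<in> I \<Longrightarrow> y \<in> I \<Longrightarrow> x + y \<in> I"
proof -
  have ag: "additive_subgroup I OK" by (rule ideal.axioms(1)[OF assms])
  show "I \<subseteq> Zs" using additive_subgroup.a_subset[OF ag] .
  show "0 \<in> I" using additive_subgroup.zero_closed[OF ag] unfolding OK_sel .
  show "y * x \<in> I" if "x \<in> I" "y \<in> Zs" for x y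
    using ideal.I_l_closed[OF assms that] unfolding OK_sel .
  show "x + y \<in> I" if "x \<in> I" "y \<in> I" for x y
    using additive_subgroup.a_closed[OF ag that] unfolding OK_sel .
qed

lemma ideal_OK_principal: assumes "ideal I OK" "I \<noteq> {0}"
  shows "\<exists>d\<in>Zs. d \<noteq> 0 \<and> I = {x. odvd d x}"
proof -
  note I = ideal_OK_closed[OF assms(1)]
  obtain z where z: "z \<in> I" "z \<noteq> 0" using assms(2) I(2) by blast
  have m1: "-1 \<in> Zs" by (rule Zs_uminus) simp
  have a: "x - y \<in> I" if "x \<in> I" "y \<in> I" for x y
    using I(4)[OF that(1) I(3)[OF that(2) m1]] by simp
  have "\<exists>d\<in>I. d \<noteq> 0 \<and> I = {x. odvd d x}"
    by (rule additive_ideal_principal[where z = z]) (fact I, erule (1) a, erule (1) I(3), fact z, fact z)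
  then show ?thesis using I(1) by blast
qed

section \<open>The maximal order\<close>

lemma s2s2 [simp]: "sqrt 2 * (sqrt 2 * x) = 2 * x"
  by (simp flip: mult.assoc)

text \<open>Coordinates with respect to \<open>1\<close>, \<open>alphaB\<close>, \<open>betaB\<close>, \<open>alphaB * betaB\<close>; the product of two basis vectors has
  integral coordinates, so these four elements span the order over the ring of integers.\<close>

definition qb :: "real \<Rightarrow> real \<Rightarrow> real \<Rightarrow> real \<Rightarrow> bquat" where
  "qb a b c d = BQ (a + b/2 + c/2 - sqrt 2 * d/2) (b/2 + c * (1/6 + sqrt 2/3) + d * (1/3 + sqrt 2/6))
     (d/2) (- c/3 - d/6)"

definition trd :: "bquat \<Rightarrow> real" where "trd x = 2 * q0 x"

lemma qb_add: "qb a b c d + qb a' b' c' d' = qb (a + a') (b + b') (c + c') (d + d')"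
  by (simp add: qb_def bquat_defs field_simps)

lemma qb_scale: "r *\<^sub>R qb a b c d = qb (r * a) (r * b) (r * c) (r * d)"
  by (simp add: qb_def bquat_defs field_simps)

lemma qb_diff: "qb a b c d - qb a' b' c' d' = qb (a - a') (b - b') (c - c') (d - d')"
  by (simp add: qb_def bquat_defs field_simps)

lemma qb_mult: "qb a b c d * qb a' b' c' d' =
  qb (a * a' - b * b' - c * c' - (1 + sqrt 2) * c * b' - c * d' - d * b' - d * d')
     (a * b' + b * a' + b * b' + c * b' + c * d' - sqrt 2 * d * b' - d * c')
     (a * c' + c * a' + c * c' + c * b' - sqrt 2 * c * d' + d * b' - b * d')
     (a * d' + d * a' + b * c' - c * b' + b * d' + d * c' - sqrt 2 * d * d')"
  by (simp add: qb_def times_bquat_def bquat_eq_iff field_simps)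

lemma qb_inject: "qb a b c d = qb a' b' c' d' \<longleftrightarrow> a = a' \<and> b = b' \<and> c = c' \<and> d = d'"
  by (auto simp: qb_def)

lemma qb_gens: "1 = qb 1 0 0 0" "0 = qb 0 0 0 0" "alphaB = qb 0 1 0 0" "betaB = qb 0 0 1 0"
proof -
  have 3: "(3 :: bquat) = of_real 3" by simp
  show "1 = qb 1 0 0 0" "0 = qb 0 0 0 0" by (simp_all add: qb_def bquat_defs)
  show "alphaB = qb 0 1 0 0"
    by (simp add: alphaB_def bi_def bquat_defs qb_def)
  show "betaB = qb 0 0 1 0"
    unfolding betaB_def 3 of_real_def by (simp add: bi_def bj_def bquat_defs field_simps qb_def)
qed

lemma qb_of_generators: "qb a b c d = a *\<^sub>R 1 + b *\<^sub>R alphaB + c *\<^sub>R betaB + d *\<^sub>R (alphaB * betaB)"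
  unfolding qb_gens qb_mult qb_scale qb_add by simp

lemma QB_closed:
  shows QB_one: "1 \<in> QB" and QB_add: "x \<in> QB \<Longrightarrow> y \<in> QB \<Longrightarrow> x + y \<in> QB"
    and QB_mult: "x \<in> QB \<Longrightarrow> y \<in> QB \<Longrightarrow> x * y \<in> QB"
    and QB_scale: "a \<in> Zs \<Longrightarrow> x \<in> QB \<Longrightarrow> a *\<^sub>R x \<in> QB"
  using QB_subalgebra unfolding OK_subalgebra_def by simp_all

lemma QB_qb: "a \<in> Zs \<Longrightarrow> b \<in> Zs \<Longrightarrow> c \<in> Zs \<Longrightarrow> d \<in> Zs \<Longrightarrow> qb a b c d \<in> QB"
  unfolding qb_of_generators by (intro QB_add QB_scale QB_mult QB_gens QB_one)

lemma QB_eq: "QB = {qb a b c d | a b c d. a \<in> Zs \<and> b \<in> Zs \<and> c \<in> Zs \<and> d \<in> Zs}" (is "_ = ?S")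
proof
  show "?S \<subseteq> QB" using QB_qb by blast
  have I: "qb a b c d \<in> ?S" if "a \<in> Zs" "b \<in> Zs" "c \<in> Zs" "d \<in> Zs" for a b c d
    using that by blast
  have "OK_subalgebra ?S"
    unfolding OK_subalgebra_def
  proof (intro conjI ballI)
    show "?S \<subseteq> DB"
    proof
      fix x assume "x \<in> ?S"
      then have "x \<in> QB" using QB_qb by blast
      then show "x \<in> DB" using QB_subalgebra unfolding OK_subalgebra_def by blast
    qed
    show "1 \<in> ?S" unfolding qb_gens(1) by (rule I) simp_all
  next
    fix x y assume "x \<in> ?S" "y \<in> ?S"
    then obtain a b c d a' b' c' d' where x: "x = qb a b c d" and y: "y = qb a' b' c' d'"
      and Z: "a \<in> Zs" "b \<in> Zs" "c \<in> Zs" "d \<in> Zs" "a' \<in> Zs" "b' \<in> Zs" "c' \<in> Zs" "d' \<in> Zs" by blast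
    show "x + y \<in> ?S" unfolding x y qb_add by (intro I Zs_add Z)
    show "x * y \<in> ?S" unfolding x y qb_mult by (intro I Zs_add Zs_diff Zs_mult Z Zs_numeral)
  next
    fix a x assume a: "a \<in> Zs" and "x \<in> ?S"
    then obtain b c d e where x: "x = qb b c d e" and Z: "b \<in> Zs" "c \<in> Zs" "d \<in> Zs" "e \<in> Zs" by blast
    show "a *\<^sub>R x \<in> ?S" unfolding x qb_scale by (intro I Zs_mult Z a)
  qed
  moreover have "alphaB \<in> ?S" "betaB \<in> ?S" unfolding qb_gens by (rule I; simp)+
  ultimately show "QB \<subseteq> ?S" unfolding QB_def by (intro hull_minimal) simp_all
qed

lemma QB_E: assumes "x \<in> QB"
  obtains a b c d where "x = qb a b c d" "a \<in> Zs" "b \<in> Zs" "c \<in> Zs" "d \<in> Zs"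
  using assms unfolding QB_eq by blast

lemma QB_uminus: "x \<in> QB \<Longrightarrow> - x \<in> QB"
  using QB_scale[of "-1" x] Zs_uminus[OF Zs_numeral(2)] by simp

lemma QB_diff: "x \<in> QB \<Longrightarrow> y \<in> QB \<Longrightarrow> x - y \<in> QB"
  using QB_add[of x "- y"] QB_uminus[of y] by simp

lemma QB_zero: "0 \<in> QB" using QB_diff[OF QB_one QB_one] by simp

lemma QB_real: "a \<in> Zs \<Longrightarrow> of_real a \<in> QB"
  unfolding of_real_def by (intro QB_scale QB_one)

lemma trd_qb: "trd (qb a b c d) = 2 * a + b + c - sqrt 2 * d"
  by (simp add: trd_def qb_def)

lemma nrd_qb: "nrd (qb a b c d) =
  a * a + b * b + c * c + d * d + a * b + a * c + b * d + c * d - sqrt 2 * a * d + (1 + sqrt 2) * b * c"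
  by (simp add: nrd_def qb_def power2_eq_square field_simps)

lemma QB_trd: "x \<in> QB \<Longrightarrow> trd x \<in> Zs"
  by (erule QB_E, simp only: trd_qb, intro Zs_add Zs_diff Zs_mult Zs_numeral, assumption+)

lemma QB_nrd: "x \<in> QB \<Longrightarrow> nrd x \<in> Zs"
  by (erule QB_E, simp only: nrd_qb, intro Zs_add Zs_diff Zs_mult Zs_numeral, assumption+)

lemma trd_add: "trd (x + y) = trd x + trd y" by (simp add: trd_def plus_bquat_def)
lemma trd_diff: "trd (x - y) = trd x - trd y" by (simp add: trd_def minus_bquat_def)
lemma trd_uminus: "trd (- x) = - trd x" by (simp add: trd_def uminus_bquat_def)
lemma trd_scale: "trd (r *\<^sub>R x) = r * trd x" by (simp add: trd_def scaleR_bquat_def)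
lemma trd_one: "trd 1 = 2" by (simp add: trd_def one_bquat_def)
lemma trd_zero: "trd 0 = 0" by (simp add: trd_def zero_bquat_def)
lemma trd_commute: "trd (x * y) = trd (y * x)" by (simp add: trd_def times_bquat_def)
lemmas trd_simps = trd_add trd_diff trd_uminus trd_scale trd_one trd_zero

lemma qconj_eq: "qconj x = of_real (trd x) - x"
  by (simp add: qconj_def trd_def of_real_def bquat_defs)

lemma QB_qconj: "x \<in> QB \<Longrightarrow> qconj x \<in> QB"
  unfolding qconj_eq by (intro QB_diff QB_real QB_trd)

lemma qconj_mult: "qconj (x * y) = qconj y * qconj x"
  by (simp add: qconj_def times_bquat_def)

lemma qconj_simps [simp]: "qconj (qconj x) = x" "qconj 1 = 1" "qconj 0 = 0"
  "qconj (r *\<^sub>R x) = r *\<^sub>R qconj x" "qconj (x + y) = qconj x + qconj y"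
  "qconj (x - y) = qconj x - qconj y" "qconj (- x) = - qconj x"
  "trd (qconj x) = trd x" "nrd (qconj x) = nrd x"
  by (cases x; simp add: qconj_def bquat_defs trd_def nrd_def)+

lemma nrd_mult: "nrd (x * y) = nrd x * nrd y"
  unfolding det_matB[symmetric] matB_hom by (rule det_mul)

lemma nrd_simps [simp]: "nrd 1 = 1" "nrd 0 = 0" "nrd (- x) = nrd x" "nrd (r *\<^sub>R x) = r\<^sup>2 * nrd x"
  by (simp_all add: nrd_def bquat_defs power_mult_distrib algebra_simps)

lemma nrd_add: "nrd (x + y) = nrd x + nrd y + trd (x * qconj y)"
  by (simp add: nrd_def bquat_defs qconj_def trd_def power2_eq_square algebra_simps)

text \<open>After \<open>sqrt 2 \<mapsto> - sqrt 2\<close> both \<open>i\<^sup>2 = - 3\<close> and \<open>j\<^sup>2 = - sqrt 2\<close> are negative, and the reduced norm turns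
  into a sum of positive multiples of squares. The algebra is ramified at the second real place.\<close>

lemma QB_conj_form: assumes "x \<in> QB"
  shows "\<exists>r0 r1 r2 r3. conj2 (trd x) = 2 * r0 \<and> conj2 (nrd x) = r0\<^sup>2 + 3 * r1\<^sup>2 + sqrt 2 * r2\<^sup>2 + 3 * sqrt 2 * r3\<^sup>2
    \<and> (r1 = 0 \<and> r2 = 0 \<and> r3 = 0 \<longrightarrow> q1 x = 0 \<and> q2 x = 0 \<and> q3 x = 0)"
proof -
  obtain a b c d where x: "x = qb a b c d" and Z: "a \<in> Zs" "b \<in> Zs" "c \<in> Zs" "d \<in> Zs"
    using assms by (rule QB_E)
  let ?r0 = "conj2 a + conj2 b/2 + conj2 c/2 + sqrt 2 * conj2 d/2"
  let ?r1 = "conj2 b/2 + conj2 c * (1/6 - sqrt 2/3) + conj2 d * (1/3 - sqrt 2/6)"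
  let ?r2 = "conj2 d/2"
  let ?r3 = "- conj2 c/3 - conj2 d/6"
  have t: "conj2 (trd x) = 2 * ?r0"
    unfolding x trd_qb by (simp add: conj2_hom Z Zs_closed)
  have "conj2 (nrd x) = conj2 a * conj2 a + conj2 b * conj2 b + conj2 c * conj2 c + conj2 d * conj2 d + conj2 a * conj2 b + conj2 a * conj2 c + conj2 b * conj2 d + conj2 c * conj2 d
     + sqrt 2 * conj2 a * conj2 d + (1 - sqrt 2) * conj2 b * conj2 c"
    unfolding x nrd_qb by (simp add: conj2_hom Z Zs_closed)
  also have "\<dots> = ?r0\<^sup>2 + 3 * ?r1\<^sup>2 + sqrt 2 * ?r2\<^sup>2 + 3 * sqrt 2 * ?r3\<^sup>2"
    by (simp add: power2_eq_square field_simps)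
  finally have n: "conj2 (nrd x) = ?r0\<^sup>2 + 3 * ?r1\<^sup>2 + sqrt 2 * ?r2\<^sup>2 + 3 * sqrt 2 * ?r3\<^sup>2" .
  have "q1 x = 0 \<and> q2 x = 0 \<and> q3 x = 0" if "?r1 = 0 \<and> ?r2 = 0 \<and> ?r3 = 0"
  proof -
    have d0: "conj2 d = 0" using that by simp
    have c0: "conj2 c = 0" using that d0 by simp
    have "conj2 b = 0" using that d0 c0 by simp
    then have "d = 0" "c = 0" "b = 0" using d0 c0 conj2_eq_0 Z by simp_all
    then show ?thesis by (simp add: x qb_def)
  qed
  then have imp: "?r1 = 0 \<and> ?r2 = 0 \<and> ?r3 = 0 \<longrightarrow> q1 x = 0 \<and> q2 x = 0 \<and> q3 x = 0" by (rule impI)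
  show ?thesis
    by (rule_tac x = ?r0 in exI, rule_tac x = ?r1 in exI, rule_tac x = ?r2 in exI, rule_tac x = ?r3 in exI)
      (intro conjI t n imp)
qed

lemma QB_conj_bound: assumes "x \<in> QB" shows "(conj2 (trd x))\<^sup>2 \<le> 4 * conj2 (nrd x)" "0 \<le> conj2 (nrd x)"
proof -
  obtain r0 r1 r2 r3 where r: "conj2 (trd x) = 2 * r0"
    "conj2 (nrd x) = r0\<^sup>2 + 3 * r1\<^sup>2 + sqrt 2 * r2\<^sup>2 + 3 * sqrt 2 * r3\<^sup>2" using QB_conj_form[OF assms] by blast
  have p: "0 \<le> 3 * r1\<^sup>2" "0 \<le> sqrt 2 * r2\<^sup>2" "0 \<le> 3 * sqrt 2 * r3\<^sup>2" "0 \<le> r0\<^sup>2" by simp_all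
  show "(conj2 (trd x))\<^sup>2 \<le> 4 * conj2 (nrd x)" using p unfolding r power_mult_distrib by simp
  show "0 \<le> conj2 (nrd x)" using p unfolding r by linarith
qed

lemma QB_conj_scalar: assumes "x \<in> QB" "(conj2 (trd x))\<^sup>2 = 4 * conj2 (nrd x)" shows "x = of_real (trd x / 2)"
proof -
  obtain r0 r1 r2 r3 where r: "conj2 (trd x) = 2 * r0"
    "conj2 (nrd x) = r0\<^sup>2 + 3 * r1\<^sup>2 + sqrt 2 * r2\<^sup>2 + 3 * sqrt 2 * r3\<^sup>2"
    and z: "r1 = 0 \<and> r2 = 0 \<and> r3 = 0 \<longrightarrow> q1 x = 0 \<and> q2 x = 0 \<and> q3 x = 0"
    using QB_conj_form[OF assms(1)] by blast
  have p: "0 \<le> 3 * r1\<^sup>2" "0 \<le> sqrt 2 * r2\<^sup>2" "0 \<le> 3 * sqrt 2 * r3\<^sup>2" by simp_all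
  have "3 * r1\<^sup>2 + sqrt 2 * r2\<^sup>2 + 3 * sqrt 2 * r3\<^sup>2 = 0"
    using assms(2) unfolding r power_mult_distrib by simp
  with p have "3 * r1\<^sup>2 = 0" "sqrt 2 * r2\<^sup>2 = 0" "3 * sqrt 2 * r3\<^sup>2 = 0" by linarith+
  then have "r1 = 0" "r2 = 0" "r3 = 0" by simp_all
  with z have "q1 x = 0" "q2 x = 0" "q3 x = 0" by simp_all
  then show ?thesis by (simp add: of_real_def bquat_defs trd_def bquat_eq_iff)
qed

text \<open>Definiteness at the conjugate place makes the quaternion algebra a division algebra.\<close>

lemma QB_nrd_eq_0: assumes "x \<in> QB" "nrd x = 0" shows "x = 0"
proof -
  have "(conj2 (trd x))\<^sup>2 \<le> 0" using QB_conj_bound(1)[OF assms(1)] by (simp add: assms(2))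
  then have c0: "conj2 (trd x) = 0" by simp
  then have "trd x = 0" using conj2_eq_0 QB_trd assms(1) by blast
  moreover have "x = of_real (trd x / 2)" using QB_conj_scalar[OF assms(1)] c0 assms(2) by simp
  ultimately show ?thesis by simp
qed

lemma QB1_D: "x \<in> QB1 \<Longrightarrow> x \<in> QB" "x \<in> QB1 \<Longrightarrow> nrd x = 1" by (simp_all add: QB1_def)

lemma QB1_closed:
  shows QB1_one: "1 \<in> QB1" and QB1_mult: "x \<in> QB1 \<Longrightarrow> y \<in> QB1 \<Longrightarrow> x * y \<in> QB1"
    and QB1_qconj: "x \<in> QB1 \<Longrightarrow> qconj x \<in> QB1" and QB1_uminus: "x \<in> QB1 \<Longrightarrow> - x \<in> QB1"
  by (simp_all add: QB1_def QB_one QB_mult QB_qconj QB_uminus nrd_mult)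

lemma QB1_inv [simp]: assumes "x \<in> QB1"
  shows "x * qconj x = 1" "qconj x * x = 1" "x * (qconj x * y) = y" "qconj x * (x * y) = y"
  using assms nrd_conj[of x] by (simp_all add: QB1_D flip: mult.assoc)

lemma QB1_conj2_trd: assumes "x \<in> QB1" shows "\<bar>conj2 (trd x)\<bar> \<le> 2"
proof -
  have "(conj2 (trd x))\<^sup>2 \<le> 2\<^sup>2" using QB_conj_bound(1)[of x] assms by (simp add: QB1_def)
  then show ?thesis by (metis abs_le_square_iff abs_numeral)
qed

text \<open>Membership in the two-sided ideal generated by \<open>d\<close>.\<close>

definition qdvd :: "real \<Rightarrow> bquat \<Rightarrow> bool" where
  "qdvd d x \<longleftrightarrow> (\<exists>w\<in>QB. x = d *\<^sub>R w)"

lemma qdvdI: "w \<in> QB \<Longrightarrow> qdvd d (d *\<^sub>R w)" by (auto simp: qdvd_def)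
lemma qdvdE: assumes "qdvd d x" obtains w where "w \<in> QB" "x = d *\<^sub>R w"
  using assms unfolding qdvd_def by blast
lemma qdvd_0 [simp]: "qdvd d 0" using qdvdI[OF QB_zero, of d] by simp
lemma qdvd_add: assumes "qdvd d x" "qdvd d y" shows "qdvd d (x + y)"
proof -
  obtain w where w: "w \<in> QB" "x = d *\<^sub>R w" using assms(1) by (rule qdvdE)
  obtain v where v: "v \<in> QB" "y = d *\<^sub>R v" using assms(2) by (rule qdvdE)
  have "x + y = d *\<^sub>R (w + v)" by (simp add: w v scaleR_add_right)
  then show ?thesis using qdvdI QB_add w v by metis
qed
lemma qdvd_mult: assumes "qdvd d x" "y \<in> QB" shows "qdvd d (x * y)" "qdvd d (y * x)"
proof -
  obtain w where w: "w \<in> QB" "x = d *\<^sub>R w" using assms(1) by (rule qdvdE)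
  have e: "x * y = d *\<^sub>R (w * y)" "y * x = d *\<^sub>R (y * w)" by (simp_all add: w)
  show "qdvd d (x * y)" "qdvd d (y * x)" unfolding e by (intro qdvdI QB_mult w assms)+
qed
lemma qdvd_uminus: "qdvd d x \<Longrightarrow> qdvd d (- x)"
  using qdvd_mult(1)[of d x "-1"] QB_uminus[OF QB_one] by simp
lemma qdvd_uminus_iff [simp]: "qdvd d (- x) \<longleftrightarrow> qdvd d x"
  using qdvd_uminus[of d x] qdvd_uminus[of d "- x"] by auto
lemma qdvd_diff: "qdvd d x \<Longrightarrow> qdvd d y \<Longrightarrow> qdvd d (x - y)"
  using qdvd_add[of d x "- y"] by simp
lemma qdvd_commute: "qdvd d (x - y) \<longleftrightarrow> qdvd d (y - x)"
  using qdvd_uminus_iff[of d "x - y"] by simp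
lemma qdvd_trans: assumes "qdvd d (x - y)" "qdvd d (y - z)" shows "qdvd d (x - z)"
  using qdvd_add[OF assms] by simp
lemma qdvd_scale: assumes "qdvd d x" "a \<in> Zs" shows "qdvd d (a *\<^sub>R x)"
  using qdvd_mult(1)[OF assms(1) QB_real[OF assms(2)]] by (simp add: of_real_def)
lemma qdvd_odvd: assumes "odvd d a" "x \<in> QB" shows "qdvd d (a *\<^sub>R x)"
proof -
  obtain b where b: "b \<in> Zs" "a = d * b" using assms(1) unfolding odvd_def by blast
  have e: "a *\<^sub>R x = d *\<^sub>R (b *\<^sub>R x)" by (simp add: b)
  show ?thesis unfolding e by (intro qdvdI QB_scale b assms)
qed
lemma qdvd_qconj: assumes "qdvd d x" shows "qdvd d (qconj x)"
proof -
  obtain w where w: "w \<in> QB" "x = d *\<^sub>R w" using assms by (rule qdvdE)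
  have e: "qconj x = d *\<^sub>R qconj w" by (simp add: w)
  show ?thesis unfolding e by (intro qdvdI QB_qconj w)
qed
lemma qdvd_trd: assumes "qdvd d x" shows "odvd d (trd x)"
  using assms by (elim qdvdE) (simp add: trd_scale odvd_multI QB_trd)
lemma qdvd_qb: assumes "d \<noteq> 0"
  shows "qdvd d (qb a b c e) \<longleftrightarrow> odvd d a \<and> odvd d b \<and> odvd d c \<and> odvd d e"
proof
  assume "qdvd d (qb a b c e)"
  then obtain w where w: "w \<in> QB" "qb a b c e = d *\<^sub>R w" by (rule qdvdE)
  obtain a' b' c' e' where "w = qb a' b' c' e'" "a' \<in> Zs" "b' \<in> Zs" "c' \<in> Zs" "e' \<in> Zs"
    using w(1) by (rule QB_E)
  with w(2) show "odvd d a \<and> odvd d b \<and> odvd d c \<and> odvd d e"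
    by (simp add: qb_scale qb_inject odvd_multI)
next
  assume "odvd d a \<and> odvd d b \<and> odvd d c \<and> odvd d e"
  then obtain a' b' c' e' where Z: "a' \<in> Zs" "b' \<in> Zs" "c' \<in> Zs" "e' \<in> Zs"
    and e: "a = d * a'" "b = d * b'" "c = d * c'" "e = d * e'" unfolding odvd_def by blast
  have "qb a b c e = d *\<^sub>R qb a' b' c' e'" by (simp add: e qb_scale)
  then show "qdvd d (qb a b c e)" using qdvdI[OF QB_qb[OF Z]] by metis
qed

lemma ideal_QB_eq: assumes "d \<in> Zs" "I = {x. odvd d x}" shows "ideal_QB I = {x. qdvd d x}"
proof (intro equalityI subsetI CollectI)
  fix x assume "x \<in> ideal_QB I"
  then show "qdvd d x"
  proof induction
    case zero then show ?case by simp
  next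
    case (add a x y) then show ?case using assms(2) by (simp add: qdvd_add qdvd_odvd)
  qed
next
  fix x assume "x \<in> {x. qdvd d x}"
  then obtain w where w: "w \<in> QB" "x = d *\<^sub>R w" by (auto elim: qdvdE)
  have "d \<in> I" using assms by simp
  from ideal_QB.add[OF this w(1) ideal_QB.zero] show "x \<in> ideal_QB I" by (simp add: w)
qed

text \<open>The principal congruence subgroup of the ideal generated by \<open>d\<close>.\<close>

definition Gam :: "real \<Rightarrow> bquat set" where
  "Gam d = {x \<in> QB1. qdvd d (x - 1)}"

lemma QB1_cong_eq: assumes "d \<in> Zs" "I = {x. odvd d x}" shows "QB1_cong I = Gam d"
  by (simp add: QB1_cong_def Gam_def ideal_QB_eq[OF assms])

lemma Gam_iff: assumes "x \<in> QB1" "y \<in> QB1" shows "x * qconj y \<in> Gam d \<longleftrightarrow> qdvd d (x - y)"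
proof -
  have "x - y = (x * qconj y - 1) * y" by (simp add: algebra_simps assms mult.assoc)
  then have 1: "qdvd d (x * qconj y - 1) \<Longrightarrow> qdvd d (x - y)"
    using qdvd_mult(1)[OF _ QB1_D(1)[OF assms(2)]] by metis
  have "x * qconj y - 1 = (x - y) * qconj y" by (simp add: algebra_simps assms)
  then have 2: "qdvd d (x - y) \<Longrightarrow> qdvd d (x * qconj y - 1)"
    using qdvd_mult(1)[OF _ QB_qconj[OF QB1_D(1)[OF assms(2)]]] by metis
  have "x * qconj y \<in> QB1" using assms QB1_mult QB1_qconj by blast
  then show ?thesis using 1 2 by (auto simp: Gam_def)
qed

lemma Gam_closed:
  shows Gam_QB1: "x \<in> Gam d \<Longrightarrow> x \<in> QB1" and Gam_one: "1 \<in> Gam d"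
    and Gam_mult: "x \<in> Gam d \<Longrightarrow> y \<in> Gam d \<Longrightarrow> x * y \<in> Gam d"
    and Gam_qconj: "x \<in> Gam d \<Longrightarrow> qconj x \<in> Gam d"
proof -
  show 0: "x \<in> QB1" if "x \<in> Gam d" for x using that by (simp add: Gam_def)
  show one: "1 \<in> Gam d" by (simp add: Gam_def QB1_one)
  show c: "qconj x \<in> Gam d" if "x \<in> Gam d" for x
    using qdvd_qconj[of d "x - 1"] that by (simp add: Gam_def QB1_qconj)
  show "x * y \<in> Gam d" if "x \<in> Gam d" "y \<in> Gam d" for x y
  proof -
    have "x * y - 1 = (x - 1) * y + (y - 1)" by (simp add: algebra_simps)
    moreover have "qdvd d ((x - 1) * y + (y - 1))"
      using that by (intro qdvd_add qdvd_mult) (simp_all add: Gam_def QB1_D)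
    ultimately have "qdvd d (x * y - 1)" by (simp only:)
    then show ?thesis using that by (simp add: Gam_def QB1_mult)
  qed
qed

text \<open>Writing \<open>x = 1 + d w\<close>, the equation \<open>nrd x = 1\<close> forces \<open>trd x - 2 = - d\<^sup>2 nrd w\<close>, an element
  of norm at least \<open>(anorm d)\<^sup>2\<close>; the definite conjugate embedding bounds its conjugate by 4.\<close>

lemma Gam_trd: assumes "x \<in> Gam d" "x \<noteq> 1" "d \<in> Zs" "d \<noteq> 0"
  shows "(anorm d)\<^sup>2 \<le> 4 * \<bar>trd x - 2\<bar>"
proof -
  have x1: "x \<in> QB1" using assms by (simp add: Gam_def)
  obtain w where w: "w \<in> QB" "x - 1 = d *\<^sub>R w" using assms by (auto simp: Gam_def elim: qdvdE)
  have xe: "x = 1 + d *\<^sub>R w" using w(2) by (simp add: algebra_simps)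
  have "nrd x = 1 + d\<^sup>2 * nrd w + d * trd w" unfolding xe nrd_add by (simp add: trd_scale)
  then have "d * trd w = - (d\<^sup>2 * nrd w)" using x1 by (simp add: QB1_D)
  then have t: "trd x - 2 = - (d\<^sup>2 * nrd w)" unfolding xe by (simp add: trd_simps)
  have w0: "w \<noteq> 0" using assms xe by auto
  have n0: "nrd w \<noteq> 0" using QB_nrd_eq_0 w w0 by blast
  have "anorm (trd x - 2) = anorm (d * (d * nrd w))"
    unfolding t anorm_def by (simp add: conj2_uminus Zs_closed assms QB_nrd w power2_eq_square mult.assoc)
  also have "\<dots> = (anorm d)\<^sup>2 * anorm (nrd w)"
    by (simp add: anorm_mult Zs_closed assms QB_nrd w power2_eq_square)
  finally have 1: "anorm (trd x - 2) = (anorm d)\<^sup>2 * anorm (nrd w)" .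
  have 2: "(anorm d)\<^sup>2 \<le> anorm (trd x - 2)" unfolding 1
    using anorm_ge_1[OF QB_nrd[OF w(1)] n0] mult_left_mono[of 1 "anorm (nrd w)" "(anorm d)\<^sup>2"] by simp
  have "conj2 (trd x - 2) = conj2 (trd x) - 2" by (simp add: conj2_diff QB_trd QB1_D x1)
  then have "\<bar>conj2 (trd x - 2)\<bar> \<le> 4" using QB1_conj2_trd[OF x1] by linarith
  then have "anorm (trd x - 2) \<le> \<bar>trd x - 2\<bar> * 4" unfolding anorm_def abs_mult by (intro mult_left_mono) simp_all
  with 2 show ?thesis by simp
qed

section \<open>Counting residues of norm one elements\<close>

lemma card_ge_fibres:
  assumes "finite A" "\<And>c. c \<in> C \<Longrightarrow> k \<le> card {x \<in> A. f x = c}" "finite C"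
  shows "k * card C \<le> card A"
proof -
  have "k * card C = (\<Sum>c\<in>C. k)" by simp
  also have "\<dots> \<le> (\<Sum>c\<in>C. card {x \<in> A. f x = c})" using assms(2) by (rule sum_mono)
  also have "\<dots> = card (\<Union>c\<in>C. {x \<in> A. f x = c})"
    by (rule card_UN_disjoint[symmetric]) (use assms(1,3) in auto)
  also have "\<dots> \<le> card A" by (rule card_mono) (use assms(1) in auto)
  finally show ?thesis .
qed

lemma card_le_fibres:
  assumes "finite A" "\<And>x. x \<in> A \<Longrightarrow> card {y \<in> A. f y = f x} \<le> k"
  shows "card A \<le> k * card (f ` A)"
proof -
  have A: "A = (\<Union>c\<in>f ` A. {x \<in> A. f x = c})" by auto
  have "card A \<le> (\<Sum>c\<in>f ` A. card {x \<in> A. f x = c})"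
    by (subst A, rule card_UN_le) (use assms(1) in simp)
  also have "\<dots> \<le> (\<Sum>c\<in>f ` A. k)" by (rule sum_mono) (use assms(2) in auto)
  finally show ?thesis by (simp add: mult.commute)
qed

text \<open>Meant for maps that behave like squaring on a field: two-to-one outside \<open>z\<close> and one-to-one there.\<close>

lemma card_half_image:
  assumes "finite A" "z \<in> A" "\<And>x. x \<in> A \<Longrightarrow> card {y \<in> A. f y = f x} \<le> 2" "\<And>x. x \<in> A \<Longrightarrow> f x = f z \<Longrightarrow> x = z"
  shows "card A + 1 \<le> 2 * card (f ` A)"
proof -
  let ?B = "A - {z}"
  have fib: "card {y \<in> ?B. f y = f x} \<le> 2" if "x \<in> ?B" for x
  proof -
    have "card {y \<in> ?B. f y = f x} \<le> card {y \<in> A. f y = f x}"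
      by (rule card_mono) (use assms(1) in auto)
    also have "\<dots> \<le> 2" using assms(3) that by simp
    finally show ?thesis .
  qed
  have "card ?B \<le> 2 * card (f ` ?B)" by (rule card_le_fibres) (use assms(1) fib in simp_all)
  moreover have "card (f ` ?B) \<le> card (f ` A - {f z})"
  proof (rule card_mono)
    show "f ` ?B \<subseteq> f ` A - {f z}"
    proof
      fix y assume "y \<in> f ` ?B"
      then obtain x where x: "x \<in> A" "x \<noteq> z" "y = f x" by blast
      have "f x \<noteq> f z" using assms(4)[OF x(1)] x(2) by metis
      then show "y \<in> f ` A - {f z}" using x(1,3) by simp
    qed
  qed (use assms(1) in simp)
  moreover have "card (f ` A - {f z}) = card (f ` A) - 1" "card ?B = card A - 1"
    using assms(1,2) by simp_all
  moreover have "card A > 0" "card (f ` A) > 0" using assms(1,2) by (auto simp: card_gt_0_iff)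
  ultimately show ?thesis by linarith
qed

text \<open>Residue classes are represented by chosen elements, so that the sets \<open>RO d\<close> and \<open>RQ d\<close> of
  representatives stand for the residue rings of the ring of integers and of the order.\<close>

definition redO :: "real \<Rightarrow> real \<Rightarrow> real" where
  "redO d x = (SOME y. y \<in> Zs \<and> odvd d (y - x))"
definition RO :: "real \<Rightarrow> real set" where "RO d = redO d ` Zs"

definition redQ :: "real \<Rightarrow> bquat \<Rightarrow> bquat" where
  "redQ d x = (SOME y. y \<in> QB \<and> qdvd d (y - x))"
definition RQ :: "real \<Rightarrow> bquat set" where "RQ d = redQ d ` QB"

lemma odvd_commute: "odvd d (x - y) \<longleftrightarrow> odvd d (y - x)"
  using odvd_uminus[of d "x - y"] odvd_uminus[of d "y - x"] by auto
lemma odvd_transd: assumes "odvd d (x - y)" "odvd d (y - z)" shows "odvd d (x - z)"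
  using odvd_add[OF assms] by simp

lemma redO: assumes "x \<in> Zs" shows "redO d x \<in> Zs" "odvd d (redO d x - x)"
proof -
  have "x \<in> Zs \<and> odvd d (x - x)" using assms by simp
  then have "redO d x \<in> Zs \<and> odvd d (redO d x - x)" unfolding redO_def by (rule someI)
  then show "redO d x \<in> Zs" "odvd d (redO d x - x)" by simp_all
qed

lemma redO_eq_iff: assumes "x \<in> Zs" "y \<in> Zs" shows "redO d x = redO d y \<longleftrightarrow> odvd d (x - y)"
proof
  assume "redO d x = redO d y"
  then show "odvd d (x - y)"
    using redO(2)[OF assms(1), of d] redO(2)[OF assms(2), of d] odvd_transd[of d x "redO d x" y]
    by (simp add: odvd_commute)
next
  assume o: "odvd d (x - y)"
  have "odvd d (z - x) \<longleftrightarrow> odvd d (z - y)" for z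
    using odvd_transd[of d z x y] odvd_transd[of d z y x] o odvd_commute by blast
  then show "redO d x = redO d y" unfolding redO_def by simp
qed

lemma RO_Zs: "x \<in> RO d \<Longrightarrow> x \<in> Zs" unfolding RO_def using redO(1) by blast
lemma redO_RO: "x \<in> Zs \<Longrightarrow> redO d x \<in> RO d" unfolding RO_def by blast
lemma RO_fixed: assumes "x \<in> RO d" shows "redO d x = x"
proof -
  obtain y where y: "y \<in> Zs" "x = redO d y" using assms unfolding RO_def by blast
  then have "redO d x = redO d y" using redO[OF y(1), of d] by (simp add: redO_eq_iff)
  then show ?thesis using y by simp
qed
lemma RO_eq_iff: "x \<in> RO d \<Longrightarrow> y \<in> RO d \<Longrightarrow> x = y \<longleftrightarrow> odvd d (x - y)"
  using redO_eq_iff[OF RO_Zs RO_Zs, of x d y d d] by (simp add: RO_fixed)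

lemma redQ: assumes "x \<in> QB" shows "redQ d x \<in> QB" "qdvd d (redQ d x - x)"
proof -
  have "x \<in> QB \<and> qdvd d (x - x)" using assms by simp
  then have "redQ d x \<in> QB \<and> qdvd d (redQ d x - x)" unfolding redQ_def by (rule someI)
  then show "redQ d x \<in> QB" "qdvd d (redQ d x - x)" by simp_all
qed

lemma redQ_eq_iff: assumes "x \<in> QB" "y \<in> QB" shows "redQ d x = redQ d y \<longleftrightarrow> qdvd d (x - y)"
proof
  assume "redQ d x = redQ d y"
  then show "qdvd d (x - y)"
    using redQ(2)[OF assms(1), of d] redQ(2)[OF assms(2), of d] qdvd_trans[of d x "redQ d x" y]
    by (simp add: qdvd_commute)
next
  assume o: "qdvd d (x - y)"
  have "qdvd d (z - x) \<longleftrightarrow> qdvd d (z - y)" for z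
    using qdvd_trans[of d z x y] qdvd_trans[of d z y x] o qdvd_commute by blast
  then show "redQ d x = redQ d y" unfolding redQ_def by simp
qed

lemma RQ_QB: "x \<in> RQ d \<Longrightarrow> x \<in> QB" unfolding RQ_def using redQ(1) by blast
lemma redQ_RQ: "x \<in> QB \<Longrightarrow> redQ d x \<in> RQ d" unfolding RQ_def by blast
lemma RQ_fixed: assumes "x \<in> RQ d" shows "redQ d x = x"
proof -
  obtain y where y: "y \<in> QB" "x = redQ d y" using assms unfolding RQ_def by blast
  then have "redQ d x = redQ d y" using redQ[OF y(1), of d] by (simp add: redQ_eq_iff)
  then show ?thesis using y by simp
qed
lemma RQ_eqI: "x \<in> RQ d \<Longrightarrow> y \<in> RQ d \<Longrightarrow> qdvd d (x - y) \<Longrightarrow> x = y"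
  using redQ_eq_iff[OF RQ_QB RQ_QB, of x d y d d] by (simp add: RQ_fixed)
lemma redQ_inj: "x \<in> QB \<Longrightarrow> y \<in> QB \<Longrightarrow> redQ d x = redQ d y \<Longrightarrow> qdvd d (x - y)"
  by (simp add: redQ_eq_iff)

text \<open>If \<open>g\<close> is the gcd of the coordinates of \<open>d\<close>, the ideal of \<open>d\<close> contains \<open>anorm d / g\<close> and an
  element whose \<open>sqrt 2\<close>-coordinate is \<open>g\<close>.\<close>

lemma RO_card: assumes "d \<in> Zs" "d \<noteq> 0"
  shows "finite (RO d)" "real (card (RO d)) \<le> anorm d"
proof -
  obtain a b where d: "d = real_of_int a + real_of_int b * sqrt 2" using assms(1) by (rule Zs_E)
  define g where "g = gcd a b"
  have g0: "g > 0" using assms(2) by (auto simp: g_def d)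
  obtain a' where a': "a = g * a'" using dvd_def g_def gcd_dvd1 by metis
  obtain b' where b': "b = g * b'" using dvd_def g_def gcd_dvd2 by metis
  define N where "N = g * (a'\<^sup>2 - 2 * b'\<^sup>2)"
  have nmd: "anorm d = of_int (g * \<bar>N\<bar>)"
  proof -
    have "a\<^sup>2 - 2 * b\<^sup>2 = g * N" unfolding a' b' N_def by (simp add: power2_eq_square algebra_simps)
    then show ?thesis unfolding d anorm_eq using g0 by (simp add: abs_mult)
  qed
  have "anorm d \<ge> 1" using anorm_ge_1 assms by blast
  then have N0: "\<bar>N\<bar> > 0" unfolding nmd by (cases "N = 0") auto
  obtain y z where yz: "z * a + y * b = g" using bezout_int[of a b] unfolding g_def by blast
  have e1: "odvd d (real_of_int (a * y + 2 * b * z) + real_of_int g * sqrt 2)"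
  proof -
    have "real_of_int (a * y + 2 * b * z) + real_of_int g * sqrt 2 = d * (real_of_int y + real_of_int z * sqrt 2)"
      unfolding d yz[symmetric] by (simp add: algebra_simps)
    then show ?thesis using odvd_multI[OF Zs_I[OF refl]] by metis
  qed
  have e2: "odvd d (real_of_int \<bar>N\<bar>)"
  proof -
    have "real_of_int N = d * (real_of_int a' + real_of_int (- b') * sqrt 2)"
      unfolding d a' b' N_def by (simp add: algebra_simps power2_eq_square)
    then have "odvd d (real_of_int N)" using odvd_multI[OF Zs_I[OF refl]] by metis
    then show ?thesis using odvd_uminus[of d "real_of_int N"] by (simp add: abs_if)
  qed
  let ?S = "{0..<\<bar>N\<bar>} \<times> {0..<g}"
  let ?F = "\<lambda>(i,j). redO d (real_of_int i + real_of_int j * sqrt 2)"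
  have sub: "RO d \<subseteq> ?F ` ?S"
  proof
    fix r assume "r \<in> RO d"
    then obtain x where x: "x \<in> Zs" "r = redO d x" unfolding RO_def by blast
    obtain u v where uv: "x = real_of_int u + real_of_int v * sqrt 2" using x(1) by (rule Zs_E)
    define k where "k = v div g"
    define w where "w = u - k * (a * y + 2 * b * z)"
    define l where "l = w div \<bar>N\<bar>"
    have v: "v = k * g + v mod g" by (simp add: k_def)
    have w: "w = l * \<bar>N\<bar> + w mod \<bar>N\<bar>" by (simp add: l_def)
    have "x - (real_of_int (w mod \<bar>N\<bar>) + real_of_int (v mod g) * sqrt 2) =
       real_of_int k * (real_of_int (a * y + 2 * b * z) + real_of_int g * sqrt 2) + real_of_int l * real_of_int \<bar>N\<bar>"
    proof -
      have "w mod \<bar>N\<bar> = u - k * (a * y + 2 * b * z) - l * \<bar>N\<bar>" using w w_def by linarith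
      moreover have "v mod g = v - k * g" using v by linarith
      ultimately show ?thesis unfolding uv by (simp only: of_int_diff of_int_mult) (simp add: algebra_simps)
    qed
    moreover have "odvd d (real_of_int k * (real_of_int (a * y + 2 * b * z) + real_of_int g * sqrt 2) + real_of_int l * real_of_int \<bar>N\<bar>)"
      by (intro odvd_add odvd_mult2 e1 e2 Zs_int)
    ultimately have "odvd d (x - (real_of_int (w mod \<bar>N\<bar>) + real_of_int (v mod g) * sqrt 2))" by (simp only:)
    then have "r = ?F (w mod \<bar>N\<bar>, v mod g)"
      using x redO_eq_iff[OF x(1) Zs_I[OF refl]] by simp
    moreover have "(w mod \<bar>N\<bar>, v mod g) \<in> ?S" using N0 g0 by simp
    ultimately show "r \<in> ?F ` ?S" by (rule image_eqI)
  qed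
  then show "finite (RO d)" by (rule finite_subset) simp
  have "card (RO d) \<le> card (?F ` ?S)" by (rule card_mono[OF _ sub]) simp
  also have "\<dots> \<le> card ?S" by (rule card_image_le) simp
  also have "\<dots> = nat (g * \<bar>N\<bar>)" using g0 by (simp add: nat_mult_distrib mult.commute)
  finally have "int (card (RO d)) \<le> g * \<bar>N\<bar>" using g0 by (simp add: nat_le_iff le_nat_iff)
  then have "real_of_int (int (card (RO d))) \<le> real_of_int (g * \<bar>N\<bar>)" by (simp only: of_int_le_iff)
  then show "real (card (RO d)) \<le> anorm d" unfolding nmd by simp
qed

lemma RO_pos: assumes "d \<in> Zs" "d \<noteq> 0" shows "card (RO d) > 0"
  using RO_card(1)[OF assms] redO_RO[of 0 d] by (auto simp: card_gt_0_iff)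

lemma RQ_card: assumes "d \<in> Zs" "d \<noteq> 0"
  shows "finite (RQ d)" "card (RQ d) \<le> card (RO d) ^ 4"
proof -
  let ?R = "RO d"
  let ?S = "?R \<times> ?R \<times> ?R \<times> ?R"
  let ?F = "\<lambda>(p,q,r,s). redQ d (qb p q r s)"
  have f: "finite ?S" using RO_card(1)[OF assms] by simp
  have sub: "RQ d \<subseteq> ?F ` ?S"
  proof
    fix r assume "r \<in> RQ d"
    then obtain x where x: "x \<in> QB" "r = redQ d x" unfolding RQ_def by blast
    obtain a b c e where xe: "x = qb a b c e" and Z: "a \<in> Zs" "b \<in> Zs" "c \<in> Zs" "e \<in> Zs"
      using x(1) by (rule QB_E)
    have "qdvd d (x - qb (redO d a) (redO d b) (redO d c) (redO d e))"
      unfolding xe qb_diff qdvd_qb[OF assms(2)]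
      using Z by (simp add: redO odvd_commute[of d a] odvd_commute[of d b] odvd_commute[of d c] odvd_commute[of d e])
    then have "r = ?F (redO d a, redO d b, redO d c, redO d e)"
      using x redQ_eq_iff[OF x(1) QB_qb] Z redO(1) by simp
    moreover have "(redO d a, redO d b, redO d c, redO d e) \<in> ?S" using Z redO_RO by simp
    ultimately show "r \<in> ?F ` ?S" by (rule image_eqI)
  qed
  show "finite (RQ d)" by (rule finite_subset[OF sub]) (use f in simp)
  have "card (RQ d) \<le> card (?F ` ?S)" by (rule card_mono[OF _ sub]) (use f in simp)
  also have "\<dots> \<le> card ?S" by (rule card_image_le[OF f])
  finally show "card (RQ d) \<le> card (RO d) ^ 4" by (simp add: card_cartesian_product power4_eq_xxxx mult.assoc)
qed

text \<open>The index of \<open>Gam d\<close> in the group of norm one elements, as the number of residues that this group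
  attains.\<close>

definition idx :: "real \<Rightarrow> nat" where "idx d = card (redQ d ` QB1)"

lemma redQ_QB1_sub: "redQ d ` QB1 \<subseteq> RQ d"
  unfolding RQ_def QB1_def by blast

lemma idx_le_RQ: "d \<in> Zs \<Longrightarrow> d \<noteq> 0 \<Longrightarrow> idx d \<le> card (RO d) ^ 4"
  unfolding idx_def using card_mono[OF RQ_card(1) redQ_QB1_sub] RQ_card(2) order_trans by blast

lemma finite_idx: "d \<in> Zs \<Longrightarrow> d \<noteq> 0 \<Longrightarrow> finite (redQ d ` QB1)"
  using finite_subset[OF redQ_QB1_sub RQ_card(1)] by blast

lemma Gam_QB: "x \<in> Gam d \<Longrightarrow> x \<in> QB" by (simp add: Gam_def QB1_D)

lemma qdvd_mult_scale: assumes "e \<noteq> 0" shows "qdvd (e * p) (e *\<^sub>R w) \<longleftrightarrow> qdvd p w"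
  using assms by (auto simp: qdvd_def simp flip: scaleR_scaleR)

lemma qdvd_dvd_trans: assumes "odvd e d" "qdvd d x" shows "qdvd e x"
proof -
  obtain w where w: "w \<in> QB" "x = d *\<^sub>R w" using assms(2) by (rule qdvdE)
  show ?thesis unfolding w(2) by (rule qdvd_odvd[OF assms(1) w(1)])
qed

text \<open>Two norm one elements with the same residue modulo \<open>e\<close> differ by an element of \<open>Gam e\<close>, so each fibre of
  the reduction from level \<open>e p\<close> to level \<open>e\<close> is a translate of the residues of \<open>Gam e\<close>.\<close>

lemma idx_step:
  assumes "e \<in> Zs" "p \<in> Zs" "e \<noteq> 0" "p \<noteq> 0"
  shows "idx (e * p) \<le> card (redQ (e * p) ` Gam e) * idx e"
proof -
  let ?d = "e * p"
  have dZ: "?d \<in> Zs" "?d \<noteq> 0" using assms Zs_mult by simp_all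
  have ed: "odvd e ?d" using assms odvd_multI by blast
  let ?A = "redQ ?d ` QB1"
  have fA: "finite ?A" using finite_idx dZ by blast
  have fG: "finite (redQ ?d ` Gam e)"
    by (rule finite_subset[OF _ fA]) (use Gam_QB1 in blast)
  have fib: "card {y \<in> ?A. redQ e y = redQ e y0} \<le> card (redQ ?d ` Gam e)" if "y0 \<in> ?A" for y0
  proof -
    obtain x0 where x0: "x0 \<in> QB1" "y0 = redQ ?d x0" using \<open>y0 \<in> ?A\<close> by blast
    have x0Q: "x0 \<in> QB" "qconj x0 \<in> QB" using x0 QB1_D QB_qconj by simp_all
    let ?phi = "\<lambda>y. redQ ?d (qconj x0 * y)"
    show ?thesis
    proof (rule card_inj_on_le[OF _ _ fG, of ?phi])
      show "inj_on ?phi {y \<in> ?A. redQ e y = redQ e y0}"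
      proof (rule inj_onI, goal_cases)
        case (1 y y')
        have Q: "y \<in> RQ ?d" "y' \<in> RQ ?d" using 1(1,2) redQ_QB1_sub by blast+
        have "qdvd ?d (qconj x0 * y - qconj x0 * y')"
          by (rule redQ_inj[OF _ _ 1(3)]) (intro QB_mult x0Q RQ_QB[OF Q(1)] RQ_QB[OF Q(2)])+
        from qdvd_mult(2)[OF this x0Q(1)] have "qdvd ?d (y - y')"
          using x0(1) by (simp add: right_diff_distrib)
        then show ?case by (rule RQ_eqI[OF Q])
      qed
      show "?phi ` {y \<in> ?A. redQ e y = redQ e y0} \<subseteq> redQ ?d ` Gam e"
      proof
        fix z assume "z \<in> ?phi ` {y \<in> ?A. redQ e y = redQ e y0}"
        then obtain x where x: "x \<in> QB1" "z = ?phi (redQ ?d x)" "redQ e (redQ ?d x) = redQ e y0" by blast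
        have xQ: "x \<in> QB" using x QB1_D by simp
        have "qdvd e (redQ ?d x - redQ ?d x0)"
          using x(3) x0 redQ_inj[OF redQ(1)[OF xQ] redQ(1)[OF x0Q(1)]] by simp
        moreover have "qdvd e (redQ ?d x - x)" "qdvd e (redQ ?d x0 - x0)"
          using qdvd_dvd_trans[OF ed] redQ(2) xQ x0Q by blast+
        ultimately have "qdvd e (x - x0)" using qdvd_trans qdvd_commute by metis
        then have "qdvd e (qconj x0 * (x - x0))" by (rule qdvd_mult(2)) (rule x0Q)
        then have G: "qconj x0 * x \<in> Gam e"
          using x0(1) x(1) by (simp add: Gam_def QB1_mult QB1_qconj right_diff_distrib)
        have "qdvd ?d (qconj x0 * (redQ ?d x - x))" by (rule qdvd_mult(2)[OF redQ(2)[OF xQ] x0Q(2)])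
        then have "z = redQ ?d (qconj x0 * x)" unfolding x(2)
          by (subst redQ_eq_iff) (simp_all add: QB_mult x0Q xQ redQ(1) right_diff_distrib)
        then show "z \<in> redQ ?d ` Gam e" using G by (rule image_eqI)
      qed
    qed
  qed
  have "card ?A \<le> card (redQ ?d ` Gam e) * card (redQ e ` ?A)"
    by (rule card_le_fibres[OF fA fib])
  also have "redQ e ` ?A \<subseteq> redQ e ` QB1"
  proof
    fix z assume "z \<in> redQ e ` ?A"
    then obtain x where x: "x \<in> QB1" "z = redQ e (redQ ?d x)" by blast
    have xQ: "x \<in> QB" using x QB1_D by simp
    have "z = redQ e x" unfolding x(2)
      using redQ_eq_iff[OF redQ(1)[OF xQ] xQ] qdvd_dvd_trans[OF ed redQ(2)[OF xQ]] by simp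
    then show "z \<in> redQ e ` QB1" using x(1) by (rule image_eqI)
  qed
  then have "card (redQ e ` ?A) \<le> idx e"
    unfolding idx_def by (rule card_mono[OF finite_idx[OF assms(1,3)]])
  finally show ?thesis unfolding idx_def by simp
qed

text \<open>Adding \<open>c alphaB\<close>, an element of trace \<open>c\<close>, moves the trace zero residues into the fibre over \<open>c\<close>. So all
  fibres of the trace have at least the size of the one over zero.\<close>

lemma trace_zero_card: assumes "p \<in> Zs" "p \<noteq> 0"
  shows "card {y \<in> RQ p. odvd p (trd y)} \<le> card (RO p) ^ 3"
proof -
  let ?T = "{y \<in> RQ p. odvd p (trd y)}"
  have fR: "finite (RQ p)" using RQ_card(1)[OF assms] .
  have "card ?T * card (RO p) \<le> card (RQ p)"
  proof (rule card_ge_fibres[OF fR _ RO_card(1)[OF assms]])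
    fix c assume c: "c \<in> RO p"
    have cZ: "c \<in> Zs" using RO_Zs c by blast
    let ?a = "c *\<^sub>R alphaB"
    have aQ: "?a \<in> QB" by (intro QB_scale QB_gens cZ)
    have at: "trd ?a = c" by (simp add: trd_scale qb_gens trd_qb)
    show "card ?T \<le> card {x \<in> RQ p. redO p (trd x) = c}"
    proof (rule card_inj_on_le[of "\<lambda>y. redQ p (y + ?a)"])
      show "inj_on (\<lambda>y. redQ p (y + ?a)) ?T"
      proof (rule inj_onI, goal_cases)
        case (1 y y')
        have Q: "y \<in> RQ p" "y' \<in> RQ p" using 1(1,2) by simp_all
        have "qdvd p (y + ?a - (y' + ?a))"
          by (rule redQ_inj[OF _ _ 1(3)]) (intro QB_add aQ RQ_QB[OF Q(1)] RQ_QB[OF Q(2)])+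
        then show ?case using RQ_eqI[OF Q] by simp
      qed
      show "(\<lambda>y. redQ p (y + ?a)) ` ?T \<subseteq> {x \<in> RQ p. redO p (trd x) = c}"
      proof
        fix z assume "z \<in> (\<lambda>y. redQ p (y + ?a)) ` ?T"
        then obtain y where y: "y \<in> RQ p" "odvd p (trd y)" "z = redQ p (y + ?a)" by blast
        have Q: "y + ?a \<in> QB" by (intro QB_add RQ_QB[OF y(1)] aQ)
        have "odvd p (trd (z - (y + ?a)))" unfolding y(3) by (rule qdvd_trd[OF redQ(2)[OF Q]])
        then have "odvd p (trd z - trd y - c)" by (simp only: trd_diff trd_add at diff_diff_eq)
        then have "odvd p (trd z - c)" using odvd_add[OF _ y(2), of "trd z - trd y - c"] by simp
        then have "redO p (trd z) = redO p c"
          using redO_eq_iff[OF QB_trd cZ] redQ(1)[OF Q] y(3) by simp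
        then show "z \<in> {x \<in> RQ p. redO p (trd x) = c}" using y(3) redQ_RQ[OF Q] RO_fixed[OF c] by simp
      qed
    qed (use fR in simp)
  qed
  also have "card (RQ p) \<le> card (RO p) ^ 3 * card (RO p)" using RQ_card(2)[OF assms] by (simp add: power4_eq_xxxx power3_eq_cube)
  finally show ?thesis using RO_pos[OF assms] by simp
qed

text \<open>For \<open>x = 1 + e w\<close> the norm one condition reads \<open>trd w = - e nrd w\<close>, which vanishes modulo \<open>p\<close> when
  \<open>p\<close> divides \<open>e\<close>. Hence the residue of \<open>w\<close> modulo \<open>p\<close> is of trace zero, and it determines the residue of
  \<open>x\<close> modulo \<open>e p\<close>.\<close>

lemma Gam_card_repeated:
  assumes "e \<in> Zs" "p \<in> Zs" "e \<noteq> 0" "p \<noteq> 0" "odvd p e"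
  shows "card (redQ (e * p) ` Gam e) \<le> card (RO p) ^ 3"
proof -
  let ?d = "e * p" and ?T = "{y \<in> RQ p. odvd p (trd y)}"
  let ?psi = "\<lambda>z. redQ p (inverse e *\<^sub>R (z - 1))"
  have key: "\<exists>w\<in>QB. redQ ?d x = 1 + e *\<^sub>R w \<and> odvd p (trd w)" if x: "x \<in> Gam e" for x
  proof -
    have x1: "x \<in> QB1" using x by (rule Gam_QB1)
    obtain w where w: "w \<in> QB" "x - 1 = e *\<^sub>R w" using x unfolding Gam_def by (auto elim: qdvdE)
    have xe: "x = 1 + e *\<^sub>R w" using w(2) by (simp add: algebra_simps)
    obtain u where u: "u \<in> QB" "redQ ?d x - x = ?d *\<^sub>R u" using redQ(2)[OF QB1_D(1)[OF x1]] by (rule qdvdE)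
    have "nrd x = 1 + e\<^sup>2 * nrd w + e * trd w" unfolding xe nrd_add by (simp add: trd_scale)
    then have "e * (trd w + e * nrd w) = 0" using x1 by (simp add: QB1_D power2_eq_square algebra_simps)
    then have tw: "trd w = - (e * nrd w)" using assms(3) by simp
    have "odvd p (trd w)" unfolding tw by (intro odvd_uminus odvd_mult assms(5) QB_nrd w)
    moreover have "odvd p (trd (p *\<^sub>R u))" by (intro qdvd_trd qdvdI u)
    ultimately have "odvd p (trd (w + p *\<^sub>R u))" unfolding trd_add by (rule odvd_add)
    moreover have "redQ ?d x = 1 + e *\<^sub>R (w + p *\<^sub>R u)"
      using u(2) xe by (simp add: algebra_simps)
    moreover have "w + p *\<^sub>R u \<in> QB" by (intro QB_add QB_scale w u assms)
    ultimately show ?thesis by blast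
  qed
  have psi: "?psi (1 + e *\<^sub>R w) = redQ p w" for w using assms(3) by simp
  have "card (redQ ?d ` Gam e) \<le> card ?T"
  proof (rule card_inj_on_le[of ?psi])
    show "inj_on ?psi (redQ ?d ` Gam e)"
    proof (rule inj_onI)
      fix z z' assume "z \<in> redQ ?d ` Gam e" "z' \<in> redQ ?d ` Gam e" and eq: "?psi z = ?psi z'"
      then obtain x x' where x: "x \<in> Gam e" "z = redQ ?d x" and x': "x' \<in> Gam e" "z' = redQ ?d x'" by blast
      obtain w where w: "w \<in> QB" "z = 1 + e *\<^sub>R w" using key[OF x(1)] x(2) by blast
      obtain w' where w': "w' \<in> QB" "z' = 1 + e *\<^sub>R w'" using key[OF x'(1)] x'(2) by blast
      have "qdvd p (w - w')" by (rule redQ_inj[OF w(1) w'(1)]) (use eq in \<open>simp only: w(2) w'(2) psi\<close>)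
      then have "qdvd ?d (e *\<^sub>R (w - w'))" by (simp only: qdvd_mult_scale[OF assms(3)])
      then have "qdvd ?d (z - z')" by (simp add: w w' scaleR_diff_right)
      then show "z = z'" using RQ_eqI x x' redQ_RQ Gam_QB by blast
    qed
    show "?psi ` redQ ?d ` Gam e \<subseteq> ?T"
    proof
      fix z assume "z \<in> ?psi ` redQ ?d ` Gam e"
      then obtain x where x: "x \<in> Gam e" "z = ?psi (redQ ?d x)" by blast
      obtain w where w: "w \<in> QB" "redQ ?d x = 1 + e *\<^sub>R w" "odvd p (trd w)" using key[OF x(1)] by blast
      have z: "z = redQ p w" using x(2) unfolding w(2) psi .
      have "odvd p (trd (z - w))" unfolding z by (rule qdvd_trd[OF redQ(2)[OF w(1)]])
      from odvd_add[OF this w(3)] have "odvd p (trd z)" by (simp add: trd_diff)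
      then show "z \<in> ?T" using z redQ_RQ[OF w(1)] by simp
    qed
  qed (use RQ_card(1)[OF assms(2,4)] in simp)
  also have "\<dots> \<le> card (RO p) ^ 3" by (rule trace_zero_card[OF assms(2,4)])
  finally show ?thesis .
qed

lemma qdvd_coprime:
  assumes "u \<in> Zs" "v \<in> Zs" "u * e + v * p = 1" "qdvd e x" "qdvd p x"
  shows "qdvd (e * p) x"
proof -
  obtain w where w: "w \<in> QB" "x = e *\<^sub>R w" using assms(4) by (rule qdvdE)
  obtain w' where w': "w' \<in> QB" "x = p *\<^sub>R w'" using assms(5) by (rule qdvdE)
  have "x = (u * e + v * p) *\<^sub>R x" using assms(3) by simp
  also have "\<dots> = (u * e) *\<^sub>R (p *\<^sub>R w') + (v * p) *\<^sub>R (e *\<^sub>R w)"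
    unfolding scaleR_add_left by (simp only: w(2)[symmetric] w'(2)[symmetric])
  also have "\<dots> = (e * p) *\<^sub>R (u *\<^sub>R w' + v *\<^sub>R w)" by (simp add: algebra_simps)
  finally have e: "x = (e * p) *\<^sub>R (u *\<^sub>R w' + v *\<^sub>R w)" .
  show ?thesis by (subst e) (intro qdvdI QB_add QB_scale assms w w')
qed

text \<open>Elements of \<open>Gam e\<close> have the same residue modulo \<open>e\<close>, so by the Chinese remainder theorem their residue
  modulo \<open>e p\<close> is determined by the one modulo \<open>p\<close>.\<close>

lemma Gam_card_coprime:
  assumes "e \<in> Zs" "p \<in> Zs" "e \<noteq> 0" "p \<noteq> 0" "u \<in> Zs" "v \<in> Zs" "u * e + v * p = 1"
  shows "card (redQ (e * p) ` Gam e) \<le> idx p"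
  unfolding idx_def
proof (rule card_inj_on_le[of "redQ p"])
  let ?d = "e * p"
  have ed: "odvd e ?d" "odvd p ?d" using assms odvd_multI[of e p] odvd_multI[of p e] by (simp_all add: mult.commute)
  show "inj_on (redQ p) (redQ ?d ` Gam e)"
  proof (rule inj_onI)
    fix z z' assume "z \<in> redQ ?d ` Gam e" "z' \<in> redQ ?d ` Gam e" and eq: "redQ p z = redQ p z'"
    then obtain x x' where x: "x \<in> Gam e" "z = redQ ?d x" and x': "x' \<in> Gam e" "z' = redQ ?d x'" by blast
    have R: "z \<in> RQ ?d" "z' \<in> RQ ?d" using x x' redQ_RQ Gam_QB by blast+
    have "qdvd e (z - x)" "qdvd e (z' - x')"
      using qdvd_dvd_trans[OF ed(1)] redQ(2) Gam_QB x x' by blast+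
    moreover have "qdvd e (x - 1)" "qdvd e (x' - 1)" using x x' by (simp_all add: Gam_def)
    ultimately have "qdvd e (z - z')" using qdvd_trans qdvd_commute by metis
    moreover have "qdvd p (z - z')" by (rule redQ_inj[OF RQ_QB[OF R(1)] RQ_QB[OF R(2)] eq])
    ultimately have "qdvd ?d (z - z')" by (rule qdvd_coprime[OF assms(5-7)])
    then show "z = z'" by (rule RQ_eqI[OF R])
  qed
  show "redQ p ` redQ ?d ` Gam e \<subseteq> redQ p ` QB1"
  proof
    fix z assume "z \<in> redQ p ` redQ ?d ` Gam e"
    then obtain x where x: "x \<in> Gam e" "z = redQ p (redQ ?d x)" by blast
    have xQ: "x \<in> QB" using x Gam_QB by blast
    have "z = redQ p x" unfolding x(2)
      using redQ_eq_iff[OF redQ(1)[OF xQ] xQ] qdvd_dvd_trans[OF ed(2) redQ(2)[OF xQ]] by simp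
    then show "z \<in> redQ p ` QB1" using Gam_QB1[OF x(1)] by (rule image_eqI)
  qed
  show "finite (redQ p ` QB1)" using finite_idx assms by blast
qed

text \<open>The residue ring modulo \<open>p\<close> is a field. Primality is used only in this form: inverses of nonzero
  residues.\<close>

definition residue_field :: "real \<Rightarrow> bool" where
  "residue_field p \<longleftrightarrow> (\<forall>x\<in>Zs. odvd p x \<or> (\<exists>u\<in>Zs. odvd p (u * x - 1))) \<and> \<not> odvd p 1"

lemma residue_fieldE: assumes "residue_field p" "x \<in> Zs" "\<not> odvd p x"
  obtains u where "u \<in> Zs" "odvd p (u * x - 1)"
  using assms unfolding residue_field_def by blast

lemma residue_field_prime:
  assumes "residue_field p" "x \<in> Zs" "y \<in> Zs" "odvd p (x * y)" "\<not> odvd p x"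
  shows "odvd p y"
proof -
  obtain u where u: "u \<in> Zs" "odvd p (u * x - 1)" using residue_fieldE[OF assms(1,2,5)] .
  have "odvd p (u * (x * y) - (u * x - 1) * y)"
    by (intro odvd_diff odvd_mult2 odvd_mult u assms)
  then show ?thesis by (simp add: algebra_simps)
qed

text \<open>Both the squares and the values of \<open>sqrt 2 - 3 b\<^sup>2\<close> fill more than half of the residue field,
  so they meet, unless 3 vanishes there; in that case \<open>(1 + 2 sqrt 2)\<^sup>2 = 9 + 4 sqrt 2\<close> helps.\<close>

lemma isotropic_coordinates:
  assumes "residue_field p" "p \<in> Zs" "p \<noteq> 0"
  shows "\<exists>a\<in>Zs. \<exists>b\<in>Zs. odvd p (a * a + 3 * b * b - sqrt 2)"
proof (cases "odvd p 3")
  case True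
  have "odvd p (3 * (3 + sqrt 2))" by (rule odvd_mult[OF True]) (simp add: Zs_add)
  moreover have "(1 + 2 * sqrt 2) * (1 + 2 * sqrt 2) + 3 * 0 * 0 - sqrt 2 = 3 * (3 + sqrt 2)"
    by (simp add: algebra_simps)
  ultimately have "odvd p ((1 + 2 * sqrt 2) * (1 + 2 * sqrt 2) + 3 * 0 * 0 - sqrt 2)" by (simp only:)
  then have "\<exists>b\<in>Zs. odvd p ((1 + 2 * sqrt 2) * (1 + 2 * sqrt 2) + 3 * b * b - sqrt 2)"
    using Zs_numeral(1) by (rule bexI)
  moreover have "1 + 2 * sqrt 2 \<in> Zs" by (intro Zs_add Zs_mult Zs_numeral)
  ultimately show ?thesis by (rule bexI)
next
  case False
  let ?A = "RO p"
  have fA: "finite ?A" using RO_card(1)[OF assms(2,3)] .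
  let ?f = "\<lambda>x. redO p (x * x)" and ?g = "\<lambda>x. redO p (sqrt 2 - 3 * x * x)"
  have zA: "redO p 0 \<in> ?A" by (simp add: redO_RO)
  have z0: "odvd p (redO p 0)" using redO(2)[of 0 p] by simp
  have gen: "card ?A + 1 \<le> 2 * card (h ` ?A)"
    if h: "\<And>x y. x \<in> ?A \<Longrightarrow> y \<in> ?A \<Longrightarrow> h x = h y \<longleftrightarrow> odvd p ((x - y) * (x + y))" for h :: "real \<Rightarrow> real"
  proof (rule card_half_image[OF fA zA])
    have pm: "y = x \<or> y = redO p (- x)" if xy: "x \<in> ?A" "y \<in> ?A" "h y = h x" for x y
    proof (cases "odvd p (y - x)")
      case True then show ?thesis using RO_eq_iff xy by blast
    next
      case False
      have Z: "x \<in> Zs" "y \<in> Zs" using xy RO_Zs by blast+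
      have "odvd p ((y - x) * (y + x))" using h xy by blast
      from residue_field_prime[OF assms(1) _ _ this False] Z have "odvd p (y - (- x))" by (simp add: Zs_add Zs_diff)
      then have "redO p y = redO p (- x)" using redO_eq_iff Z Zs_uminus by blast
      then show ?thesis using RO_fixed xy by metis
    qed
    show "card {y \<in> ?A. h y = h x} \<le> 2" if "x \<in> ?A" for x
    proof -
      have "{y \<in> ?A. h y = h x} \<subseteq> {x, redO p (- x)}" using pm that by blast
      then have "card {y \<in> ?A. h y = h x} \<le> card {x, redO p (- x)}" by (rule card_mono[rotated]) simp
      also have "\<dots> \<le> 2" by (simp add: card_insert_if)
      finally show ?thesis .
    qed
    show "x = redO p 0" if x: "x \<in> ?A" "h x = h (redO p 0)" for x
    proof -
      have "odvd p (redO p (- redO p 0) - (- redO p 0))" by (rule redO(2)[OF Zs_uminus[OF redO(1)]]) simp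
      from odvd_diff[OF this z0] have "odvd p (redO p (- redO p 0))" by simp
      then have "redO p (- redO p 0) = redO p 0"
        using RO_eq_iff[OF redO_RO zA, of "- redO p 0"] z0 odvd_diff Zs_uminus[OF RO_Zs[OF zA]] by blast
      then show ?thesis using pm[OF zA x(1)] x(2) by metis
    qed
  qed
  have "card ?A + 1 \<le> 2 * card (?f ` ?A)"
  proof (rule gen)
    fix x y assume "x \<in> ?A" "y \<in> ?A"
    then have Z: "x \<in> Zs" "y \<in> Zs" using RO_Zs by blast+
    have "x * x - y * y = (x - y) * (x + y)" by (simp add: algebra_simps)
    then show "?f x = ?f y \<longleftrightarrow> odvd p ((x - y) * (x + y))" using redO_eq_iff[OF Zs_mult Zs_mult] Z by simp
  qed
  moreover have "card ?A + 1 \<le> 2 * card (?g ` ?A)"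
  proof (rule gen)
    fix x y assume "x \<in> ?A" "y \<in> ?A"
    then have Z: "x \<in> Zs" "y \<in> Zs" using RO_Zs by blast+
    have Z2: "sqrt 2 - 3 * x * x \<in> Zs" "sqrt 2 - 3 * y * y \<in> Zs" "(x - y) * (x + y) \<in> Zs"
      using Z by (simp_all add: Zs_closed)
    have e: "(sqrt 2 - 3 * x * x) - (sqrt 2 - 3 * y * y) = - (3 * ((x - y) * (x + y)))" by (simp add: algebra_simps)
    have "?g x = ?g y \<longleftrightarrow> odvd p (- (3 * ((x - y) * (x + y))))" using redO_eq_iff[OF Z2(1,2)] unfolding e .
    also have "\<dots> \<longleftrightarrow> odvd p (3 * ((x - y) * (x + y)))" using odvd_uminus[of p "3 * ((x - y) * (x + y))"]
        odvd_uminus[of p "- (3 * ((x - y) * (x + y)))"] by auto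
    also have "\<dots> \<longleftrightarrow> odvd p ((x - y) * (x + y))"
      using residue_field_prime[OF assms(1) Zs_numeral(3) Z2(3) _ False] odvd_mult2[OF _ Zs_numeral(3)] by blast
    finally show "?g x = ?g y \<longleftrightarrow> odvd p ((x - y) * (x + y))" .
  qed
  ultimately have big: "card ?A < card (?f ` ?A) + card (?g ` ?A)" by linarith
  have sub: "?f ` ?A \<union> ?g ` ?A \<subseteq> ?A"
  proof
    fix z assume "z \<in> ?f ` ?A \<union> ?g ` ?A"
    then obtain x where x: "x \<in> ?A" "z = ?f x \<or> z = ?g x" by blast
    have "x \<in> Zs" using RO_Zs x by blast
    then show "z \<in> ?A" using x(2) redO_RO Zs_closed by (auto intro!: redO_RO Zs_mult Zs_diff)
  qed
  have "?f ` ?A \<inter> ?g ` ?A \<noteq> {}"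
  proof
    assume "?f ` ?A \<inter> ?g ` ?A = {}"
    then have "card (?f ` ?A) + card (?g ` ?A) = card (?f ` ?A \<union> ?g ` ?A)" using fA by (simp add: card_Un_disjoint)
    also have "\<dots> \<le> card ?A" by (rule card_mono[OF fA sub])
    finally show False using big by simp
  qed
  then obtain a b where ab: "a \<in> ?A" "b \<in> ?A" "redO p (a * a) = redO p (sqrt 2 - 3 * b * b)" by blast
  have Z: "a \<in> Zs" "b \<in> Zs" using ab RO_Zs by blast+
  have "odvd p (a * a - (sqrt 2 - 3 * b * b))"
    using ab(3) redO_eq_iff[of "a * a" "sqrt 2 - 3 * b * b" p] Z by (simp add: Zs_closed)
  moreover have "a * a - (sqrt 2 - 3 * b * b) = a * a + 3 * b * b - sqrt 2" by simp
  ultimately have "odvd p (a * a + 3 * b * b - sqrt 2)" by (simp only:)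
  then show ?thesis using Z by blast
qed

lemma trd_polar_qb: "trd (qb a' b' c' d' * qconj (qb a b c d)) =
  a' * (2 * a + b + c - sqrt 2 * d) + b' * (a + 2 * b + (1 + sqrt 2) * c + d)
  + c' * (a + (1 + sqrt 2) * b + 2 * c + d) + d' * (2 * d + b + c - sqrt 2 * a)"
  by (simp add: trd_def qconj_def qb_def times_bquat_def field_simps)

text \<open>If the linear form \<open>x \<mapsto> trd (x * qconj v)\<close> did not take the value one modulo \<open>p\<close>, it would vanish. Its
  values on the basis give four linear congruences for the coordinates of \<open>v\<close>, and eliminating requires
  division only by \<open>sqrt 2\<close> and by units, so all coordinates would be divisible by \<open>p\<close>.\<close>

lemma trace_form_unit:
  assumes "residue_field p" "p \<in> Zs" "p \<noteq> 0" "\<not> odvd p (sqrt 2)" "v \<in> QB" "\<not> qdvd p v"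
  shows "\<exists>x\<in>QB. odvd p (trd (x * qconj v) - 1)"
proof (rule ccontr)
  assume no: "\<not> (\<exists>x\<in>QB. odvd p (trd (x * qconj v) - 1))"
  have all: "odvd p (trd (x * qconj v))" if x: "x \<in> QB" for x
  proof (rule ccontr)
    assume n: "\<not> odvd p (trd (x * qconj v))"
    have "trd (x * qconj v) \<in> Zs" by (intro QB_trd QB_mult QB_qconj x assms)
    then obtain u where u: "u \<in> Zs" "odvd p (u * trd (x * qconj v) - 1)"
      using residue_fieldE[OF assms(1) _ n] by blast
    then have "odvd p (trd ((u *\<^sub>R x) * qconj v) - 1)" by (simp add: trd_scale)
    then show False using no QB_scale[OF u(1) x] by blast
  qed
  obtain a b c d where v: "v = qb a b c d" and Z: "a \<in> Zs" "b \<in> Zs" "c \<in> Zs" "d \<in> Zs"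
    using assms(5) by (rule QB_E)
  have 1: "odvd p (2 * a + b + c - sqrt 2 * d)"
    using all[OF QB_qb[of 1 0 0 0]] unfolding v trd_polar_qb by simp
  have 2: "odvd p (a + 2 * b + (1 + sqrt 2) * c + d)"
    using all[OF QB_qb[of 0 1 0 0]] unfolding v trd_polar_qb by simp
  have 3: "odvd p (a + (1 + sqrt 2) * b + 2 * c + d)"
    using all[OF QB_qb[of 0 0 1 0]] unfolding v trd_polar_qb by simp
  have 4: "odvd p (2 * d + b + c - sqrt 2 * a)"
    using all[OF QB_qb[of 0 0 0 1]] unfolding v trd_polar_qb by simp
  have s: "1 + sqrt 2 \<in> Zs" "2 + sqrt 2 \<in> Zs" "3 + sqrt 2 \<in> Zs" "sqrt 2 - 1 \<in> Zs" "1 - sqrt 2 \<in> Zs" by (simp_all add: Zs_closed)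
  \<comment> \<open>The second and third congruences differ by \<open>(sqrt 2 - 1) (b - c)\<close>, a unit multiple of \<open>b - c\<close>.\<close>
  have "odvd p ((1 + sqrt 2) * ((a + (1 + sqrt 2) * b + 2 * c + d) - (a + 2 * b + (1 + sqrt 2) * c + d)))"
    by (intro odvd_mult2 odvd_diff 2 3 s)
  then have bc: "odvd p (b - c)" by (simp add: algebra_simps)
  have "odvd p ((2 * a + b + c - sqrt 2 * d) + (b - c))" by (intro odvd_add 1 bc)
  then have "odvd p (sqrt 2 * (sqrt 2 * a + sqrt 2 * b - d))" by (simp add: algebra_simps)
  from residue_field_prime[OF assms(1) _ _ this assms(4)]
  have 5: "odvd p (sqrt 2 * a + sqrt 2 * b - d)" using Z by (simp add: Zs_closed)
  have "odvd p ((2 * d + b + c - sqrt 2 * a) + (b - c))" by (intro odvd_add 4 bc)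
  then have "odvd p (sqrt 2 * (sqrt 2 * d + sqrt 2 * b - a))" by (simp add: algebra_simps)
  from residue_field_prime[OF assms(1) _ _ this assms(4)]
  have 6: "odvd p (sqrt 2 * d + sqrt 2 * b - a)" using Z by (simp add: Zs_closed)
  have 7: "odvd p (a + (3 + sqrt 2) * b + d)"
  proof -
    have "odvd p ((a + (1 + sqrt 2) * b + 2 * c + d) + 2 * (b - c))" by (intro odvd_add odvd_mult2 3 bc Zs_numeral)
    then show ?thesis by (simp add: algebra_simps)
  qed
  have 8: "odvd p (d + (2 + sqrt 2) * b)"
  proof -
    have "odvd p ((sqrt 2 * a + sqrt 2 * b - d) + sqrt 2 * (sqrt 2 * d + sqrt 2 * b - a))"
      by (intro odvd_add odvd_mult2 5 6 Zs_numeral)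
    then show ?thesis by (simp add: algebra_simps)
  qed
  have b: "odvd p b"
  proof -
    have "odvd p ((1 - sqrt 2) * ((a + (3 + sqrt 2) * b + d) + (sqrt 2 * d + sqrt 2 * b - a) - (1 + sqrt 2) * (d + (2 + sqrt 2) * b)))"
      by (intro odvd_mult2 odvd_add odvd_diff 6 7 8 s)
    moreover have "(1 - sqrt 2) * ((a + (3 + sqrt 2) * b + d) + (sqrt 2 * d + sqrt 2 * b - a) - (1 + sqrt 2) * (d + (2 + sqrt 2) * b)) = b"
      by (simp add: algebra_simps)
    ultimately show ?thesis by (simp only:)
  qed
  have c: "odvd p c" using odvd_diff[OF b bc] by simp
  have d: "odvd p d" using odvd_diff[OF 8 odvd_mult2[OF b s(2)]] by simp
  have "odvd p (sqrt 2 * d + sqrt 2 * b - (sqrt 2 * d + sqrt 2 * b - a))"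
    by (intro odvd_diff odvd_add odvd_mult2 6 b d Zs_numeral)
  then have "odvd p a" by simp
  then show False using assms(6) b c d unfolding v qdvd_qb[OF assms(3)] by simp
qed

lemma qconj_mult_self_QB: "qconj t * (t * v) = nrd t *\<^sub>R v"
proof -
  have "qconj t * (t * v) = of_real (nrd t) * v" by (simp add: nrd_conj flip: mult.assoc)
  then show ?thesis by (simp add: of_real_def)
qed

text \<open>For an isotropic vector \<open>v\<close> that does not vanish modulo \<open>p\<close>, the fibres of
  \<open>x \<mapsto> x v\<close> on norm one residues are translates of the trace zero part of the annihilator \<open>L\<close>
  of \<open>v\<close>, and the trace maps \<open>L\<close> onto the residue field because the trace form is
  nondegenerate. So the number of norm one residues is at most \<open>q\<^sup>4 / q\<close>.\<close>

lemma idx_residue_field: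
  assumes "residue_field p" "p \<in> Zs" "p \<noteq> 0" "\<not> odvd p (sqrt 2)"
  shows "idx p \<le> card (RO p) ^ 3"
proof -
  obtain a b where ab: "a \<in> Zs" "b \<in> Zs" "odvd p (a * a + 3 * b * b - sqrt 2)"
    using isotropic_coordinates[OF assms(1-3)] by blast
  \<comment> \<open>In the standard basis this is \<open>v = a + b i + j\<close>.\<close>
  define v where "v = qb (a - b + 1 + sqrt 2) (2 * b - 1) (- 1) 2"
  have vQ: "v \<in> QB" unfolding v_def by (intro QB_qb Zs_add Zs_diff Zs_mult Zs_uminus Zs_numeral ab)
  have "nrd v = a * a + 3 * b * b - sqrt 2" unfolding v_def nrd_qb by (simp add: algebra_simps)
  then have nv: "odvd p (nrd v)" using ab by simp
  have n1: "\<not> odvd p (- 1)" using assms(1) odvd_uminus[of p "- 1"] by (auto simp: residue_field_def)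
  then have nd: "\<not> qdvd p v" unfolding v_def qdvd_qb[OF assms(3)] by simp
  have vp: "odvd p r" if r: "qdvd p (r *\<^sub>R v)" for r
  proof -
    have "odvd p (r * - 1)" using r unfolding v_def qb_scale qdvd_qb[OF assms(3)] by simp
    then show ?thesis using odvd_uminus[of p "- r"] by simp
  qed
  obtain x1 where x1: "x1 \<in> QB" "odvd p (trd (x1 * qconj v) - 1)"
    using trace_form_unit[OF assms vQ nd] by blast
  \<comment> \<open>An element of the annihilator of \<open>v\<close> whose trace is one modulo \<open>p\<close>.\<close>
  define w where "w = x1 * qconj v"
  have wQ: "w \<in> QB" unfolding w_def by (intro QB_mult QB_qconj x1 vQ)
  have wt: "odvd p (trd w - 1)" using x1 by (simp add: w_def)
  have wv: "qdvd p (w * v)"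
  proof -
    have "w * v = nrd v *\<^sub>R x1" by (simp add: w_def mult.assoc nrd_conj) (simp add: of_real_def)
    then show ?thesis using qdvd_odvd[OF nv x1(1)] by simp
  qed
  let ?R = "RQ p"
  define L where "L = {y \<in> ?R. qdvd p (y * v)}"
  define L0 where "L0 = {y \<in> L. odvd p (trd y)}"
  define N where "N = redQ p ` QB1"
  let ?f = "\<lambda>y. redQ p (y * v)"
  have fR: "finite ?R" using RQ_card(1) assms by blast
  have fL: "finite L" "finite L0" using fR by (simp_all add: L_def L0_def)
  have fN: "finite N" unfolding N_def using finite_idx assms by blast
  have LQ: "y \<in> QB" if "y \<in> L" for y using that RQ_QB by (auto simp: L_def)
  have L0L: "y \<in> L" if "y \<in> L0" for y using that by (simp add: L0_def)
  have LI: "redQ p t \<in> L" if t: "t \<in> QB" "qdvd p (t * v)" for t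
  proof -
    have "qdvd p ((redQ p t - t) * v + t * v)" by (intro qdvd_add qdvd_mult(1) redQ(2) t vQ)
    then show ?thesis using redQ_RQ[OF t(1)] by (simp add: L_def algebra_simps)
  qed
  have 1: "card N \<le> card L0 * card (?f ` N)"
  proof (rule card_le_fibres[OF fN])
    fix y0 assume "y0 \<in> N"
    then obtain x0 where x0: "x0 \<in> QB1" "y0 = redQ p x0" unfolding N_def by blast
    have x0Q: "x0 \<in> QB" "qconj x0 \<in> QB" using x0 QB1_D QB_qconj by simp_all
    let ?phi = "\<lambda>y. redQ p (qconj x0 * y - 1)"
    show "card {y \<in> N. ?f y = ?f y0} \<le> card L0"
    proof (rule card_inj_on_le[of ?phi, OF _ _ fL(2)])
      show "inj_on ?phi {y \<in> N. ?f y = ?f y0}"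
      proof (rule inj_onI, goal_cases)
        case (1 y y')
        have Q: "y \<in> ?R" "y' \<in> ?R" using 1(1,2) redQ_QB1_sub unfolding N_def by blast+
        have "qdvd p ((qconj x0 * y - 1) - (qconj x0 * y' - 1))"
          by (rule redQ_inj[OF _ _ 1(3)]) (intro QB_diff QB_one QB_mult x0Q RQ_QB[OF Q(1)] RQ_QB[OF Q(2)])+
        then have "qdvd p (qconj x0 * (y - y'))" by (simp add: right_diff_distrib)
        from qdvd_mult(2)[OF this x0Q(1)] have "qdvd p (y - y')" using x0(1) by simp
        then show ?case by (rule RQ_eqI[OF Q])
      qed
      show "?phi ` {y \<in> N. ?f y = ?f y0} \<subseteq> L0"
      proof
        fix z assume "z \<in> ?phi ` {y \<in> N. ?f y = ?f y0}"
        then obtain x where x: "x \<in> QB1" "z = ?phi (redQ p x)" "?f (redQ p x) = ?f y0"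
          unfolding N_def by blast
        have xQ: "x \<in> QB" using x QB1_D by simp
        have q1: "qdvd p (redQ p x * v - redQ p x0 * v)"
          using redQ_inj[OF _ _ x(3)] x0(2) QB_mult redQ(1) xQ x0Q(1) vQ by simp
        have q2: "qdvd p ((redQ p x - x) * v)" and q3: "qdvd p ((redQ p x0 - x0) * v)"
          by (intro qdvd_mult(1) redQ(2) xQ x0Q vQ)+
        have "qdvd p ((redQ p x * v - redQ p x0 * v) - (redQ p x - x) * v + (redQ p x0 - x0) * v)"
          using qdvd_add[OF qdvd_diff[OF q1 q2] q3] .
        then have xv: "qdvd p ((x - x0) * v)" by (simp add: algebra_simps)
        define t where "t = qconj x0 * x - 1"
        have tQ: "t \<in> QB" unfolding t_def by (intro QB_diff QB_one QB_mult x0Q xQ)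
        have "t * v = qconj x0 * ((x - x0) * v)" unfolding t_def using x0(1) by (simp add: algebra_simps)
        then have tv: "qdvd p (t * v)" using qdvd_mult(2)[OF xv x0Q(2)] by simp
        have "qdvd p (qconj t * (t * v))" by (intro qdvd_mult(2) tv QB_qconj tQ)
        then have nt: "odvd p (nrd t)" unfolding qconj_mult_self_QB by (rule vp)
        have "nrd (t + 1) = 1" using QB1_D(2)[OF QB1_mult[OF QB1_qconj[OF x0(1)] x(1)]] by (simp add: t_def)
        then have "trd t = - nrd t" unfolding nrd_add by simp
        then have tt: "odvd p (trd t)" using odvd_uminus[OF nt] by simp
        have z: "z = redQ p t"
        proof -
          have "qdvd p (qconj x0 * (redQ p x - x))" by (intro qdvd_mult(2) redQ(2) xQ x0Q)
          then show ?thesis unfolding x(2) t_def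
            by (subst redQ_eq_iff) (simp_all add: QB_diff QB_one QB_mult x0Q xQ redQ(1) right_diff_distrib)
        qed
        have "odvd p (trd (redQ p t - t) + trd t)" by (intro odvd_add tt qdvd_trd redQ(2) tQ)
        then show "z \<in> L0" using LI[OF tQ tv] by (simp add: z L0_def trd_diff)
      qed
    qed
  qed
  have "card L * card (?f ` ?R) \<le> card ?R"
  proof (rule card_ge_fibres[OF fR, of _ _ ?f])
    show "finite (?f ` ?R)" using fR by simp
    fix c assume "c \<in> ?f ` ?R"
    then obtain y0 where y0: "y0 \<in> ?R" "c = ?f y0" by blast
    have y0Q: "y0 \<in> QB" using y0 RQ_QB by blast
    let ?phi = "\<lambda>t. redQ p (y0 + t)"
    show "card L \<le> card {x \<in> ?R. ?f x = c}"
    proof (rule card_inj_on_le[of ?phi])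
      show "inj_on ?phi L"
      proof (rule inj_onI, goal_cases)
        case (1 y y')
        have "qdvd p ((y0 + y) - (y0 + y'))"
          by (rule redQ_inj[OF _ _ 1(3)]) (intro QB_add y0Q LQ[OF 1(1)] LQ[OF 1(2)])+
        then have "qdvd p (y - y')" by simp
        then show ?case using RQ_eqI[of y p y'] 1(1,2) by (simp add: L_def)
      qed
      show "?phi ` L \<subseteq> {x \<in> ?R. ?f x = c}"
      proof
        fix z assume "z \<in> ?phi ` L"
        then obtain t where t: "t \<in> L" "z = ?phi t" by blast
        have tQ: "t \<in> QB" using LQ t by blast
        have sQ: "y0 + t \<in> QB" by (intro QB_add y0Q tQ)
        have "qdvd p ((?phi t - (y0 + t)) * v + t * v)"
          by (rule qdvd_add[OF qdvd_mult(1)[OF redQ(2)[OF sQ] vQ]]) (use t(1) in \<open>simp add: L_def\<close>)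
        then have "qdvd p (z * v - y0 * v)" using t(2) by (simp add: algebra_simps)
        then have "?f z = c" unfolding y0(2) t(2) by (subst redQ_eq_iff) (intro QB_mult redQ(1) sQ vQ y0Q | assumption)+
        then show "z \<in> {x \<in> ?R. ?f x = c}" using t(2) redQ_RQ[OF sQ] by simp
      qed
    qed (use fR in simp)
  qed
  moreover have "card (?f ` N) \<le> card (?f ` ?R)"
    by (rule card_mono) (use fR redQ_QB1_sub in \<open>auto simp: N_def\<close>)
  ultimately have 2: "card L * card (?f ` N) \<le> card ?R" by (meson le_trans mult_le_mono2)
  have 3: "card L0 * card (RO p) \<le> card L"
  proof (rule card_ge_fibres[OF fL(1) _ RO_card(1)[OF assms(2,3)]])
    fix c assume c: "c \<in> RO p"
    have cZ: "c \<in> Zs" using c RO_Zs by blast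
    let ?phi = "\<lambda>y. redQ p (y + c *\<^sub>R w)"
    show "card L0 \<le> card {x \<in> L. redO p (trd x) = c}"
    proof (rule card_inj_on_le[of ?phi])
      show "inj_on ?phi L0"
      proof (rule inj_onI, goal_cases)
        case (1 y y')
        have "qdvd p ((y + c *\<^sub>R w) - (y' + c *\<^sub>R w))"
          by (rule redQ_inj[OF _ _ 1(3)]) (intro QB_add QB_scale cZ wQ LQ L0L 1(1) 1(2))+
        then have "qdvd p (y - y')" by simp
        then show ?case using RQ_eqI[of y p y'] 1(1,2) by (simp add: L0_def L_def)
      qed
      show "?phi ` L0 \<subseteq> {x \<in> L. redO p (trd x) = c}"
      proof
        fix z assume "z \<in> ?phi ` L0"
        then obtain y where y: "y \<in> L0" "z = ?phi y" by blast
        have yQ: "y \<in> QB" using LQ L0L y by blast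
        have sQ: "y + c *\<^sub>R w \<in> QB" by (intro QB_add QB_scale cZ wQ yQ)
        have "qdvd p (y * v + c *\<^sub>R (w * v))"
          by (rule qdvd_add[OF _ qdvd_scale[OF wv cZ]]) (use y(1) in \<open>simp add: L0_def L_def\<close>)
        then have "qdvd p ((y + c *\<^sub>R w) * v)" by (simp add: algebra_simps)
        from LI[OF sQ this] have zL: "z \<in> L" unfolding y(2) .
        have "odvd p (trd (?phi y - (y + c *\<^sub>R w)) + trd y + c * (trd w - 1))"
          by (rule odvd_add[OF odvd_add[OF qdvd_trd[OF redQ(2)[OF sQ]]] odvd_mult2[OF wt cZ]])
            (use y(1) in \<open>simp add: L0_def\<close>)
        then have "odvd p (trd z - c)" by (simp add: y(2) trd_simps algebra_simps)
        then have "redO p (trd z) = redO p c"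
          using redO_eq_iff[OF QB_trd[OF LQ[OF zL]] cZ] by simp
        then show "z \<in> {x \<in> L. redO p (trd x) = c}" using zL RO_fixed[OF c] by simp
      qed
    qed (use fL in simp)
  qed
  have "card N * card (RO p) \<le> (card L0 * card (RO p)) * card (?f ` N)"
    using mult_le_mono1[OF 1, of "card (RO p)"] by (simp add: mult_ac)
  also have "\<dots> \<le> card L * card (?f ` N)" using 3 by (rule mult_le_mono1)
  also have "\<dots> \<le> card ?R" by (rule 2)
  also have "\<dots> \<le> card (RO p) ^ 3 * card (RO p)"
    using RQ_card(2)[OF assms(2,3)] by (simp add: power4_eq_xxxx power3_eq_cube)
  finally show ?thesis using RO_pos[OF assms(2,3)] unfolding idx_def N_def by simp
qed

lemma Zs_unit_dvd: assumes "x \<in> Zs" "anorm x = 1" shows "odvd x 1"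
  using anorm_unit[OF assms] unfolding odvd_def by metis

text \<open>A divisor of least norm above one generates, with any element that it does not divide, the unit
  ideal.\<close>

lemma minimal_divisor:
  assumes "d \<in> Zs" "d \<noteq> 0" "anorm d \<noteq> 1"
  shows "\<exists>p\<in>Zs. p \<noteq> 0 \<and> odvd p d \<and> residue_field p"
proof -
  define f where "f x = nat \<lfloor>anorm x\<rfloor>" for x
  have f: "real (f x) = anorm x" if "x \<in> Zs" for x using that by (metis f_def floor_of_nat nat_int anorm_nat)
  let ?P = "\<lambda>x. x \<in> Zs \<and> odvd x d \<and> anorm x \<noteq> 1"
  have "?P d" using assms by simp
  then obtain p where p: "?P p" "\<And>y. ?P y \<Longrightarrow> f p \<le> f y"
    using ex_has_least_nat[of ?P d f] by blast
  have pZ: "p \<in> Zs" and pd: "odvd p d" and p1: "anorm p \<noteq> 1" using p(1) by simp_all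
  have p0: "p \<noteq> 0" using pd assms(2) by (auto simp: odvd_def)
  have n1: "\<not> odvd p 1"
  proof
    assume "odvd p 1"
    then have "anorm p \<le> anorm 1" using odvd_anorm_le pZ by simp
    then show False using anorm_ge_1[OF pZ p0] p1 by (simp add: anorm_def)
  qed
  have "odvd p x \<or> (\<exists>u\<in>Zs. odvd p (u * x - 1))" if x: "x \<in> Zs" for x
  proof -
    obtain g u v where g: "g \<in> Zs" "g \<noteq> 0" "odvd g p" "odvd g x" and uv: "u \<in> Zs" "v \<in> Zs" "g = u * p + v * x"
      using Zs_bezout[OF pZ x p0] by blast
    show ?thesis
    proof (cases "anorm g = 1")
      case True
      then obtain h where h: "h \<in> Zs" "g * h = 1" using anorm_unit g by blast
      have "(h * v) * x - 1 = p * (- (h * u))" using h(2) unfolding uv(3) by (simp add: algebra_simps)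
      moreover have "odvd p (p * (- (h * u)))" by (intro odvd_multI Zs_uminus Zs_mult h uv)
      ultimately have "odvd p ((h * v) * x - 1)" by (simp only:)
      moreover have "h * v \<in> Zs" by (intro Zs_mult h uv)
      ultimately show ?thesis by blast
    next
      case False
      have "odvd g d" using odvd_trans g pd by blast
      then have "f p \<le> f g" using p(2)[of g] g False by simp
      then have "anorm p \<le> anorm g" using f[OF pZ] f[OF g(1)] by linarith
      moreover have "anorm g \<le> anorm p" using odvd_anorm_le[OF g(1,3) p0] .
      ultimately have "odvd p g" using odvd_anorm_eq[OF g(1,3) p0] by simp
      then show ?thesis using odvd_trans g by blast
    qed
  qed
  then have "residue_field p" using n1 unfolding residue_field_def by simp
  then show ?thesis using pZ p0 pd by blast
qed

lemma anorm_sqrt2: "anorm (sqrt 2) = 2" by (simp add: anorm_def)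

lemma anorm_nonneg: "0 \<le> anorm x" by (simp add: anorm_def)

text \<open>The factor 2 is lost at most once, when the prime \<open>sqrt 2\<close> enters for the first time.\<close>

lemma idx_bound:
  assumes "d \<in> Zs" "d \<noteq> 0"
  shows "real (idx d) \<le> (if odvd (sqrt 2) d then 2 else 1) * anorm d ^ 3"
  using assms
proof (induction "nat \<lfloor>anorm d\<rfloor>" arbitrary: d rule: less_induct)
  case less
  note dZ = less.prems(1) and d0 = less.prems(2)
  have fl: "real (nat \<lfloor>anorm x\<rfloor>) = anorm x" if "x \<in> Zs" for x using that by (metis floor_of_nat nat_int anorm_nat)
  have one_le: "1 \<le> anorm d" using anorm_ge_1 dZ d0 by blast
  show ?case
  proof (cases "anorm d = 1")
    case True
    have "real (card (RO d)) \<le> 1" using RO_card(2)[OF dZ d0] True by simp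
    then have "card (RO d) \<le> 1" by simp
    then have "card (RO d) ^ 4 \<le> 1" using power_mono[of "card (RO d)" 1 4] by simp
    then have "idx d \<le> 1" using idx_le_RQ[OF dZ d0] by linarith
    then have "real (idx d) \<le> 1" by simp
    then show ?thesis using True by simp
  next
    case False
    obtain p where p: "p \<in> Zs" "p \<noteq> 0" "odvd p d" "residue_field p" using minimal_divisor[OF dZ d0 False] by blast
    obtain e where e: "e \<in> Zs" "d = p * e" using p(3) unfolding odvd_def by blast
    have e0: "e \<noteq> 0" using d0 e by simp
    have de: "d = e * p" using e by simp
    have nmd: "anorm d = anorm e * anorm p" unfolding de using anorm_mult e p by simp
    have np1: "\<not> odvd p 1" using p(4) by (simp add: residue_field_def)
    have "anorm p \<noteq> 1" using Zs_unit_dvd p np1 by blast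
    then have np: "anorm p \<ge> 2"
    proof -
      obtain n where n: "anorm p = real n" using anorm_nat p(1) by blast
      have "n \<noteq> 1" "n \<noteq> 0" using \<open>anorm p \<noteq> 1\<close> n anorm_ge_1[OF p(1,2)] by auto
      then have "n \<ge> 2" by simp
      then show ?thesis using n by simp
    qed
    have ne: "anorm e \<ge> 1" using anorm_ge_1 e e0 by blast
    have "anorm e * 2 \<le> anorm e * anorm p" using np ne by (intro mult_left_mono) simp_all
    then have "anorm e < anorm d" using nmd ne by linarith
    then have "nat \<lfloor>anorm e\<rfloor> < nat \<lfloor>anorm d\<rfloor>" using fl[OF e(1)] fl[OF dZ] by linarith
    from less.hyps[OF this e(1) e0]
    have IH: "real (idx e) \<le> (if odvd (sqrt 2) e then 2 else 1) * anorm e ^ 3" .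
    let ?F = "card (redQ (e * p) ` Gam e)"
    have step: "idx d \<le> ?F * idx e" unfolding de by (rule idx_step[OF e(1) p(1) e0 p(2)])
    then have stepr: "real (idx d) \<le> real ?F * real (idx e)" by (simp flip: of_nat_mult)
    have cub: "real (card (RO p) ^ 3) \<le> anorm p ^ 3"
      using RO_card(2)[OF p(1,2)] by (simp add: power_mono)
    have cop: "?F \<le> idx p" if n: "\<not> odvd p e"
    proof -
      obtain u where u: "u \<in> Zs" "odvd p (u * e - 1)" using residue_fieldE[OF p(4) e(1) n] .
      obtain y where y: "y \<in> Zs" "u * e - 1 = p * y" using u(2) unfolding odvd_def by blast
      have "u * e + (- y) * p = 1" using y(2) by (simp add: algebra_simps)
      then show ?thesis using Gam_card_coprime[OF e(1) p(1) e0 p(2) u(1) Zs_uminus[OF y(1)]] by simp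
    qed
    have s2d: "odvd (sqrt 2) e \<Longrightarrow> odvd (sqrt 2) d" unfolding de using odvd_mult p by blast
    have ram: "?F \<le> card (RO p) ^ 3" if "odvd p e"
      using Gam_card_repeated[OF e(1) p(1) e0 p(2) that] .
    have main: ?thesis if F: "real ?F \<le> anorm p ^ 3"
    proof -
      have "real (idx d) \<le> anorm p ^ 3 * ((if odvd (sqrt 2) e then 2 else 1) * anorm e ^ 3)"
        using stepr mult_mono[OF F IH] anorm_nonneg[of p] by simp
      also have "\<dots> = (if odvd (sqrt 2) e then 2 else 1) * anorm d ^ 3"
        unfolding nmd by (simp add: power_mult_distrib)
      also have "\<dots> \<le> (if odvd (sqrt 2) d then 2 else 1) * anorm d ^ 3"
        using s2d one_le by (intro mult_right_mono) auto
      finally show ?thesis .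
    qed
    show ?thesis
    proof (cases "odvd p e")
      case True
      then show ?thesis using ram cub main by (meson of_nat_le_iff order_trans)
    next
      case npe: False
      show ?thesis
      proof (cases "odvd p (sqrt 2)")
        case False
        have "?F \<le> card (RO p) ^ 3" using cop[OF npe] idx_residue_field[OF p(4,1,2) False] by (rule order_trans)
        then show ?thesis using cub main by (meson of_nat_le_iff order_trans)
      next
        case True
        \<comment> \<open>Here \<open>p\<close> is \<open>sqrt 2\<close> up to a unit and there are at most \<open>2\<^sup>4 = 2 * 2\<^sup>3\<close> residues.\<close>
        have "anorm p \<le> 2" using odvd_anorm_le[OF p(1) True] anorm_sqrt2 by simp
        with np have np2: "anorm p = 2" by simp
        have sp: "odvd (sqrt 2) p" using odvd_anorm_eq[OF p(1) True] np2 anorm_sqrt2 by simp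
        have sd: "odvd (sqrt 2) d" unfolding e(2) using odvd_mult[OF sp e(1)] .
        have nse: "\<not> odvd (sqrt 2) e" using npe odvd_trans[OF True] by blast
        have "real (card (RO p)) \<le> 2" using RO_card(2)[OF p(1,2)] np2 by simp
        then have "card (RO p) \<le> 2" by simp
        then have "card (RO p) ^ 4 \<le> 2 ^ 4" by (rule power_mono) simp
        then have "?F \<le> 16" using cop[OF npe] idx_le_RQ[OF p(1,2)] by simp
        then have "real ?F \<le> 16" by simp
        then have "real ?F * real (idx e) \<le> 16 * anorm e ^ 3"
          using IH nse by (intro mult_mono) simp_all
        then show ?thesis using stepr sd np2 nmd by (simp add: power_mult_distrib)
      qed
    qed
  qed
qed

lemma idx_le: assumes "d \<in> Zs" "d \<noteq> 0" shows "real (idx d) \<le> 2 * anorm d ^ 3"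
proof -
  have "0 \<le> anorm d ^ 3" by (simp add: anorm_nonneg)
  then show ?thesis using idx_bound[OF assms] by (auto split: if_splits)
qed

section \<open>Generation by two rotations\<close>

text \<open>The element \<open>iota\<close> is a square root of \<open>- 1\<close> in the real algebra; it generates the field of \<open>zB\<close>, an
  eighth root of unity, and singles out the common fixed point \<open>z0\<close> of both. With the fixed point as base
  point, \<open>cosh_dist x\<close> is the hyperbolic cosine of the distance that \<open>x\<close> moves it.\<close>

definition zB :: bquat where "zB = alphaB * betaB"
definition iota :: bquat where "iota = 1 + sqrt 2 *\<^sub>R zB"
definition cosh_dist :: "bquat \<Rightarrow> real" where "cosh_dist x = - trd (iota * x * iota * qconj x) / 2"

lemma alphaB_BQ: "alphaB = BQ (1/2) (1/2) 0 0"
  unfolding qb_gens by (simp add: qb_def)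

lemma zB_qb: "zB = qb 0 0 0 1"
  unfolding zB_def qb_gens qb_mult by simp

lemma zB_BQ: "zB = BQ (- sqrt 2/2) (1/3 + sqrt 2/6) (1/2) (- 1/6)"
  unfolding zB_qb by (simp add: qb_def)

lemma iota_BQ: "iota = BQ 0 ((1 + sqrt 2)/3) (sqrt 2/2) (- sqrt 2/6)"
  unfolding iota_def zB_BQ by (simp add: bquat_defs field_simps)

lemma iota_sq: "iota * iota = - 1"
  unfolding iota_BQ by (simp add: bquat_defs field_simps)

lemma iota_simps [simp]: "qconj iota = - iota" "trd iota = 0" "nrd iota = 1" "iota * (iota * x) = - x"
proof -
  show "qconj iota = - iota" "trd iota = 0" unfolding iota_BQ by (simp_all add: qconj_def uminus_bquat_def trd_def)
  show "nrd iota = 1" unfolding iota_BQ by (simp add: nrd_def power2_eq_square field_simps)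
  show "iota * (iota * x) = - x" by (simp add: iota_sq flip: mult.assoc)
qed

lemma zB_iota: "zB = (sqrt 2 / 2) *\<^sub>R (iota - 1)"
  unfolding iota_def by simp

lemma gens_QB1: "alphaB \<in> QB1" "zB \<in> QB1"
proof -
  show "alphaB \<in> QB1" unfolding QB1_def qb_gens by (simp add: nrd_qb QB_qb)
  show "zB \<in> QB1" unfolding QB1_def zB_qb by (simp add: nrd_qb QB_qb)
qed

lemma alphaB_cube: "alphaB * (alphaB * alphaB) = - 1"
  unfolding qb_gens qb_mult by (simp add: qb_def uminus_bquat_def)

lemma qconj_alphaB: "qconj alphaB = - (alphaB * alphaB)"
  unfolding qb_gens qb_mult by (simp add: qb_def qconj_def uminus_bquat_def)

lemma zB_power: "zB * zB = - iota" "zB * (zB * (zB * zB)) = - 1" "qconj zB = - (zB * (zB * zB))"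
proof -
  show 1: "zB * zB = - iota" unfolding zB_BQ iota_BQ by (simp add: bquat_defs field_simps)
  have "zB * (zB * (zB * zB)) = (zB * zB) * (zB * zB)" by (simp add: mult.assoc)
  then show 2: "zB * (zB * (zB * zB)) = - 1" by (simp add: 1 iota_sq)
  have "qconj zB * (zB * (zB * (zB * zB))) = - qconj zB" unfolding 2 by simp
  then show "qconj zB = - (zB * (zB * zB))" using gens_QB1 by simp
qed

text \<open>The monoid generated by the two rotations; as both have finite order it is a group.\<close>

inductive_set G0 :: "bquat set" where
  one: "1 \<in> G0"
| alpha: "g \<in> G0 \<Longrightarrow> g * alphaB \<in> G0"
| z: "g \<in> G0 \<Longrightarrow> g * zB \<in> G0"

lemma G0_QB1: "g \<in> G0 \<Longrightarrow> g \<in> QB1"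
  by (induction rule: G0.induct) (simp_all add: QB1_one QB1_mult gens_QB1)

lemma G0_mult: assumes "x \<in> G0" "y \<in> G0" shows "x * y \<in> G0"
  using assms(2)
proof induction
  case one then show ?case using assms by simp
next
  case (alpha g) then show ?case using G0.alpha[of "x * g"] by (simp add: mult.assoc)
next
  case (z g) then show ?case using G0.z[of "x * g"] by (simp add: mult.assoc)
qed

lemma G0_gens: "alphaB \<in> G0" "zB \<in> G0"
  using G0.alpha[OF G0.one] G0.z[OF G0.one] by simp_all

lemma G0_uminus: "x \<in> G0 \<Longrightarrow> - x \<in> G0"
  using G0_mult[OF _ G0_mult[OF G0_gens(1) G0_mult[OF G0_gens(1) G0_gens(1)]], of x] unfolding alphaB_cube by simp

lemma G0_qconj: "x \<in> G0 \<Longrightarrow> qconj x \<in> G0"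
proof (induction rule: G0.induct)
  case one then show ?case by (simp add: G0.one)
next
  case (alpha g)
  have "qconj alphaB \<in> G0" unfolding qconj_alphaB by (intro G0_uminus G0_mult G0_gens)
  then show ?case unfolding qconj_mult using G0_mult alpha by blast
next
  case (z g)
  have "qconj zB \<in> G0" unfolding zB_power(3) by (intro G0_uminus G0_mult G0_gens)
  then show ?case unfolding qconj_mult using G0_mult z by blast
qed

text \<open>Written through \<open>zB\<close> instead of \<open>iota\<close>, the excess over 1 is minus the trace of an element of the
  order of norm one, hence an algebraic integer with conjugate at most 2.\<close>

lemma cosh_dist_eq: assumes "g \<in> QB1" shows "cosh_dist g = 1 - trd (zB * g * zB * qconj g)"
proof -
  have "iota * g * iota * qconj g = 2 *\<^sub>R (zB * g * zB * qconj g) + sqrt 2 *\<^sub>R (zB * (g * qconj g))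
     + sqrt 2 *\<^sub>R (g * zB * qconj g) + g * qconj g"
    unfolding iota_def by (simp add: algebra_simps)
  also have "\<dots> = 2 *\<^sub>R (zB * g * zB * qconj g) + sqrt 2 *\<^sub>R zB + sqrt 2 *\<^sub>R (g * zB * qconj g) + 1"
    using assms by simp
  finally have e: "iota * g * iota * qconj g = 2 *\<^sub>R (zB * g * zB * qconj g) + sqrt 2 *\<^sub>R zB + sqrt 2 *\<^sub>R (g * zB * qconj g) + 1" .
  have t: "trd zB = - sqrt 2" unfolding zB_qb trd_qb by simp
  have "trd (g * zB * qconj g) = trd (qconj g * (g * zB))" by (rule trd_commute)
  also have "\<dots> = - sqrt 2" using assms t by simp
  finally have t2: "trd (g * zB * qconj g) = - sqrt 2" .
  show ?thesis unfolding cosh_dist_def e trd_simps t t2 by simp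
qed

text \<open>With \<open>t\<close> the part of \<open>g\<close> anticommuting with \<open>iota\<close>, \<open>cosh_dist g = nrd g - 2 nrd t\<close>, and the norm
  form is negative definite on the anticommuting plane.\<close>

lemma cosh_dist_ge: assumes "g \<in> QB1"
  shows "cosh_dist g \<ge> 1" "cosh_dist g = 1 \<Longrightarrow> g * iota = iota * g"
proof -
  \<comment> \<open>This is half of \<open>g\<close> minus its conjugate by \<open>iota\<close>, the anticommuting part.\<close>
  define t where "t = (1/2) *\<^sub>R (g + iota * g * iota)"
  have "nrd (g + iota * g * iota) = 2 * nrd g + trd (g * qconj (iota * g * iota))"
    unfolding nrd_add by (simp add: nrd_mult)
  also have "g * qconj (iota * g * iota) = g * (iota * (qconj g * iota))" by (simp add: qconj_mult mult.assoc)
  also have "trd (g * (iota * (qconj g * iota))) = trd (iota * g * iota * qconj g)"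
    using trd_commute[of iota "g * iota * qconj g"] by (simp add: mult.assoc)
  also have "\<dots> = - 2 * cosh_dist g" by (simp add: cosh_dist_def)
  finally have "4 * nrd t = 2 - 2 * cosh_dist g" using assms by (simp add: t_def QB1_D power2_eq_square)
  then have c: "cosh_dist g = 1 - 2 * nrd t" by simp
  have "trd (iota * g * iota) = trd (iota * (iota * g))" using trd_commute[of "iota * g" iota] by (simp only: mult.assoc)
  then have t0: "trd t = 0" by (simp add: t_def trd_simps)
  have "trd (g * iota) = trd (iota * g)" by (rule trd_commute)
  then have it: "trd (iota * t) = 0" by (simp add: t_def trd_simps distrib_left mult.assoc)
  have q0: "q0 t = 0" using t0 by (simp add: trd_def)
  let ?b = "q2 t" and ?c = "q3 t"
  have "(1 + sqrt 2) * q1 t = ?b - ?c"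
    using it unfolding iota_BQ trd_def by (simp add: times_bquat_def field_simps)
  then have "(sqrt 2 - 1) * ((1 + sqrt 2) * q1 t) = (sqrt 2 - 1) * (?b - ?c)" by simp
  then have q1: "q1 t = (sqrt 2 - 1) * (?b - ?c)" by (simp add: algebra_simps)
  have s: "707/500 < sqrt 2" "sqrt 2 < 283/200" by (rule real_less_rsqrt, simp add: power2_eq_square) (rule real_less_lsqrt, simp_all add: power2_eq_square)
  have "(sqrt 2 - 1)\<^sup>2 = 3 - 2 * sqrt 2" by (simp add: power2_eq_square algebra_simps)
  then have n: "nrd t = 3 * (3 - 2 * sqrt 2) * (?b - ?c)\<^sup>2 - sqrt 2 * ?b\<^sup>2 - 3 * sqrt 2 * ?c\<^sup>2"
    unfolding nrd_def q0 q1 power_mult_distrib by simp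
  have "3 * (3 - 2 * sqrt 2) * (?b - ?c)\<^sup>2 \<le> 13/25 * (?b - ?c)\<^sup>2" using s by (intro mult_right_mono) simp_all
  moreover have "(?b - ?c)\<^sup>2 + (?b + ?c)\<^sup>2 = 2 * ?b\<^sup>2 + 2 * ?c\<^sup>2" by (simp add: power2_eq_square algebra_simps)
  moreover have "0 \<le> (?b + ?c)\<^sup>2" by simp
  moreover have "7/5 * ?b\<^sup>2 \<le> sqrt 2 * ?b\<^sup>2" "7/5 * ?c\<^sup>2 \<le> sqrt 2 * ?c\<^sup>2" using s by (intro mult_right_mono; simp)+
  ultimately have nt: "nrd t \<le> - (3/10 * ?b\<^sup>2) - 3 * ?c\<^sup>2" unfolding n using zero_le_power2[of ?b] zero_le_power2[of ?c] by linarith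
  then show "cosh_dist g \<ge> 1" unfolding c using zero_le_power2[of ?b] zero_le_power2[of ?c] by linarith
  assume "cosh_dist g = 1"
  then have "nrd t = 0" using c by simp
  then have "?b\<^sup>2 = 0" "?c\<^sup>2 = 0" using nt zero_le_power2[of ?b] zero_le_power2[of ?c] by linarith+
  then have "t = 0" using q0 q1 by (simp add: bquat_eq_iff zero_bquat_def)
  then have "g + iota * g * iota = 0" by (simp add: t_def)
  then have "iota * (g + iota * g * iota) = 0" by simp
  then show "g * iota = iota * g" by (simp add: distrib_left mult.assoc)
qed

text \<open>The polar form of the norm on trace zero quaternions, of signature \<open>(1,2)\<close>: its positive vectors of norm one, up to
  sign, are the points of the hyperboloid model, and the conjugates of \<open>iota\<close> are the orbit of the base
  point.\<close>

definition lorentz :: "bquat \<Rightarrow> bquat \<Rightarrow> real" where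
  "lorentz u v = 3 * q1 u * q1 v - sqrt 2 * q2 u * q2 v - 3 * sqrt 2 * q3 u * q3 v"

lemma cosh_dist_lorentz: "cosh_dist (qconj u * h) = lorentz (u * iota * qconj u) (h * iota * qconj h)"
proof -
  have "trd (iota * (qconj u * h) * iota * qconj (qconj u * h)) =
    trd (iota * qconj u * (h * iota * qconj h) * u)" by (simp add: qconj_mult mult.assoc)
  also have "\<dots> = trd (u * (iota * qconj u * (h * iota * qconj h)))" by (rule trd_commute)
  finally have e: "cosh_dist (qconj u * h) = - q0 ((u * iota * qconj u) * (h * iota * qconj h))"
    by (simp add: cosh_dist_def trd_def mult.assoc)
  have z: "q0 (g * iota * qconj g) = 0" for g
  proof -
    have "trd (g * iota * qconj g) = trd (iota * (qconj g * g))"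
      using trd_commute[of g "iota * qconj g"] by (simp add: mult.assoc)
    also have "\<dots> = nrd g * trd iota" unfolding nrd_conj of_real_def by (simp only: mult_scaleR_right trd_scale mult_1_right)
    finally show ?thesis by (simp add: trd_def[of "g * iota * qconj g"])
  qed
  show ?thesis unfolding e times_bquat_def[of "u * iota * qconj u"] z lorentz_def by (simp add: z)
qed

text \<open>The images of the base point under \<open>zB ^ k * alphaB\<close> and \<open>zB ^ k * qconj alphaB\<close>: the nearest other
  points of its orbit under \<open>G0\<close>.\<close>

lemma eight_neighbours:
  "alphaB * iota * qconj alphaB = BQ 0 ((1 + sqrt 2)/3) 0 (sqrt 2/3)"
  "(zB * alphaB) * iota * qconj (zB * alphaB) = BQ 0 (1 + sqrt 2) (2 + sqrt 2) 0"
  "(zB * (zB * alphaB)) * iota * qconj (zB * (zB * alphaB)) = BQ 0 (5/3 + sqrt 2) (2 + sqrt 2) (- 2/3 - 2 * sqrt 2/3)"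
  "(zB * (zB * (zB * alphaB))) * iota * qconj (zB * (zB * (zB * alphaB))) = BQ 0 (1 + sqrt 2/3) 0 (- 2/3 - sqrt 2/3)"
  "qconj alphaB * iota * qconj (qconj alphaB) = BQ 0 ((1 + sqrt 2)/3) (- sqrt 2/2) (- sqrt 2/6)"
  "(zB * qconj alphaB) * iota * qconj (zB * qconj alphaB) = BQ 0 (1 + sqrt 2/3) (1 + sqrt 2/2) (1/3 + sqrt 2/6)"
  "(zB * (zB * qconj alphaB)) * iota * qconj (zB * (zB * qconj alphaB)) = BQ 0 (5/3 + sqrt 2) (2 + 3 * sqrt 2/2) (- 2/3 - sqrt 2/6)"
  "(zB * (zB * (zB * qconj alphaB))) * iota * qconj (zB * (zB * (zB * qconj alphaB))) = BQ 0 (1 + sqrt 2) (1 + sqrt 2/2) (- 1 - sqrt 2/2)"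
proof -
  have J: "(zB * g) * iota * qconj (zB * g) = zB * ((g * iota * qconj g) * qconj zB)" for g
    by (simp add: qconj_mult mult.assoc)
  have zc: "qconj zB = BQ (- sqrt 2/2) (- 1/3 - sqrt 2/6) (- 1/2) (1/6)" unfolding zB_BQ by (simp add: qconj_def)
  show 1: "alphaB * iota * qconj alphaB = BQ 0 ((1 + sqrt 2)/3) 0 (sqrt 2/3)"
    unfolding alphaB_BQ iota_BQ by (simp add: qconj_def times_bquat_def field_simps)
  show 2: "(zB * alphaB) * iota * qconj (zB * alphaB) = BQ 0 (1 + sqrt 2) (2 + sqrt 2) 0"
    unfolding J 1 zc unfolding zB_BQ by (simp add: times_bquat_def field_simps)
  show 3: "(zB * (zB * alphaB)) * iota * qconj (zB * (zB * alphaB)) = BQ 0 (5/3 + sqrt 2) (2 + sqrt 2) (- 2/3 - 2 * sqrt 2/3)"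
    unfolding J[of "zB * alphaB"] 2 zc unfolding zB_BQ by (simp add: times_bquat_def field_simps)
  show "(zB * (zB * (zB * alphaB))) * iota * qconj (zB * (zB * (zB * alphaB))) = BQ 0 (1 + sqrt 2/3) 0 (- 2/3 - sqrt 2/3)"
    unfolding J[of "zB * (zB * alphaB)"] 3 zc unfolding zB_BQ by (simp add: times_bquat_def field_simps)
  show 5: "qconj alphaB * iota * qconj (qconj alphaB) = BQ 0 ((1 + sqrt 2)/3) (- sqrt 2/2) (- sqrt 2/6)"
    unfolding qconj_simps unfolding alphaB_BQ iota_BQ by (simp add: qconj_def times_bquat_def field_simps)
  show 6: "(zB * qconj alphaB) * iota * qconj (zB * qconj alphaB) = BQ 0 (1 + sqrt 2/3) (1 + sqrt 2/2) (1/3 + sqrt 2/6)"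
    unfolding J 5 zc unfolding zB_BQ by (simp add: times_bquat_def field_simps)
  show 7: "(zB * (zB * qconj alphaB)) * iota * qconj (zB * (zB * qconj alphaB)) = BQ 0 (5/3 + sqrt 2) (2 + 3 * sqrt 2/2) (- 2/3 - sqrt 2/6)"
    unfolding J[of "zB * qconj alphaB"] 6 zc unfolding zB_BQ by (simp add: times_bquat_def field_simps)
  show "(zB * (zB * (zB * qconj alphaB))) * iota * qconj (zB * (zB * (zB * qconj alphaB))) = BQ 0 (1 + sqrt 2) (1 + sqrt 2/2) (- 1 - sqrt 2/2)"
    unfolding J[of "zB * (zB * qconj alphaB)"] 7 zc unfolding zB_BQ by (simp add: times_bquat_def field_simps)
qed

text \<open>In the coordinates \<open>A\<close>, \<open>B\<close> orthogonal to the centre, the eight half planes are a regular octagon that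
  scales with \<open>c\<close>, of inradius \<open>s c\<close> and squared circumradius \<open>(8 - 4 s) c\<^sup>2\<close>, where \<open>8 - 4 s < 12/5\<close>. The
  equation places the point on the hyperboloid, at hyperbolic cosine \<open>c\<close> from the centre.\<close>

lemma octagon_bound:
  fixes A B c s :: real
  assumes s: "s * s = 2" "141/100 < s" "s < 71/50" and "c \<ge> 1"
    and "\<bar>A\<bar> \<le> s * c" "\<bar>B\<bar> \<le> s * c" "\<bar>A\<bar> + \<bar>B\<bar> \<le> 2 * c"
    and n: "(2 + 2 * s) * (c * c - 1) = A * A + B * B"
  shows "c < 3/2"
proof -
  \<comment> \<open>The larger coordinate is called \<open>a\<close>; the extreme point is the vertex \<open>(s c, (2 - s) c)\<close> of the octagon.\<close>
  have key: "a * a + b * b \<le> 12/5 * (c * c)" if ab: "0 \<le> b" "b \<le> a" "a \<le> s * c" "a + b \<le> 2 * c" for a b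
  proof -
    have "b \<le> 2 * c - a" "0 \<le> 2 * c - a" using ab by linarith+
    then have b2: "b * b \<le> (2 * c - a) * (2 * c - a)" using ab(1) by (intro mult_mono)
    show ?thesis
    proof (cases "a \<le> c")
      case True
      have "a * a \<le> c * c" "b * b \<le> c * c" using True ab by (intro mult_mono; linarith)+
      then show ?thesis using zero_le_square[of c] by linarith
    next
      case False
      have "0 \<le> (a - c) * (71/50 * c - a)"
        using False ab(3) s(3) assms(4) mult_right_mono[of s "71/50" c] by (intro mult_nonneg_nonneg) linarith+
      then have q: "a * a \<le> 121/50 * (a * c) - 71/50 * (c * c)" by (simp add: field_simps)
      have "a * c \<le> (71/50 * c) * c"
        using ab(3) s(3) assms(4) mult_right_mono[of s "71/50" c] by (intro mult_right_mono) linarith+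
      then have q2: "a * c \<le> 71/50 * (c * c)" by simp
      have "a * a + b * b \<le> 2 * (a * a) - 4 * (a * c) + 4 * (c * c)" using b2 by (simp add: algebra_simps)
      then show ?thesis using q q2 zero_le_square[of c] by linarith
    qed
  qed
  have "A * A + B * B \<le> 12/5 * (c * c)"
  proof (cases "\<bar>B\<bar> \<le> \<bar>A\<bar>")
    case True then show ?thesis using key[of "\<bar>B\<bar>" "\<bar>A\<bar>"] assms by simp
  next
    case False then show ?thesis using key[of "\<bar>A\<bar>" "\<bar>B\<bar>"] assms by (simp add: add.commute)
  qed
  moreover have "241/50 * (c * c - 1) \<le> (2 + 2 * s) * (c * c - 1)"
    using s assms(4) mult_mono[of 1 c 1 c] by (intro mult_right_mono) simp_all
  ultimately have "241/50 * (c * c - 1) \<le> 12/5 * (c * c)" unfolding n by linarith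
  moreover have "D \<le> 2" if "241/50 * (D - 1) \<le> 12/5 * D" for D :: real using that by simp
  ultimately have "c * c \<le> 2" by blast
  show ?thesis
  proof (rule ccontr)
    assume "\<not> c < 3/2"
    then have "(3/2) * (3/2) \<le> c * c" by (intro mult_mono) linarith+
    then show False using \<open>c * c \<le> 2\<close> by linarith
  qed
qed

text \<open>A point that is at least as close to the centre as to its eight neighbours lies in the octagon that
  their bisectors cut out.\<close>

lemma locally_closest:
  assumes h: "h \<in> QB1" and min: "\<And>u. u \<in> G0 \<Longrightarrow> cosh_dist h \<le> cosh_dist (qconj u * h)"
  shows "cosh_dist h < 3/2"
proof -
  define x where "x = h * iota * qconj h"
  \<comment> \<open>With \<open>c\<close> the form is diagonal: \<open>(2 + 2 sqrt 2) (c\<^sup>2 - lorentz x x) = A\<^sup>2 + B\<^sup>2\<close>.\<close>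
  define A where "A = - (2 + sqrt 2) * q1 x + (sqrt 2 + 1) * q2 x - (sqrt 2 + 3) * q3 x"
  define B where "B = sqrt 2 * q1 x - (sqrt 2 + 1) * q2 x - (sqrt 2 + 1) * q3 x"
  define c where "c = (1 + sqrt 2) * q1 x - q2 x + q3 x"
  have V: "lorentz (BQ a u v w) x = 3 * u * q1 x - sqrt 2 * v * q2 x - 3 * sqrt 2 * w * q3 x" for a u v w
    by (simp add: lorentz_def)
  have c: "cosh_dist h = c"
    using cosh_dist_lorentz[of 1 h] unfolding x_def[symmetric] by (simp add: iota_BQ V c_def field_simps)
  have G: "alphaB \<in> G0" "zB * alphaB \<in> G0" "zB * (zB * alphaB) \<in> G0" "zB * (zB * (zB * alphaB)) \<in> G0"
    "qconj alphaB \<in> G0" "zB * qconj alphaB \<in> G0" "zB * (zB * qconj alphaB) \<in> G0" "zB * (zB * (zB * qconj alphaB)) \<in> G0"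
    by (intro G0_mult G0_gens G0_qconj)+
  note m = min[OF G(1)] min[OF G(2)] min[OF G(3)] min[OF G(4)] min[OF G(5)] min[OF G(6)] min[OF G(7)] min[OF G(8)]
  note m2 = m[unfolded cosh_dist_lorentz eight_neighbours, folded x_def, unfolded V c]
  have s1: "0 \<le> sqrt 2 * c + A" using m2(1) unfolding A_def c_def by (simp add: field_simps)
  have s2: "0 \<le> sqrt 2 * c + B" using m2(2) unfolding B_def c_def by (simp add: field_simps)
  have s3: "0 \<le> sqrt 2 * c - A" using m2(3) unfolding A_def c_def by (simp add: field_simps)
  have s4: "0 \<le> sqrt 2 * c - B" using m2(4) unfolding B_def c_def by (simp add: field_simps)
  have pos: "0 \<le> y" if "0 \<le> sqrt 2 * y" for y :: real using that by (simp add: zero_le_mult_iff)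
  have s5: "0 \<le> 2 * c + (A - B)"
    by (rule pos) (use m2(5) in \<open>unfold A_def B_def c_def, simp add: field_simps\<close>)
  have s6: "0 \<le> 2 * c + (A + B)"
    by (rule pos) (use m2(6) in \<open>unfold A_def B_def c_def, simp add: field_simps\<close>)
  have s7: "0 \<le> 2 * c - (A - B)"
    by (rule pos) (use m2(7) in \<open>unfold A_def B_def c_def, simp add: field_simps\<close>)
  have s8: "0 \<le> 2 * c - (A + B)"
    by (rule pos) (use m2(8) in \<open>unfold A_def B_def c_def, simp add: field_simps\<close>)
  have "lorentz x x = 1"
    using cosh_dist_lorentz[of h h] h unfolding x_def by (simp add: cosh_dist_def iota_sq trd_simps)
  then have "(2 + 2 * sqrt 2) * (c * c - lorentz x x) = A * A + B * B"
    unfolding A_def B_def c_def lorentz_def by (simp add: field_simps)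
  then have n: "(2 + 2 * sqrt 2) * (c * c - 1) = A * A + B * B" using \<open>lorentz x x = 1\<close> by simp
  have sq: "141/100 < sqrt 2" "sqrt 2 < 71/50" by (rule real_less_rsqrt, simp add: power2_eq_square) (rule real_less_lsqrt, simp_all add: power2_eq_square)
  have "c < 3/2"
  proof (rule octagon_bound[of "sqrt 2" c A B])
    show "1 \<le> c" using cosh_dist_ge(1)[OF h] c by simp
    show "\<bar>A\<bar> \<le> sqrt 2 * c" "\<bar>B\<bar> \<le> sqrt 2 * c" using s1 s2 s3 s4 by linarith+
    show "\<bar>A\<bar> + \<bar>B\<bar> \<le> 2 * c" using s5 s6 s7 s8 by linarith
  qed (use sq n in simp_all)
  then show ?thesis using c by simp
qed

text \<open>The ring of integers is discrete in the product of its two real embeddings.\<close>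

lemma finite_bounded_Zs: "finite {m \<in> Zs. \<bar>m\<bar> \<le> K \<and> \<bar>conj2 m\<bar> \<le> K}"
proof (rule finite_subset)
  let ?f = "\<lambda>(a::int, b::int). real_of_int a + real_of_int b * sqrt 2"
  let ?S = "{-\<lceil>K\<rceil>..\<lceil>K\<rceil>} \<times> {-\<lceil>K\<rceil>..\<lceil>K\<rceil>}"
  show "finite (?f ` ?S)" by simp
  show "{m \<in> Zs. \<bar>m\<bar> \<le> K \<and> \<bar>conj2 m\<bar> \<le> K} \<subseteq> ?f ` ?S"
  proof
    fix m assume "m \<in> {m \<in> Zs. \<bar>m\<bar> \<le> K \<and> \<bar>conj2 m\<bar> \<le> K}"
    then have m: "m \<in> Zs" "\<bar>m\<bar> \<le> K" "\<bar>conj2 m\<bar> \<le> K" by simp_all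
    obtain a b where ab: "m = real_of_int a + real_of_int b * sqrt 2" using m(1) by (rule Zs_E)
    have cm: "conj2 m = real_of_int a - real_of_int b * sqrt 2" unfolding ab conj2_eq ..
    have "\<bar>real_of_int a\<bar> \<le> K" using m ab cm by linarith
    have "\<bar>real_of_int b\<bar> * 1 \<le> \<bar>real_of_int b\<bar> * sqrt 2" by (intro mult_left_mono) simp_all
    also have "\<dots> = \<bar>real_of_int b * sqrt 2\<bar>" by (simp add: abs_mult)
    also have "\<dots> \<le> K" using m ab cm by linarith
    finally have "\<bar>real_of_int b\<bar> \<le> K" by simp
    with \<open>\<bar>real_of_int a\<bar> \<le> K\<close> have "(a, b) \<in> ?S" by (simp add: abs_le_iff) linarith
    moreover have "m = ?f (a, b)" using ab by simp
    ultimately show "m \<in> ?f ` ?S" by blast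
  qed
qed

text \<open>Choose the translate of the base point under the group generated by \<open>alphaB\<close> and \<open>zB\<close> that is
  nearest to the given one. The value \<open>cosh_dist - 1\<close> lies in \<open>[0, 1/2)\<close>, belongs to the ring of
  integers and has conjugate at most 2, so it vanishes.\<close>

lemma G0_reduction: assumes g: "g \<in> QB1"
  shows "\<exists>w\<in>G0. (qconj w * g) * iota = iota * (qconj w * g)"
proof -
  define m where "m x = cosh_dist x - 1" for x
  have mZ: "m x \<in> Zs" "\<bar>conj2 (m x)\<bar> \<le> 2" "m x \<ge> 0" if x: "x \<in> QB1" for x
  proof -
    have y: "zB * x * zB * qconj x \<in> QB1" by (intro QB1_mult QB1_qconj gens_QB1 x)
    have e: "m x = - trd (zB * x * zB * qconj x)" unfolding m_def cosh_dist_eq[OF x] by simp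
    show "m x \<in> Zs" unfolding e by (intro Zs_uminus QB_trd QB1_D(1) y)
    show "\<bar>conj2 (m x)\<bar> \<le> 2" unfolding e using QB1_conj2_trd[OF y] conj2_uminus[OF QB_trd[OF QB1_D(1)[OF y]]] by simp
    show "m x \<ge> 0" using cosh_dist_ge(1)[OF x] by (simp add: m_def)
  qed
  have hQ: "qconj w * g \<in> QB1" if "w \<in> G0" for w using that G0_QB1 QB1_mult QB1_qconj g by blast
  \<comment> \<open>Only finitely many values of \<open>m\<close> are at most \<open>K\<close>; the 2 makes \<open>K\<close> bound the conjugates too.\<close>
  define K where "K = max 2 (m g)"
  define V where "V = (\<lambda>w. m (qconj w * g)) ` G0 \<inter> {..K}"
  have "V \<subseteq> {m \<in> Zs. \<bar>m\<bar> \<le> K \<and> \<bar>conj2 m\<bar> \<le> K}"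
  proof
    fix v assume "v \<in> V"
    then obtain w where w: "w \<in> G0" "v = m (qconj w * g)" "v \<le> K" unfolding V_def by blast
    show "v \<in> {m \<in> Zs. \<bar>m\<bar> \<le> K \<and> \<bar>conj2 m\<bar> \<le> K}" using mZ[OF hQ[OF w(1)]] w(2,3) by (simp add: K_def)
  qed
  then have fV: "finite V" using finite_bounded_Zs finite_subset by blast
  have "m g \<in> V" unfolding V_def using G0.one by (auto simp: K_def intro!: image_eqI[of _ _ 1])
  then have "Min V \<in> V" using fV by (intro Min_in) auto
  then obtain w where w: "w \<in> G0" "Min V = m (qconj w * g)" "Min V \<le> K" unfolding V_def by blast
  define h where "h = qconj w * g"
  have hQ1: "h \<in> QB1" unfolding h_def by (rule hQ[OF w(1)])
  have "cosh_dist h < 3/2"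
  proof (rule locally_closest[OF hQ1])
    fix u assume u: "u \<in> G0"
    have wu: "w * u \<in> G0" by (rule G0_mult[OF w(1) u])
    have e: "qconj u * h = qconj (w * u) * g" by (simp add: h_def qconj_mult mult.assoc)
    have "Min V \<le> m (qconj (w * u) * g)"
    proof (cases "m (qconj (w * u) * g) \<le> K")
      case True
      then have "m (qconj (w * u) * g) \<in> V" unfolding V_def using wu by blast
      then show ?thesis using fV by (intro Min_le)
    next
      case False then show ?thesis using w(3) by simp
    qed
    then show "cosh_dist h \<le> cosh_dist (qconj u * h)" unfolding e using w(2) by (simp add: m_def h_def)
  qed
  then have small: "m h < 1/2" by (simp add: m_def)
  have "m h = 0"
  proof (rule ccontr)
    assume "m h \<noteq> 0"
    then have "1 \<le> \<bar>m h\<bar> * \<bar>conj2 (m h)\<bar>" using anorm_ge_1 mZ(1)[OF hQ1] by (simp add: anorm_def abs_mult)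
    also have "\<dots> \<le> \<bar>m h\<bar> * 2" using mZ(2)[OF hQ1] by (intro mult_left_mono) simp_all
    finally show False using small mZ(3)[OF hQ1] by simp
  qed
  then have "cosh_dist h = 1" by (simp add: m_def)
  then have "h * iota = iota * h" by (rule cosh_dist_ge(2)[OF hQ1])
  then show ?thesis using w(1) unfolding h_def by blast
qed

text \<open>These are the possible traces of norm one elements of finite order, which satisfy the bound at both
  real places.\<close>

lemma small_Zs: assumes "t \<in> Zs" "\<bar>t\<bar> \<le> 2" "\<bar>conj2 t\<bar> \<le> 2"
  shows "t \<in> {0, 1, -1, 2, -2, sqrt 2, - sqrt 2}"
proof -
  obtain a b where ab: "t = real_of_int a + real_of_int b * sqrt 2" using assms(1) by (rule Zs_E)
  have ct: "conj2 t = real_of_int a - real_of_int b * sqrt 2" unfolding ab conj2_eq ..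
  have s: "141/100 < sqrt 2" by (rule real_less_rsqrt) (simp add: power2_eq_square)
  have sum: "\<bar>real_of_int a\<bar> + \<bar>real_of_int b\<bar> * sqrt 2 \<le> 2"
  proof -
    have "\<bar>real_of_int b\<bar> * sqrt 2 = \<bar>real_of_int b * sqrt 2\<bar>" by (simp add: abs_mult)
    then show ?thesis using assms(2)[unfolded ab] assms(3)[unfolded ct] by linarith
  qed
  have "\<bar>real_of_int b\<bar> * (141/100) \<le> \<bar>real_of_int b\<bar> * sqrt 2" using s by (intro mult_left_mono) simp_all
  then have b: "\<bar>real_of_int a\<bar> + \<bar>real_of_int b\<bar> * 141/100 \<le> 2" using sum by linarith
  have "real_of_int \<bar>b\<bar> < real_of_int 2" using b unfolding of_int_abs of_int_numeral by linarith
  then have "\<bar>b\<bar> < 2" by (simp only: of_int_less_iff)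
  then consider "b = 0" | "b = 1" | "b = -1" by linarith
  then show ?thesis
  proof cases
    case 1
    then have "real_of_int \<bar>a\<bar> \<le> real_of_int 2" using b unfolding of_int_abs of_int_numeral by simp
    then have "\<bar>a\<bar> \<le> 2" by (simp only: of_int_le_iff)
    then have "a = 0 \<or> a = 1 \<or> a = -1 \<or> a = 2 \<or> a = -2" by linarith
    then show ?thesis using 1 ab by auto
  next
    case 2
    then have "a = 0" using b by simp
    then show ?thesis using 2 ab by simp
  next
    case 3
    then have "a = 0" using b by simp
    then show ?thesis using 3 ab by simp
  qed
qed

text \<open>Such an element is \<open>x + y iota\<close> with \<open>x\<^sup>2 + y\<^sup>2 = 1\<close>, a rotation. Its trace and that of its product with
  \<open>zB\<close> are bounded at both places, which leaves the eighth roots of unity.\<close>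

lemma iota_centralizer: assumes "h \<in> QB1" "h * iota = iota * h"
  shows "\<exists>k\<in>{1, zB, zB * zB, zB * (zB * zB)}. h = k \<or> h = - k"
proof -
  define x where "x = q0 h"
  define y where "y = q1 h * (3 * (sqrt 2 - 1))"
  have q: "q2 h * ((1 + sqrt 2)/3) = q1 h * (sqrt 2/2)" "q3 h * ((1 + sqrt 2)/3) = q1 h * (- sqrt 2/6)"
    using assms(2) unfolding iota_BQ times_bquat_def bquat_eq_iff by (simp_all add: field_simps)
  have "(3 * (sqrt 2 - 1)) * (q2 h * ((1 + sqrt 2)/3)) = (3 * (sqrt 2 - 1)) * (q1 h * (sqrt 2/2))"
    "(3 * (sqrt 2 - 1)) * (q3 h * ((1 + sqrt 2)/3)) = (3 * (sqrt 2 - 1)) * (q1 h * (- sqrt 2/6))"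
    unfolding q by simp_all
  then have hh: "h = x *\<^sub>R 1 + y *\<^sub>R iota"
    unfolding iota_BQ by (simp add: bquat_eq_iff bquat_defs x_def y_def field_simps)
  have "nrd h = x\<^sup>2 + y\<^sup>2" unfolding hh nrd_add by (simp add: trd_simps)
  then have n: "x * x + y * y = 1" using assms(1) by (simp add: QB1_D power2_eq_square)
  have t1: "trd h = 2 * x" by (simp add: trd_def x_def)
  have t2: "trd (h * zB) = - sqrt 2 * (x + y)"
    unfolding hh zB_iota by (simp add: trd_simps algebra_simps iota_sq)
  have bd: "\<bar>u\<bar> \<le> 1" if "u * u + v * v = 1" for u v :: real
  proof -
    have "u * u \<le> 1" using that zero_le_square[of v] by linarith
    then show ?thesis using abs_le_square_iff[of u 1] by (simp add: power2_eq_square)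
  qed
  have hz: "h * zB \<in> QB1" by (intro QB1_mult gens_QB1 assms)
  have T1: "2 * x \<in> {0, 1, -1, 2, -2, sqrt 2, - sqrt 2}"
    by (rule small_Zs) (use QB_trd[OF QB1_D(1)[OF assms(1)]] QB1_conj2_trd[OF assms(1)] bd[OF n] in \<open>simp_all add: t1\<close>)
  have sq2: "(x + y) * (x + y) + (x - y) * (x - y) = 2" using n by (simp add: algebra_simps)
  have "(x + y) * (x + y) \<le> 2" using sq2 zero_le_square[of "x - y"] by linarith
  then have "(- sqrt 2 * (x + y)) * (- sqrt 2 * (x + y)) \<le> 4" by (simp add: algebra_simps)
  then have "(- sqrt 2 * (x + y))\<^sup>2 \<le> 2\<^sup>2" by (simp add: power2_eq_square)
  then have "\<bar>- sqrt 2 * (x + y)\<bar> \<le> 2" using abs_le_square_iff[of "- sqrt 2 * (x + y)" 2] by simp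
  then have T2: "- sqrt 2 * (x + y) \<in> {0, 1, -1, 2, -2, sqrt 2, - sqrt 2}"
    by (intro small_Zs) (use QB_trd[OF QB1_D(1)[OF hz]] QB1_conj2_trd[OF hz] in \<open>simp_all add: t2\<close>)
  \<comment> \<open>For \<open>x = \<plusminus>1/2\<close> the square of the second trace would be \<open>2 \<plusminus> sqrt 3\<close>.\<close>
  have no: "2 * x \<noteq> 1 \<and> 2 * x \<noteq> -1"
  proof (rule ccontr)
    assume "\<not> (2 * x \<noteq> 1 \<and> 2 * x \<noteq> -1)"
    then have "(2 * x) * (2 * x) = 1" by (elim disjE[OF iffD1[OF de_Morgan_conj]]) auto
    then have x4: "4 * (x * x) = 1" by (simp only: mult_ac)
    then have y4: "4 * (y * y) = 3" using n by simp
    define P where "P = 2 * (x * y)"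
    have "4 * (P * P) = (4 * (x * x)) * (4 * (y * y))" by (simp add: P_def)
    then have PP: "4 * (P * P) = 3" using x4 y4 by simp
    have "(- sqrt 2 * (x + y)) * (- sqrt 2 * (x + y)) = 2 * (x * x + y * y + P)" by (simp add: P_def algebra_simps)
    also have "\<dots> = 2 + 2 * P" using n by simp
    finally have "(- sqrt 2 * (x + y)) * (- sqrt 2 * (x + y)) = 2 + 2 * P" .
    moreover have "u * u \<in> {0, 1, 4, 2}" if "u \<in> {0, 1, -1, 2, -2, sqrt 2, - sqrt 2}" for u :: real using that by auto
    ultimately have "2 + 2 * P \<in> {0, 1, 4, 2}" using T2 by metis
    then have "P = -1 \<or> P = -1/2 \<or> P = 1 \<or> P = 0" by auto
    then show False using PP by auto
  qed
  have z: "zB = (- sqrt 2/2) *\<^sub>R 1 + (sqrt 2/2) *\<^sub>R iota" unfolding zB_iota by (simp add: algebra_simps)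
  have z3: "zB * (zB * zB) = (sqrt 2/2) *\<^sub>R 1 + (sqrt 2/2) *\<^sub>R iota"
    unfolding zB_power(1) unfolding zB_iota by (simp add: algebra_simps iota_sq)
  from T1 no consider "x = 0" | "x = 1" | "x = -1" | "x = sqrt 2/2" | "x = - sqrt 2/2" by auto
  then show ?thesis
  proof cases
    case 1
    then have "y = 1 \<or> y = -1" using n by (simp add: square_eq_1_iff)
    then show ?thesis unfolding zB_power(1) using hh 1 by auto
  next
    case 2 then have "y = 0" using n by simp
    then show ?thesis using hh 2 by simp
  next
    case 3 then have "y = 0" using n by simp
    then show ?thesis using hh 3 by simp
  next
    case 4
    have "x * x = (sqrt 2/2) * (sqrt 2/2)" by (simp only: 4)
    also have "\<dots> = 1/2" by simp
    finally have "x * x = 1/2" .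
    then have "(y - sqrt 2/2) * (y + sqrt 2/2) = 0" using n by (simp add: algebra_simps)
    then consider "y = sqrt 2/2" | "y = - sqrt 2/2" by auto
    then show ?thesis
    proof cases
      case 1 then have "h = zB * (zB * zB)" unfolding z3 using hh 4 by simp
      then show ?thesis by simp
    next
      case 2 then have "h = - zB" unfolding z using hh 4 by simp
      then show ?thesis by simp
    qed
  next
    case 5
    have "x * x = (- sqrt 2/2) * (- sqrt 2/2)" by (simp only: 5)
    also have "\<dots> = 1/2" by simp
    finally have "x * x = 1/2" .
    then have "(y - sqrt 2/2) * (y + sqrt 2/2) = 0" using n by (simp add: algebra_simps)
    then consider "y = sqrt 2/2" | "y = - sqrt 2/2" by auto
    then show ?thesis
    proof cases
      case 1 then have "h = zB" unfolding z using hh 5 by simp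
      then show ?thesis by simp
    next
      case 2 then have "h = - (zB * (zB * zB))" unfolding z3 using hh 5 by simp
      then show ?thesis by simp
    qed
  qed
qed

section \<open>The action on the hyperbolic plane\<close>

abbreviation act :: "bquat \<Rightarrow> complex \<Rightarrow> complex" where "act x \<equiv> mact (matB x)"

text \<open>Moebius maps with real coefficients, and the four matrix entries of a quaternion.\<close>

definition rmob :: "real \<Rightarrow> real \<Rightarrow> real \<Rightarrow> real \<Rightarrow> complex \<Rightarrow> complex" where
  "rmob a b c d z = (of_real a * z + of_real b) / (of_real c * z + of_real d)"

definition eA :: "bquat \<Rightarrow> real" where "eA x = q0 x + sqrt (sqrt 2) * q2 x"
definition eB :: "bquat \<Rightarrow> real" where "eB x = - 3 * q1 x + 3 * sqrt (sqrt 2) * q3 x"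
definition eC :: "bquat \<Rightarrow> real" where "eC x = q1 x + sqrt (sqrt 2) * q3 x"
definition eD :: "bquat \<Rightarrow> real" where "eD x = q0 x - sqrt (sqrt 2) * q2 x"
lemmas e_defs = eA_def eB_def eC_def eD_def

lemma s4 [simp]: "sqrt (sqrt 2) * (sqrt (sqrt 2) * x) = sqrt 2 * x"
  by (simp flip: mult.assoc)

lemma act_eq: "act x z = rmob (eA x) (eB x) (eC x) (eD x) z"
  by (simp add: mact_def moebius_def matB_def Let_def rmob_def e_defs vector_2)

lemma det_e: "eA x * eD x - eB x * eC x = nrd x"
  by (simp add: e_defs nrd_def power2_eq_square algebra_simps)

lemma trace_e: "eA x + eD x = trd x" by (simp add: e_defs trd_def)

lemma e_mult: "eA (x * y) = eA x * eA y + eB x * eC y" "eB (x * y) = eA x * eB y + eB x * eD y"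
  "eC (x * y) = eC x * eA y + eD x * eC y" "eD (x * y) = eC x * eB y + eD x * eD y"
  by (simp_all add: e_defs times_bquat_def algebra_simps)

lemma hyp_plane_iff: "z \<in> hyp_plane \<longleftrightarrow> Im z > 0" by (simp add: hyp_plane_def)

lemma rmob_den: assumes "a * d - b * c = 1" "Im z > 0" shows "of_real c * z + of_real d \<noteq> 0"
proof
  assume e: "of_real c * z + of_real d = (0 :: complex)"
  then have "Im (of_real c * z + of_real d) = 0" "Re (of_real c * z + of_real d) = 0" by simp_all
  then have "c = 0" using assms(2) by simp
  moreover have "d = 0" using \<open>Re (of_real c * z + of_real d) = 0\<close> \<open>c = 0\<close> by simp
  ultimately show False using assms(1) by simp
qed

lemma rmob_Im: assumes "a * d - b * c = 1" "Im z > 0"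
  shows "Im (rmob a b c d z) = Im z / (cmod (of_real c * z + of_real d))\<^sup>2"
proof -
  have "(a * Im z) * (c * Re z + d) - (a * Re z + b) * (c * Im z) = (a * d - b * c) * Im z" by (simp add: algebra_simps)
  then show ?thesis using assms(1) by (simp add: rmob_def Im_divide cmod_power2)
qed

lemma rmob_pos: assumes "a * d - b * c = 1" "Im z > 0" shows "Im (rmob a b c d z) > 0"
  unfolding rmob_Im[OF assms] using assms(2) rmob_den[OF assms] by simp

text \<open>The quadratic \<open>c z\<^sup>2 + (d - a) z - b\<close> measures the displacement; its minimum over the
  half plane is governed by its discriminant \<open>(a + d)\<^sup>2 - 4\<close>.\<close>

lemma rmob_displacement: assumes "a * d - b * c = 1" "Im z > 0"
  shows "((a + d)\<^sup>2 - 4) * (Im z * Im (rmob a b c d z)) \<le> (cmod (z - rmob a b c d z))\<^sup>2"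
proof -
  let ?D = "of_real c * z + of_real d :: complex"
  have D: "?D \<noteq> 0" using rmob_den[OF assms] .
  let ?n = "(cmod ?D)\<^sup>2"
  have n0: "?n > 0" using D by simp
  define x where "x = Re z"
  define y where "y = Im z"
  have y0: "y > 0" using assms(2) by (simp add: y_def)
  define P where "P = of_real c * z * z + (of_real d - of_real a) * z - of_real b"
  have "z - rmob a b c d z = P / ?D" using D by (simp add: rmob_def P_def field_simps)
  then have 1: "(cmod (z - rmob a b c d z))\<^sup>2 = (cmod P)\<^sup>2 / ?n" by (simp add: norm_divide power_divide)
  define q where "q = c * x\<^sup>2 + (d - a) * x - b"
  have "Re P = q - c * y\<^sup>2" "Im P = (2 * c * x + d - a) * y"
    by (simp_all add: P_def q_def x_def y_def power2_eq_square algebra_simps)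
  then have "(cmod P)\<^sup>2 = (q - c * y\<^sup>2)\<^sup>2 + ((2 * c * x + d - a) * y)\<^sup>2" by (simp add: cmod_power2)
  also have "\<dots> = (q + c * y\<^sup>2)\<^sup>2 + ((2 * c * x + d - a)\<^sup>2 - 4 * c * q) * y\<^sup>2" by (simp add: power2_eq_square algebra_simps)
  also have "(2 * c * x + d - a)\<^sup>2 - 4 * c * q = (a + d)\<^sup>2 - 4 * (a * d - b * c)"
    by (simp add: q_def power2_eq_square algebra_simps)
  finally have 2: "((a + d)\<^sup>2 - 4) * y\<^sup>2 \<le> (cmod P)\<^sup>2" using assms(1) by simp
  have "((a + d)\<^sup>2 - 4) * (Im z * Im (rmob a b c d z)) = ((a + d)\<^sup>2 - 4) * y\<^sup>2 / ?n"
    unfolding rmob_Im[OF assms] by (simp add: y_def power2_eq_square)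
  also have "\<dots> \<le> (cmod P)\<^sup>2 / ?n" using 2 n0 by (simp add: divide_right_mono)
  finally show ?thesis unfolding 1 .
qed

lemma act_H: "nrd x = 1 \<Longrightarrow> z \<in> hyp_plane \<Longrightarrow> act x z \<in> hyp_plane"
  unfolding act_eq hyp_plane_iff using det_e[of x] by (intro rmob_pos) simp_all

lemma act_den: "nrd x = 1 \<Longrightarrow> z \<in> hyp_plane \<Longrightarrow> of_real (eC x) * z + of_real (eD x) \<noteq> 0"
  unfolding hyp_plane_iff using det_e[of x] rmob_den by metis

lemma act_mult: assumes "nrd x = 1" "nrd y = 1" "z \<in> hyp_plane"
  shows "act (x * y) z = act x (act y z)"
proof -
  let ?D = "of_real (eC y) * z + of_real (eD y) :: complex" and ?w = "act y z"
  let ?N = "of_real (eA y) * z + of_real (eB y) :: complex"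
  have D: "?D \<noteq> 0" using act_den[OF assms(2,3)] .
  have w: "?w = ?N / ?D" by (simp add: act_eq rmob_def)
  have "of_real (eC x) * ?w + of_real (eD x) \<noteq> 0" using act_den[OF assms(1) act_H[OF assms(2,3)]] .
  have 1: "of_real (eA (x * y)) * z + of_real (eB (x * y)) = ?D * (of_real (eA x) * ?w + of_real (eB x))"
    unfolding w e_mult using D by (simp add: field_simps)
  have 2: "of_real (eC (x * y)) * z + of_real (eD (x * y)) = ?D * (of_real (eC x) * ?w + of_real (eD x))"
    unfolding w e_mult using D by (simp add: field_simps)
  show ?thesis unfolding act_eq[of "x * y"] act_eq[of x] rmob_def 1 2 using D by simp
qed

lemma act_one [simp]: "act 1 z = z"
  by (simp add: act_eq rmob_def e_defs one_bquat_def)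

lemma act_uminus [simp]: "act (- x) z = act x z"
proof -
  have "of_real (eA (- x)) * z + of_real (eB (- x)) = - (of_real (eA x) * z + of_real (eB x))"
    "of_real (eC (- x)) * z + of_real (eD (- x)) = - (of_real (eC x) * z + of_real (eD x))"
    by (simp_all add: e_defs uminus_bquat_def algebra_simps)
  then show ?thesis unfolding act_eq rmob_def by (simp only: minus_divide_left[symmetric] minus_divide_right[symmetric] minus_minus)
qed

lemma act_qconj: "x \<in> QB1 \<Longrightarrow> z \<in> hyp_plane \<Longrightarrow> act (qconj x) (act x z) = z"
  "x \<in> QB1 \<Longrightarrow> z \<in> hyp_plane \<Longrightarrow> act x (act (qconj x) z) = z"
  using act_mult[of "qconj x" x z] act_mult[of x "qconj x" z] by (simp_all add: QB1_D)

lemma act_QB1_H: "x \<in> QB1 \<Longrightarrow> z \<in> hyp_plane \<Longrightarrow> act x z \<in> hyp_plane"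
  using act_H QB1_D by blast

lemma act_QB1_mult: "x \<in> QB1 \<Longrightarrow> y \<in> QB1 \<Longrightarrow> z \<in> hyp_plane \<Longrightarrow> act (x * y) z = act x (act y z)"
  using act_mult QB1_D by blast

lemma continuous_act: assumes "nrd x = 1" shows "continuous_on hyp_plane (act x)"
proof -
  have "continuous_on hyp_plane (\<lambda>z. (of_real (eA x) * z + of_real (eB x)) / (of_real (eC x) * z + of_real (eD x)))"
    by (intro continuous_intros ballI act_den[OF assms])
  then show ?thesis unfolding act_eq rmob_def .
qed

lemma act_displacement: assumes "nrd x = 1" "z \<in> hyp_plane"
  shows "((trd x)\<^sup>2 - 4) * (Im z * Im (act x z)) \<le> (cmod (z - act x z))\<^sup>2"
  unfolding act_eq trace_e[symmetric] using det_e[of x] assms by (intro rmob_displacement) (simp_all add: hyp_plane_iff)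

text \<open>The fixed point of \<open>iota\<close>, the root of \<open>c z\<^sup>2 - 2 a z - b\<close> in the upper half plane.\<close>

definition z0 :: complex where "z0 = Complex (eA iota / eC iota) (1 / eC iota)"

lemma eC_iota: "eC iota > 0"
proof -
  have "sqrt (sqrt 2) < 2" by (rule real_less_lsqrt, simp, rule real_less_lsqrt) simp_all
  then have "sqrt 2 * sqrt (sqrt 2) < sqrt 2 * 2" by (intro mult_strict_left_mono) simp_all
  then have "3 * (sqrt 2 * sqrt (sqrt 2)) < 6 + sqrt 2 * 6" by linarith
  then show ?thesis by (simp add: eC_def iota_BQ field_simps)
qed

lemma z0_H: "z0 \<in> hyp_plane" using eC_iota by (simp add: z0_def hyp_plane_iff)

lemma iota_fixed: assumes "z \<in> hyp_plane" shows "act iota z = z \<longleftrightarrow> z = z0"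
proof -
  let ?a = "eA iota" and ?b = "eB iota" and ?c = "eC iota"
  have d: "eD iota = - ?a" using trace_e[of iota] by simp
  have det: "?a * ?a + ?b * ?c = - 1" using det_e[of iota] d by simp
  have D: "of_real ?c * z - of_real ?a \<noteq> 0" using act_den[OF _ assms, of iota] d by simp
  have "act iota z = z \<longleftrightarrow> of_real ?a * z + of_real ?b = z * (of_real ?c * z - of_real ?a)"
    unfolding act_eq rmob_def d using D by (simp add: field_simps)
  also have "\<dots> \<longleftrightarrow> of_real ?c * (of_real ?a * z + of_real ?b) = of_real ?c * (z * (of_real ?c * z - of_real ?a))"
    using eC_iota by simp
  also have "\<dots> \<longleftrightarrow> (of_real ?c * z - of_real ?a)\<^sup>2 = of_real (?a * ?a + ?b * ?c)"
    by (auto simp: power2_eq_square algebra_simps)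
  also have "\<dots> \<longleftrightarrow> (of_real ?c * z - of_real ?a)\<^sup>2 = \<i>\<^sup>2" unfolding det by simp
  also have "\<dots> \<longleftrightarrow> of_real ?c * z - of_real ?a = \<i> \<or> of_real ?c * z - of_real ?a = - \<i>" by (rule power2_eq_iff)
  also have "\<dots> \<longleftrightarrow> of_real ?c * z - of_real ?a = \<i>"
  proof -
    have "Im (of_real ?c * z - of_real ?a) > 0" using eC_iota assms by (simp add: hyp_plane_iff)
    moreover have "Im (- \<i>) = - 1" by simp
    ultimately have "of_real ?c * z - of_real ?a \<noteq> - \<i>" by (metis not_one_less_zero neg_0_less_iff_less)
    then show ?thesis by simp
  qed
  also have "\<dots> \<longleftrightarrow> z = z0"
    using eC_iota by (auto simp: z0_def complex_eq_iff field_simps)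
  finally show ?thesis .
qed

lemma act_commuting_fixes_z0: assumes "h \<in> QB1" "h * iota = iota * h" shows "act h z0 = z0"
proof -
  have h: "nrd h = 1" using assms QB1_D by blast
  have "act iota (act h z0) = act (h * iota) z0" using act_mult[OF _ h z0_H, of iota] assms(2) by simp
  also have "\<dots> = act h z0" using act_mult[OF h _ z0_H, of iota] iota_fixed[OF z0_H] by simp
  finally show ?thesis using iota_fixed[OF act_H[OF h z0_H]] by simp
qed

text \<open>Conjugating \<open>iota\<close> by \<open>h\<close> gives a trace zero element that fixes the same point, so it is \<open>iota\<close> or its
  negative.\<close>

lemma act_fixes_z0: assumes "h \<in> QB1" "act h z0 = z0" shows "h * iota = iota * h"
proof -
  have h: "nrd h = 1" using assms QB1_D by blast
  define k where "k = h * (iota * qconj h)"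
  have nk: "nrd k = 1" unfolding k_def using h by (simp add: nrd_mult)
  have tk: "trd k = 0"
    unfolding k_def using trd_commute[of h "iota * qconj h"] assms(1) by (simp add: mult.assoc)
  have hc: "act (qconj h) z0 = z0" using act_qconj(1)[OF assms(1) z0_H] assms(2) by simp
  have k0: "act k z0 = z0"
    unfolding k_def using act_mult[of h "iota * qconj h" z0] act_mult[of iota "qconj h" z0] h z0_H hc iota_fixed[OF z0_H] assms(2)
    by (simp add: nrd_mult)
  let ?a = "eA iota" and ?b = "eB iota" and ?c = "eC iota"
  let ?a' = "eA k" and ?b' = "eB k" and ?c' = "eC k"
  have d: "eD iota = - ?a" "eD k = - ?a'" using trace_e[of iota] trace_e[of k] tk by simp_all
  have q: "of_real (eA x) * z0 + of_real (eB x) = z0 * (of_real (eC x) * z0 + of_real (eD x))" if "nrd x = 1" "act x z0 = z0" for x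
    using that(2) act_den[OF that(1) z0_H] unfolding act_eq rmob_def by (simp add: field_simps)
  have e1: "of_real ?a * z0 + of_real ?b = z0 * (of_real ?c * z0 - of_real ?a)" using q[of iota] iota_fixed[OF z0_H] d by simp
  have e2: "of_real ?a' * z0 + of_real ?b' = z0 * (of_real ?c' * z0 - of_real ?a')" using q[of k] nk k0 d by simp
  define x where "x = Re z0"
  define y where "y = Im z0"
  have y: "y > 0" using z0_H by (simp add: y_def hyp_plane_iff)
  have i1: "2 * ?a * y = 2 * ?c * x * y" "2 * ?a * x + ?b = ?c * (x * x - y * y)"
    using arg_cong[OF e1, of Im] arg_cong[OF e1, of Re] by (simp_all add: x_def y_def algebra_simps)
  have i2: "2 * ?a' * y = 2 * ?c' * x * y" "2 * ?a' * x + ?b' = ?c' * (x * x - y * y)"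
    using arg_cong[OF e2, of Im] arg_cong[OF e2, of Re] by (simp_all add: x_def y_def algebra_simps)
  have a: "?a = ?c * x" "?a' = ?c' * x" using i1(1) i2(1) y by simp_all
  have b: "?b = - ?c * (x * x + y * y)" "?b' = - ?c' * (x * x + y * y)" using i1(2) i2(2) a by (simp_all add: algebra_simps)
  have det: "?a * ?a + ?b * ?c = - 1" "?a' * ?a' + ?b' * ?c' = - 1" using det_e[of iota] det_e[of k] d nk by simp_all
  have "?c * ?c * (y * y) = 1" "?c' * ?c' * (y * y) = 1" using det unfolding a b by (simp_all add: algebra_simps)
  then have "(?c' - ?c) * (?c' + ?c) * (y * y) = 0" by (simp add: algebra_simps)
  then have "?c' = ?c \<or> ?c' = - ?c" using y by auto
  then consider "k = iota" | "k = - iota"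
  proof
    assume c: "?c' = ?c"
    then have "?a' = ?a" "?b' = ?b" using a b by simp_all
    with c d have "matB k = matB iota" by (simp add: matB_def Let_def vec_eq_iff forall_2 vector_2 e_defs)
    then show ?thesis using that bij_matB by (metis bij_def injD)
  next
    assume c: "?c' = - ?c"
    then have "?a' = - ?a" "?b' = - ?b" using a b by simp_all
    with c d have "matB k = matB (- iota)"
      by (simp add: matB_def Let_def vec_eq_iff forall_2 vector_2 e_defs uminus_bquat_def)
    then show ?thesis using that bij_matB by (metis bij_def injD)
  qed
  then show ?thesis
  proof cases
    case 1
    then have "h * (iota * (qconj h * h)) = iota * h" unfolding k_def by (metis mult.assoc)
    then show ?thesis using assms(1) by simp
  next
    case 2
    \<comment> \<open>If \<open>h\<close> swapped \<open>iota\<close> and \<open>- iota\<close>, the hyperbolic cosine of its displacement would be \<open>- 1\<close>.\<close>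
    have "cosh_dist (qconj h) = trd (iota * (iota * 1)) / - 2 * - 1"
    proof -
      have "iota * qconj h * iota * qconj (qconj h) = iota * (qconj h * iota * h)" by (simp add: mult.assoc)
      also have "qconj h * iota * h = - iota"
      proof -
        have "k * h = - (iota * h)" using 2 by simp
        then have "h * iota = - (iota * h)" unfolding k_def using assms(1) by (simp add: mult.assoc)
        then have "qconj h * (h * iota) = - (qconj h * (iota * h))" by simp
        then have "iota = - (qconj h * (iota * h))" using assms(1) by simp
        then have "- iota = - (- (qconj h * (iota * h)))" by (rule arg_cong)
        then show ?thesis by (simp only: minus_minus mult.assoc)
      qed
      finally show ?thesis by (simp add: cosh_dist_def iota_sq trd_simps)
    qed
    then have "cosh_dist (qconj h) = - 1" by (simp add: iota_sq trd_simps)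
    then show ?thesis using cosh_dist_ge(1)[OF QB1_qconj[OF assms(1)]] by simp
  qed
qed

section \<open>The systole\<close>

lemma Gam_trd_large: assumes "x \<in> Gam d" "x \<noteq> 1" "d \<in> Zs" "d \<noteq> 0"
  shows "(anorm d)\<^sup>2 / 4 - 2 \<le> \<bar>trd x\<bar>"
proof -
  have "\<bar>trd x - 2\<bar> \<le> \<bar>trd x\<bar> + 2" by linarith
  then have "4 * \<bar>trd x - 2\<bar> \<le> 4 * (\<bar>trd x\<bar> + 2)" by (intro mult_left_mono) simp_all
  then have "(anorm d)\<^sup>2 \<le> 4 * (\<bar>trd x\<bar> + 2)" using Gam_trd[OF assms] by (rule order_trans[rotated])
  then show ?thesis by (simp add: field_simps)
qed

lemma Gam_trd_ge_98: assumes "x \<in> Gam d" "x \<noteq> 1" "d \<in> Zs" "anorm d \<ge> 20"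
  shows "98 \<le> \<bar>trd x\<bar>"
proof -
  have "d \<noteq> 0" using assms(4) by (auto simp: anorm_def)
  have "20\<^sup>2 \<le> (anorm d)\<^sup>2" using assms(4) by (intro power_mono) simp_all
  then show ?thesis using Gam_trd_large[OF assms(1-3) \<open>d \<noteq> 0\<close>] by simp
qed

text \<open>The displacement \<open>L\<close> along the geodesic satisfies \<open>cosh L \<ge> t\<^sup>2/2 - 1\<close> for the trace \<open>t\<close> of the element
  that induces it.\<close>

lemma closed_geodesic_bound:
  assumes d: "d \<in> Zs" "anorm d \<ge> 20" and L: "closed_geodesic_length (matB ` Gam d) L"
  shows "2 * ln ((anorm d)\<^sup>2 / 4 - 3) \<le> L"
proof -
  have d0: "d \<noteq> 0" using d(2) by (auto simp: anorm_def)
  have N2: "400 \<le> (anorm d)\<^sup>2" using power_mono[OF d(2), of 2] by simp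
  obtain c x where L0: "L > 0" and c: "range c \<subseteq> hyp_plane" "\<And>s t. hyp_dist (c s) (c t) = \<bar>s - t\<bar>"
    and x: "x \<in> Gam d" "\<And>t. act x (c t) = c (t + L)"
    using L unfolding closed_geodesic_length_def by blast
  have n1: "nrd x = 1" using x(1) Gam_QB1 QB1_D by blast
  have H: "c t \<in> hyp_plane" for t using c(1) by blast
  have "x \<noteq> 1"
  proof
    assume "x = 1"
    then have "c 0 = c L" using x(2)[of 0] by simp
    then show False using c(2)[of 0 L] c(2)[of 0 0] L0 by simp
  qed
  define T where "T = (anorm d)\<^sup>2 / 4 - 2"
  have T: "T \<le> \<bar>trd x\<bar>" unfolding T_def by (rule Gam_trd_large[OF x(1) \<open>x \<noteq> 1\<close> d(1) d0])
  have T98: "T \<ge> 98" unfolding T_def using N2 by simp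
  let ?z = "c 0" and ?w = "c L"
  have w: "act x ?z = ?w" using x(2)[of 0] by simp
  have p: "Im ?z > 0" "Im ?w > 0" using H by (simp_all add: hyp_plane_iff)
  have "((trd x)\<^sup>2 - 4) * (Im ?z * Im ?w) \<le> (cmod (?z - ?w))\<^sup>2" using act_displacement[OF n1 H[of 0]] unfolding w .
  then have u: "((trd x)\<^sup>2 - 4) / 2 \<le> (cmod (?z - ?w))\<^sup>2 / (2 * Im ?z * Im ?w)"
    using p by (simp add: field_simps)
  have "1 \<le> 1 + (cmod (?z - ?w))\<^sup>2 / (2 * Im ?z * Im ?w)" using p by simp
  moreover have "arcosh (1 + (cmod (?z - ?w))\<^sup>2 / (2 * Im ?z * Im ?w)) = L"
    using c(2)[of 0 L] L0 by (simp add: hyp_dist_def)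
  ultimately have "cosh L = 1 + (cmod (?z - ?w))\<^sup>2 / (2 * Im ?z * Im ?w)" by (metis cosh_arcosh_real)
  then have 1: "(trd x)\<^sup>2 / 2 - 1 \<le> cosh L" using u by (simp add: field_simps)
  have "T\<^sup>2 \<le> \<bar>trd x\<bar>\<^sup>2" using T T98 by (intro power_mono) simp_all
  then have 2: "T\<^sup>2 / 2 - 1 \<le> cosh L" using 1 by simp
  have "exp (- L) \<le> 1" using L0 by simp
  then have "2 * cosh L \<le> exp L + 1" by (simp add: cosh_def)
  then have "T\<^sup>2 - 3 \<le> exp L" using 2 by linarith
  \<comment> \<open>Since \<open>2 cosh L \<le> exp L + 1\<close>, the length is at least the logarithm of \<open>T\<^sup>2 - 3\<close>.\<close>
  moreover have "(T - 1)\<^sup>2 \<le> T\<^sup>2 - 3" using T98 by (simp add: power2_eq_square algebra_simps)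
  ultimately have "(T - 1)\<^sup>2 \<le> exp L" by linarith
  then have "ln ((T - 1)\<^sup>2) \<le> ln (exp L)" using T98 by (subst ln_le_cancel_iff) simp_all
  then have "2 * ln (T - 1) \<le> L" using T98 by (simp add: ln_realpow)
  then show ?thesis by (simp add: T_def)
qed

text \<open>The quaternion \<open>(3 + 2 sqrt 2) + (2 + 2 sqrt 2) j\<close> of norm one. Its matrix is diagonal, so it
  translates along the imaginary axis.\<close>

definition hyp_unit :: bquat where "hyp_unit = BQ (3 + 2 * sqrt 2) 0 (2 + 2 * sqrt 2) 0"

lemma hyp_unit_QB1: "hyp_unit \<in> QB1"
proof -
  let ?a = "2 + 2 * sqrt 2"
  have e: "hyp_unit = qb (3 + 2 * sqrt 2 + ?a * (1 + sqrt 2)) (- ?a) (- ?a) (2 * ?a)"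
    by (simp add: hyp_unit_def qb_def field_simps)
  have "hyp_unit \<in> QB" unfolding e by (intro QB_qb Zs_add Zs_mult Zs_uminus Zs_numeral)
  moreover have "nrd hyp_unit = 1" by (simp add: hyp_unit_def nrd_def power2_eq_square algebra_simps)
  ultimately show ?thesis by (simp add: QB1_def)
qed

definition hyp_unit_eigenvalue :: real where "hyp_unit_eigenvalue = eA hyp_unit"

lemma hyp_unit_eigenvalue: "eD hyp_unit * hyp_unit_eigenvalue = 1" "hyp_unit_eigenvalue > 1" "eB hyp_unit = 0" "eC hyp_unit = 0"
proof -
  show bc: "eB hyp_unit = 0" "eC hyp_unit = 0" by (simp_all add: e_defs hyp_unit_def)
  show "eD hyp_unit * hyp_unit_eigenvalue = 1" using det_e[of hyp_unit] bc QB1_D(2)[OF hyp_unit_QB1] by (simp add: hyp_unit_eigenvalue_def mult.commute)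
  have "0 \<le> sqrt (sqrt 2) * (2 + 2 * sqrt 2)" "0 \<le> sqrt 2" by simp_all
  then show "hyp_unit_eigenvalue > 1" by (simp add: hyp_unit_eigenvalue_def eA_def hyp_unit_def add_pos_nonneg)
qed

lemma e_one: "eA 1 = 1" "eB 1 = 0" "eC 1 = 0" "eD 1 = 1"
  by (simp_all add: e_defs one_bquat_def)

lemma hyp_unit_power: "eA (hyp_unit ^ n) = hyp_unit_eigenvalue ^ n" "eB (hyp_unit ^ n) = 0" "eC (hyp_unit ^ n) = 0" "eD (hyp_unit ^ n) = (eD hyp_unit) ^ n"
  by (induction n) (simp_all add: e_mult hyp_unit_eigenvalue hyp_unit_eigenvalue_def[symmetric] e_one)

lemma QB1_power: "x \<in> QB1 \<Longrightarrow> x ^ n \<in> QB1"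
  by (induction n) (simp_all add: QB1_one QB1_mult)

text \<open>The lower bound for the infimum needs one closed geodesic. By the pigeonhole principle some positive
  power of \<open>hyp_unit\<close> is congruent to one, and it translates along the imaginary axis.\<close>

lemma closed_geodesic_exists:
  assumes d: "d \<in> Zs" "d \<noteq> 0"
  shows "\<exists>L. closed_geodesic_length (matB ` Gam d) L"
proof -
  have P: "hyp_unit ^ n \<in> QB1" for n using QB1_power hyp_unit_QB1 by blast
  have "\<not> inj (\<lambda>n. redQ d (hyp_unit ^ n))"
  proof
    assume i: "inj (\<lambda>n. redQ d (hyp_unit ^ n))"
    have "range (\<lambda>n. redQ d (hyp_unit ^ n)) \<subseteq> redQ d ` QB1" using P by blast
    then have "finite (range (\<lambda>n. redQ d (hyp_unit ^ n)))" using finite_idx[OF d] finite_subset by blast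
    then show False using i finite_imageD infinite_UNIV_nat by blast
  qed
  then obtain i j where ij: "i \<noteq> j" "redQ d (hyp_unit ^ i) = redQ d (hyp_unit ^ j)" unfolding inj_def by blast
  have *: "\<exists>n. n > 0 \<and> hyp_unit ^ n \<in> Gam d" if "i < j" "redQ d (hyp_unit ^ i) = redQ d (hyp_unit ^ j)" for i j
  proof -
    have "qdvd d (hyp_unit ^ j - hyp_unit ^ i)" using redQ_inj[OF QB1_D(1)[OF P] QB1_D(1)[OF P], of d j i] that(2) by simp
    then have "hyp_unit ^ j * qconj (hyp_unit ^ i) \<in> Gam d" using Gam_iff[OF P P] by blast
    moreover have "hyp_unit ^ j = hyp_unit ^ (j - i) * hyp_unit ^ i" using that(1) by (simp flip: power_add)
    ultimately have "hyp_unit ^ (j - i) \<in> Gam d" using P[of i] by (simp add: mult.assoc)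
    then show ?thesis using that(1) by (intro exI[of _ "j - i"]) simp
  qed
  obtain n where n: "n > 0" "hyp_unit ^ n \<in> Gam d"
    using *[of i j] *[of j i] ij by (metis linorder_neqE_nat)
  define L where "L = 2 * real n * ln hyp_unit_eigenvalue"
  have l0: "hyp_unit_eigenvalue > 0" "ln hyp_unit_eigenvalue > 0" using hyp_unit_eigenvalue(2) by simp_all
  have L0: "L > 0" using n(1) l0 by (simp add: L_def)
  \<comment> \<open>The imaginary axis, parametrized by arc length.\<close>
  define c where "c t = \<i> * of_real (exp t)" for t :: real
  have A: "act (hyp_unit ^ n) (c t) = c (t + L)" for t
  proof -
    have D: "eD hyp_unit = inverse hyp_unit_eigenvalue" using inverse_unique[of hyp_unit_eigenvalue "eD hyp_unit"] hyp_unit_eigenvalue(1) by (simp add: mult.commute)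
    have "exp L = hyp_unit_eigenvalue ^ n * hyp_unit_eigenvalue ^ n"
    proof -
      have "exp L = exp (real (n + n) * ln hyp_unit_eigenvalue)" by (simp add: L_def algebra_simps)
      also have "\<dots> = exp (ln hyp_unit_eigenvalue) ^ (n + n)" by (rule exp_of_nat_mult)
      also have "\<dots> = hyp_unit_eigenvalue ^ (n + n)" using l0 by simp
      finally show ?thesis by (simp add: power_add)
    qed
    then have "act (hyp_unit ^ n) (c t) = of_real (exp L) * c t"
      unfolding act_eq rmob_def hyp_unit_power D using l0 by (simp add: field_simps)
    then show ?thesis by (simp add: c_def exp_add mult_ac)
  qed
  have "hyp_dist (c s) (c t) = \<bar>s - t\<bar>" for s t
  proof -
    have "c s - c t = \<i> * of_real (exp s - exp t)" by (simp add: c_def algebra_simps)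
    then have "cmod (c s - c t) = \<bar>exp s - exp t\<bar>" by (simp only: norm_mult norm_ii norm_of_real mult_1)
    then have "1 + (cmod (c s - c t))\<^sup>2 / (2 * Im (c s) * Im (c t)) = 1 + (exp s - exp t)\<^sup>2 / (2 * exp s * exp t)"
      by (simp add: c_def)
    also have "\<dots> = cosh \<bar>s - t\<bar>"
    proof -
      have "cosh \<bar>s - t\<bar> = cosh (s - t)" by (simp add: abs_if)
      also have "\<dots> = (exp s / exp t + exp t / exp s) / 2" by (simp add: cosh_def exp_diff)
      finally show ?thesis by (simp add: field_simps power2_eq_square)
    qed
    finally have e: "1 + (cmod (c s - c t))\<^sup>2 / (2 * Im (c s) * Im (c t)) = cosh \<bar>s - t\<bar>" .
    show ?thesis unfolding hyp_dist_def e by (rule arcosh_cosh_real) simp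
  qed
  moreover have "range c \<subseteq> hyp_plane" by (auto simp: c_def hyp_plane_iff)
  ultimately have "closed_geodesic_length (matB ` Gam d) L"
    unfolding closed_geodesic_length_def using L0 A n(2) by blast
  then show ?thesis by blast
qed

lemma systole_bound: assumes "d \<in> Zs" "anorm d \<ge> 20"
  shows "2 * ln ((anorm d)\<^sup>2 / 4 - 3) \<le> systole (matB ` Gam d)"
proof -
  have d0: "d \<noteq> 0" using assms(2) by (auto simp: anorm_def)
  show ?thesis unfolding systole_def
  proof (rule cInf_greatest)
    show "{L. closed_geodesic_length (matB ` Gam d) L} \<noteq> {}" using closed_geodesic_exists[OF assms(1) d0] by blast
  qed (use closed_geodesic_bound[OF assms] in simp)
qed

section \<open>One-cycles on the quotient surface\<close>

text \<open>The upper half plane, the quotient surface of level \<open>d\<close> and the projection between them.\<close>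

abbreviation HP :: "complex topology" where "HP \<equiv> top_of_set hyp_plane"
abbreviation surface :: "real \<Rightarrow> complex set topology" where "surface d \<equiv> hyp_quotient (matB ` Gam d)"
abbreviation proj :: "real \<Rightarrow> complex \<Rightarrow> complex set" where "proj d \<equiv> orbit_map (matB ` Gam d)"

lemma proj_eq: "proj d z = (\<lambda>x. act x z) ` Gam d"
  by (simp add: orbit_map_def image_image)

lemma proj_act: assumes "x \<in> Gam d" "z \<in> hyp_plane" shows "proj d (act x z) = proj d z"
proof -
  have x: "x \<in> QB1" using assms Gam_QB1 by blast
  show ?thesis unfolding proj_eq
  proof (intro equalityI subsetI)
    fix w assume "w \<in> (\<lambda>y. act y (act x z)) ` Gam d"
    then obtain y where y: "y \<in> Gam d" "w = act y (act x z)" by blast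
    have "w = act (y * x) z" unfolding y(2) using act_QB1_mult[OF Gam_QB1[OF y(1)] x assms(2)] by simp
    then show "w \<in> (\<lambda>y. act y z) ` Gam d" using Gam_mult[OF y(1) assms(1)] by (rule image_eqI)
  next
    fix w assume "w \<in> (\<lambda>y. act y z) ` Gam d"
    then obtain y where y: "y \<in> Gam d" "w = act y z" by blast
    have "act (y * qconj x) (act x z) = act y (act (qconj x) (act x z))"
      by (rule act_QB1_mult[OF Gam_QB1[OF y(1)] QB1_qconj[OF x] act_QB1_H[OF x assms(2)]])
    then have "w = act (y * qconj x) (act x z)" using y(2) act_qconj(1)[OF x assms(2)] by simp
    then show "w \<in> (\<lambda>y. act y (act x z)) ` Gam d" using Gam_mult[OF y(1) Gam_qconj[OF assms(1)]] by (rule image_eqI)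
  qed
qed

lemma proj_eq_D: assumes "proj d z = proj d w" shows "\<exists>x\<in>Gam d. z = act x w"
proof -
  have "act 1 z \<in> proj d z" unfolding proj_eq using Gam_one by blast
  then have "z \<in> proj d w" using assms by simp
  then show ?thesis unfolding proj_eq by blast
qed

lemma continuous_proj: "continuous_map HP (surface d) (proj d)"
  by (rule quotient_imp_continuous_map[OF quotient_map_orbit])

lemma topspace_surface: "topspace (surface d) = proj d ` hyp_plane"
  using quotient_imp_surjective_map[OF quotient_map_orbit, of "matB ` Gam d"] by simp

lemma open_proj: assumes "openin HP U" shows "openin (surface d) (proj d ` U)"
  unfolding openin_hyp_quotient
proof
  have UH: "U \<subseteq> hyp_plane" using openin_subset[OF assms] by simp
  then show "proj d ` U \<subseteq> proj d ` hyp_plane" by blast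
  have "{z \<in> hyp_plane. proj d z \<in> proj d ` U} = (\<Union>x\<in>Gam d. {z \<in> hyp_plane. act x z \<in> U})"
  proof (intro equalityI subsetI)
    fix z assume "z \<in> {z \<in> hyp_plane. proj d z \<in> proj d ` U}"
    then obtain u where u: "z \<in> hyp_plane" "u \<in> U" "proj d u = proj d z" by force
    obtain x where "x \<in> Gam d" "u = act x z" using proj_eq_D[OF u(3)] by blast
    then show "z \<in> (\<Union>x\<in>Gam d. {z \<in> hyp_plane. act x z \<in> U})" using u by blast
  next
    fix z assume "z \<in> (\<Union>x\<in>Gam d. {z \<in> hyp_plane. act x z \<in> U})"
    then obtain x where x: "x \<in> Gam d" "z \<in> hyp_plane" "act x z \<in> U" by blast
    have "proj d z = proj d (act x z)" using proj_act[OF x(1,2)] by simp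
    then show "z \<in> {z \<in> hyp_plane. proj d z \<in> proj d ` U}" using x by blast
  qed
  also have "openin HP \<dots>"
  proof (rule openin_Union, clarify)
    fix x assume x: "x \<in> Gam d"
    have n: "nrd x = 1" using Gam_QB1[OF x] QB1_D by blast
    have "continuous_map HP HP (act x)"
      using continuous_act[OF n] act_H[OF n] by (simp add: continuous_map_in_subtopology image_subset_iff_funcset Pi_iff)
    from openin_continuous_map_preimage[OF this assms]
    show "openin HP {z \<in> hyp_plane. act x z \<in> U}" by simp
  qed
  finally show "openin HP {z \<in> hyp_plane. proj d z \<in> proj d ` U}" .
qed

text \<open>When \<open>anorm d \<ge> 20\<close>, a nontrivial element of the group has trace at least 98 in absolute value, so it moves every point of a ball
  of half the height out of that ball; such balls are evenly covered.\<close>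

definition small_ball :: "complex \<Rightarrow> complex set" where "small_ball z = ball z (Im z / 2)"

lemma small_ball_Im: assumes "u \<in> small_ball z" shows "Im z / 2 < Im u"
proof -
  have "\<bar>Im (z - u)\<bar> \<le> cmod (z - u)" by (rule abs_Im_le_cmod)
  also have "\<dots> < Im z / 2" using assms by (simp add: small_ball_def dist_norm)
  finally show ?thesis by (simp add: abs_if split: if_splits)
qed

lemma small_ball_H: "z \<in> hyp_plane \<Longrightarrow> small_ball z \<subseteq> hyp_plane"
  using small_ball_Im by (fastforce simp: hyp_plane_iff)

lemma proj_inj_small_ball: assumes d: "d \<in> Zs" "anorm d \<ge> 20" and z: "z \<in> hyp_plane"
  shows "inj_on (proj d) (small_ball z)"
proof (rule inj_onI)
  fix u v assume u: "u \<in> small_ball z" and v: "v \<in> small_ball z" and "proj d u = proj d v"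
  then obtain x where x: "x \<in> Gam d" "u = act x v" using proj_eq_D by blast
  show "u = v"
  proof (rule ccontr)
    assume "u \<noteq> v"
    then have "x \<noteq> 1" using x(2) by auto
    have t: "98 \<le> \<bar>trd x\<bar>" by (rule Gam_trd_ge_98[OF x(1) \<open>x \<noteq> 1\<close> d])
    then have "98\<^sup>2 \<le> \<bar>trd x\<bar>\<^sup>2" by (intro power_mono) simp_all
    then have t2: "4 \<le> (trd x)\<^sup>2 - 4" by simp
    have y: "Im z > 0" using z by (simp add: hyp_plane_iff)
    have n: "nrd x = 1" using Gam_QB1[OF x(1)] QB1_D by blast
    have vH: "v \<in> hyp_plane" using v small_ball_H z by blast
    have "(Im z / 2) * (Im z / 2) < Im v * Im u"
      using small_ball_Im[OF u] small_ball_Im[OF v] y by (intro mult_strict_mono) simp_all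
    then have 1: "4 * ((Im z / 2) * (Im z / 2)) < 4 * (Im v * Im u)" by simp
    have p: "0 \<le> Im v * Im u" using small_ball_Im[OF u] small_ball_Im[OF v] y by simp
    have "4 * (Im v * Im u) \<le> ((trd x)\<^sup>2 - 4) * (Im v * Im u)" by (rule mult_right_mono[OF t2 p])
    also have "\<dots> \<le> (cmod (v - u))\<^sup>2" using act_displacement[OF n vH] x(2) by simp
    finally have 2: "4 * (Im v * Im u) \<le> (cmod (v - u))\<^sup>2" .
    have "cmod (v - u) < Im z"
    proof -
      have "dist v u \<le> dist z v + dist z u" by (rule dist_triangle3)
      also have "\<dots> < Im z / 2 + Im z / 2" using u v by (intro add_strict_mono) (simp_all add: small_ball_def)
      finally show ?thesis by (simp add: dist_norm)
    qed
    then have "(cmod (v - u))\<^sup>2 < (Im z)\<^sup>2" by (intro power_strict_mono) simp_all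
    also have "(Im z)\<^sup>2 = 4 * ((Im z / 2) * (Im z / 2))" by (simp add: power2_eq_square)
    finally show False using 1 2 by linarith
  qed
qed

lemma openin_small_ball: "z \<in> hyp_plane \<Longrightarrow> openin HP (small_ball z)"
  using open_subset[OF small_ball_H] by (simp add: small_ball_def)

text \<open>On a small ball the projection is an injective open map, so it has a continuous inverse there.\<close>

lemma small_simplex_lifts:
  assumes d: "d \<in> Zs" "anorm d \<ge> 20" and z: "z \<in> hyp_plane"
    and f: "singular_simplex n (surface d) f" "f \<in> standard_simplex n \<rightarrow> proj d ` small_ball z"
  shows "\<exists>g. singular_simplex n HP g \<and> simplex_map n (proj d) g = f"
proof -
  let ?B = "small_ball z" and ?P = "proj d ` small_ball z"
  have BH: "?B \<subseteq> hyp_plane" by (rule small_ball_H[OF z])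
  have oB: "openin HP ?B" by (rule openin_small_ball[OF z])
  have Ptop: "?P \<subseteq> topspace (surface d)" using BH topspace_surface by blast
  have cont: "continuous_map (subtopology HP ?B) (subtopology (surface d) ?P) (proj d)"
    using continuous_proj by (auto simp: continuous_map_in_subtopology continuous_map_from_subtopology)
  have "open_map (subtopology HP ?B) (subtopology (surface d) ?P) (proj d)"
    unfolding open_map_def
  proof (intro allI impI)
    fix U assume U: "openin (subtopology HP ?B) U"
    have "openin HP U" using U oB openin_trans_full by blast
    then have "openin (surface d) (proj d ` U)" by (rule open_proj)
    moreover have "proj d ` U \<subseteq> ?P" using openin_subset[OF U] by auto
    ultimately show "openin (subtopology (surface d) ?P) (proj d ` U)" unfolding openin_subtopology by blast
  qed
  then have "homeomorphic_map (subtopology HP ?B) (subtopology (surface d) ?P) (proj d)"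
  proof (rule bijective_open_imp_homeomorphic_map[OF cont])
    show "proj d ` topspace (subtopology HP ?B) = topspace (subtopology (surface d) ?P)" using BH Ptop by (simp add: inf.absorb2)
    show "inj_on (proj d) (topspace (subtopology HP ?B))"
      using proj_inj_small_ball[OF d z] BH by (simp add: inf.absorb2)
  qed
  then obtain g where g: "homeomorphic_maps (subtopology HP ?B) (subtopology (surface d) ?P) (proj d) g"
    using homeomorphic_map_maps by blast
  let ?S = "subtopology (powertop_real UNIV) (standard_simplex n)"
  have cf: "continuous_map ?S (subtopology (surface d) ?P) f"
    using f unfolding singular_simplex_def by (simp add: continuous_map_in_subtopology image_subset_iff_funcset)
  have cg: "continuous_map (subtopology (surface d) ?P) (subtopology HP ?B) g" using g by (simp add: homeomorphic_maps_def)
  have "continuous_map ?S HP (g \<circ> f)"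
    using continuous_map_compose[OF cf cg] by (simp add: continuous_map_in_subtopology)
  then have "singular_simplex n HP (restrict (g \<circ> f) (standard_simplex n))"
    unfolding singular_simplex_def by simp
  moreover have "simplex_map n (proj d) (restrict (g \<circ> f) (standard_simplex n)) = f"
  proof
    fix x
    show "simplex_map n (proj d) (restrict (g \<circ> f) (standard_simplex n)) x = f x"
    proof (cases "x \<in> standard_simplex n")
      case True
      have "f x \<in> ?P" using f(2) True by blast
      then have "proj d (g (f x)) = f x" using g Ptop by (auto simp: homeomorphic_maps_def)
      then show ?thesis using True by (simp add: simplex_map_def)
    next
      case False
      then show ?thesis using f(1) by (simp add: simplex_map_def singular_simplex_def extensional_def)
    qed
  qed
  ultimately show ?thesis by blast
qed

text \<open>The two vertices of the standard 1-simplex, and the 0-simplex at a point.\<close>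

definition v0 :: "nat \<Rightarrow> real" where "v0 = (\<lambda>j. if j = 0 then 1 else 0)"
definition v1 :: "nat \<Rightarrow> real" where "v1 = (\<lambda>j. if j = 1 then 1 else 0)"
definition pt :: "'a \<Rightarrow> (nat \<Rightarrow> real) \<Rightarrow> 'a" where "pt x = restrict (\<lambda>_. x) (standard_simplex 0)"

lemma v01: "v0 \<in> standard_simplex 1" "v1 \<in> standard_simplex 1" "standard_simplex 0 = {v0}"
  unfolding v0_def v1_def by (simp_all add: standard_simplex_0)

lemma pt_v0 [simp]: "pt x v0 = x" by (simp add: pt_def v01)

lemma boundary_simplex: "chain_boundary 1 (frag_of f) = frag_of (pt (f v1)) - frag_of (pt (f v0))"
proof -
  have s: "simplical_face 0 v0 = v1" "simplical_face 1 v0 = v0"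
    by (auto simp: simplical_face_def v0_def v1_def)
  have "singular_face 1 0 f = pt (f v1)" "singular_face 1 1 f = pt (f v0)"
    by (auto simp: singular_face_def pt_def v01 s s[simplified] restrict_def)
  then show ?thesis by (simp add: chain_boundary_of sum.atMost_Suc)
qed

text \<open>The half plane is convex.\<close>

lemma cycle_HP_boundary: assumes "singular_relcycle 1 HP {} c" shows "singular_relboundary 1 HP {} c"
proof -
  have "convex hyp_plane" unfolding hyp_plane_def by (rule convex_halfspace_Im_gt)
  then have "contractible hyp_plane" by (rule convex_imp_contractible)
  then have "contractible_space HP" by (simp add: contractible_def contractible_space_def)
  then have "trivial_group (reduced_homology_group 1 HP)" by (rule trivial_reduced_homology_group_contractible_space)
  then have "trivial_group (homology_group 1 HP)" by (simp add: un_reduced_homology_group)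
  then have car: "carrier (homology_group (int 1) HP) = {singular_relboundary_set 1 HP {}}"
    using one_relative_homology_group[of 1 HP "{}"] by (simp add: trivial_group_def)
  have "homologous_rel_set 1 HP {} c \<in> carrier (homology_group (int 1) HP)"
    using assms carrier_relative_homology_group[of 1 HP "{}"] by blast
  then have "homologous_rel_set 1 HP {} c = singular_relboundary_set 1 HP {}" using car by simp
  then show ?thesis by (simp only: homologous_rel_set_eq_relboundary)
qed

abbreviation homologous :: "real \<Rightarrow> complex set chain \<Rightarrow> complex set chain \<Rightarrow> bool" where
  "homologous d \<equiv> homologous_rel 1 (surface d) {}"

text \<open>This turns all comparisons of one-chains on the surface into comparisons of boundaries upstairs.\<close>

lemma same_boundary_homologous:
  assumes "singular_chain 1 HP a" "singular_chain 1 HP b" "chain_boundary 1 a = chain_boundary 1 b"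
  shows "homologous d (chain_map 1 (proj d) a) (chain_map 1 (proj d) b)"
proof -
  have "singular_relcycle 1 HP {} (a - b)"
    using assms by (simp add: singular_cycle singular_chain_diff chain_boundary_diff)
  then have "singular_relboundary 1 HP {} (a - b)" by (rule cycle_HP_boundary)
  then have "singular_relboundary 1 (surface d) {} (chain_map 1 (proj d) (a - b))"
    by (rule singular_relboundary_chain_map[OF _ continuous_proj]) simp
  then show ?thesis unfolding homologous_rel_def chain_map_diff .
qed

text \<open>Euclidean segments serve as paths in the half plane; only their end points matter in homology. The
  chain \<open>seg_chain d z w\<close> is the image on the surface.\<close>

definition seg :: "complex \<Rightarrow> complex \<Rightarrow> (nat \<Rightarrow> real) \<Rightarrow> complex" where
  "seg z w = restrict (\<lambda>x. x 0 *\<^sub>R z + x 1 *\<^sub>R w) (standard_simplex 1)"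

lemma seg_ends [simp]: "seg z w v0 = z" "seg z w v1 = w"
  using v01 by (simp_all add: seg_def) (simp_all add: v0_def v1_def)

lemma seg_simplex: assumes "z \<in> hyp_plane" "w \<in> hyp_plane" shows "singular_simplex 1 HP (seg z w)"
proof -
  let ?S = "subtopology (powertop_real UNIV) (standard_simplex 1)"
  have "continuous_map ?S euclidean (\<lambda>x. x 0 *\<^sub>R z + x 1 *\<^sub>R w)"
  proof -
    have c: "continuous_map ?S euclideanreal (\<lambda>x. x i)" for i
      by (intro continuous_map_from_subtopology continuous_map_product_projection) simp
    have m: "continuous_map euclideanreal euclidean (\<lambda>t. t *\<^sub>R y)" for y :: complex
      by (simp add: continuous_map_iff_continuous2 continuous_intros)
    have "continuous_map ?S euclidean (\<lambda>x. x i *\<^sub>R y)" for i and y :: complex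
      using continuous_map_compose[OF c m] by (simp add: comp_def)
    then show ?thesis by (intro continuous_map_add)
  qed
  moreover have "x 0 *\<^sub>R z + x 1 *\<^sub>R w \<in> hyp_plane" if x: "x \<in> standard_simplex 1" for x
  proof -
    have "convex hyp_plane" unfolding hyp_plane_def by (rule convex_halfspace_Im_gt)
    moreover have "0 \<le> x 0" "0 \<le> x 1" "x 0 + x 1 = 1" using x by (simp_all add: standard_simplex_def)
    ultimately show ?thesis using assms by (simp add: convex_def)
  qed
  ultimately have "continuous_map ?S HP (\<lambda>x. x 0 *\<^sub>R z + x 1 *\<^sub>R w)"
    by (simp add: continuous_map_in_subtopology Pi_iff)
  then have "continuous_map ?S HP (seg z w)" unfolding seg_def by (rule continuous_map_eq) simp
  then show ?thesis unfolding singular_simplex_def seg_def by simp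
qed

lemma boundary_seg: "chain_boundary 1 (frag_of (seg z w)) = frag_of (pt w) - frag_of (pt z)"
  by (simp only: boundary_simplex seg_ends)

definition seg_chain :: "real \<Rightarrow> complex \<Rightarrow> complex \<Rightarrow> complex set chain" where
  "seg_chain d z w = chain_map 1 (proj d) (frag_of (seg z w))"

lemma simplex_ends_H: assumes "singular_simplex 1 HP g" shows "g v0 \<in> hyp_plane" "g v1 \<in> hyp_plane"
  using assms v01 unfolding singular_simplex_def continuous_map_def by auto

lemma simplex_seg_chain: assumes "singular_simplex 1 HP g"
  shows "homologous d (chain_map 1 (proj d) (frag_of g)) (seg_chain d (g v0) (g v1))"
  unfolding seg_chain_def
  by (rule same_boundary_homologous)
    (use assms simplex_ends_H[OF assms] seg_simplex in \<open>simp_all only: singular_chain_of boundary_simplex seg_ends\<close>)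

lemma seg_chain_add: assumes "z \<in> hyp_plane" "w \<in> hyp_plane" "u \<in> hyp_plane"
  shows "homologous d (seg_chain d z w + seg_chain d w u) (seg_chain d z u)"
proof -
  have "homologous d (chain_map 1 (proj d) (frag_of (seg z w) + frag_of (seg w u))) (chain_map 1 (proj d) (frag_of (seg z u)))"
    by (rule same_boundary_homologous)
      (simp_all only: singular_chain_of singular_chain_add seg_simplex assms chain_boundary_add boundary_seg add_diff_add
        , simp)
  then show ?thesis unfolding seg_chain_def chain_map_add .
qed

lemma homologous_trans: "homologous d a b \<Longrightarrow> homologous d b c \<Longrightarrow> homologous d a c"
  using homologous_rel_trans by blast
lemma homologous_sym: "homologous d a b \<Longrightarrow> homologous d b a"
  using homologous_rel_sym by blast
lemma homologous_add: "homologous d a b \<Longrightarrow> homologous d a' b' \<Longrightarrow> homologous d (a + a') (b + b')"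
  by (rule homologous_rel_add)
lemma homologous_diff: "homologous d a b \<Longrightarrow> homologous d a' b' \<Longrightarrow> homologous d (a - a') (b - b')"
  by (rule homologous_rel_diff)

lemma seg_chain_refl: assumes "z \<in> hyp_plane" shows "homologous d (seg_chain d z z) 0"
  using homologous_diff[OF seg_chain_add[OF assms assms assms, of d] homologous_rel_refl[of 1 "surface d" "{}" "seg_chain d z z"]] by simp

lemma seg_chain_Gam: assumes "x \<in> Gam d" "z \<in> hyp_plane" "w \<in> hyp_plane"
  shows "homologous d (seg_chain d (act x z) (act x w)) (seg_chain d z w)"
proof -
  have n: "nrd x = 1" using Gam_QB1[OF assms(1)] QB1_D by blast
  have c: "continuous_map HP HP (act x)"
    using continuous_act[OF n] act_H[OF n] by (simp add: continuous_map_in_subtopology Pi_iff)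
  let ?s = "simplex_map 1 (act x) (seg z w)"
  have s: "singular_simplex 1 HP (seg z w)" by (rule seg_simplex[OF assms(2,3)])
  have s2: "singular_simplex 1 HP ?s" by (rule singular_simplex_simplex_map[OF s c])
  have e: "?s v0 = act x z" "?s v1 = act x w" using v01 by (simp_all add: simplex_map_def)
  have "chain_map 1 (proj d) (frag_of ?s) = chain_map 1 (proj d) (chain_map 1 (act x) (frag_of (seg z w)))" by simp
  also have "\<dots> = chain_map 1 (proj d \<circ> act x) (frag_of (seg z w))" by (simp only: chain_map_compose comp_apply)
  also have "\<dots> = chain_map 1 (proj d) (frag_of (seg z w))"
    by (rule chain_map_eq[of _ HP]) (use s proj_act[OF assms(1)] in \<open>simp_all add: singular_chain_of\<close>)
  finally have f: "chain_map 1 (proj d) (frag_of ?s) = seg_chain d z w" unfolding seg_chain_def .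
  show ?thesis using simplex_seg_chain[OF s2, of d] unfolding e f by (rule homologous_sym)
qed

text \<open>The oriented edge from \<open>g z0\<close> to \<open>g alphaB z0\<close>, projected. It is the translate of one fixed path, so that
  congruent \<open>g\<close> give the same simplex and not only homologous ones.\<close>

definition edge :: "real \<Rightarrow> bquat \<Rightarrow> (nat \<Rightarrow> real) \<Rightarrow> complex set" where
  "edge d g = simplex_map 1 (proj d \<circ> act g) (seg z0 (act alphaB z0))"

lemma e0_simplex: "singular_simplex 1 HP (seg z0 (act alphaB z0))"
  by (intro seg_simplex z0_H act_QB1_H gens_QB1)

lemma edge_seg_chain: assumes "g \<in> QB1" shows "homologous d (frag_of (edge d g)) (seg_chain d (act g z0) (act (g * alphaB) z0))"
proof -
  let ?e = "seg z0 (act alphaB z0)"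
  have n: "nrd g = 1" using assms QB1_D by blast
  have c: "continuous_map HP HP (act g)"
    using continuous_act[OF n] act_H[OF n] by (simp add: continuous_map_in_subtopology Pi_iff)
  let ?s = "simplex_map 1 (act g) ?e"
  have s2: "singular_simplex 1 HP ?s" by (rule singular_simplex_simplex_map[OF e0_simplex c])
  have e: "?s v0 = act g z0" "?s v1 = act (g * alphaB) z0"
    using v01 act_QB1_mult[OF assms gens_QB1(1) z0_H] by (simp_all add: simplex_map_def)
  have "frag_of (edge d g) = chain_map 1 (proj d) (frag_of ?s)"
    unfolding edge_def chain_map_of simplex_map_compose by simp
  then show ?thesis using simplex_seg_chain[OF s2, of d] unfolding e by simp
qed

lemma edge_ends: assumes "g \<in> QB1"
  shows "chain_boundary 1 (frag_of (edge d g)) = frag_of (pt (proj d (act (g * alphaB) z0))) - frag_of (pt (proj d (act g z0)))"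
  unfolding boundary_simplex edge_def
  using v01 act_QB1_mult[OF assms gens_QB1(1) z0_H] by (simp add: simplex_map_def)

lemma edge_simplex: assumes "g \<in> QB1" shows "singular_simplex 1 (surface d) (edge d g)"
proof -
  have n: "nrd g = 1" using assms QB1_D by blast
  have c: "continuous_map HP HP (act g)"
    using continuous_act[OF n] act_H[OF n] by (simp add: continuous_map_in_subtopology Pi_iff)
  show ?thesis unfolding edge_def
    by (rule singular_simplex_simplex_map[OF e0_simplex continuous_map_compose[OF c continuous_proj]])
qed

lemma edge_cong: assumes "g \<in> QB1" "x \<in> Gam d" shows "edge d (x * g) = edge d g" "edge d (- g) = edge d g"
proof -
  have x: "x \<in> QB1" using assms Gam_QB1 by blast
  show "edge d (x * g) = edge d g" unfolding edge_def
    by (rule simplex_map_eq[OF e0_simplex])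
      (use act_QB1_mult[OF x assms(1)] proj_act[OF assms(2) act_QB1_H[OF assms(1)]] in simp)
  show "edge d (- g) = edge d g" unfolding edge_def comp_def act_uminus ..
qed

definition edges :: "real \<Rightarrow> (bquat \<Rightarrow>\<^sub>0 int) \<Rightarrow> complex set chain" where
  "edges d = frag_extend (\<lambda>g. frag_of (edge d g))"

lemma edges_hom: "edges d 0 = 0" "edges d (a + b) = edges d a + edges d b" "edges d (a - b) = edges d a - edges d b"
  "edges d (frag_of g) = frag_of (edge d g)"
  by (simp_all add: edges_def frag_extend_add frag_extend_diff)

definition on_G0 :: "(bquat \<Rightarrow>\<^sub>0 int) \<Rightarrow> bool" where "on_G0 v \<longleftrightarrow> Poly_Mapping.keys v \<subseteq> G0"

lemma on_G0_closed: "on_G0 0" "on_G0 a \<Longrightarrow> on_G0 b \<Longrightarrow> on_G0 (a + b)" "on_G0 a \<Longrightarrow> on_G0 b \<Longrightarrow> on_G0 (a - b)"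
  "g \<in> G0 \<Longrightarrow> on_G0 (frag_of g)"
  using keys_add[of a b] keys_diff[of a b] by (auto simp: on_G0_def)

lemma zB_fixes: "act zB z0 = z0"
proof (rule act_commuting_fixes_z0[OF gens_QB1(2)])
  show "zB * iota = iota * zB" by (simp add: zB_iota algebra_simps)
qed

text \<open>A word in the generators is read as a walk: \<open>zB\<close> turns around the current vertex and \<open>alphaB\<close> runs along
  an edge.\<close>

lemma G0_path: assumes "w \<in> G0" shows "\<exists>v. on_G0 v \<and> homologous d (seg_chain d z0 (act w z0)) (edges d v)"
  using assms
proof induction
  case one
  show ?case using seg_chain_refl[OF z0_H, of d] on_G0_closed(1) edges_hom(1) by (intro exI[of _ 0]) simp
next
  case (alpha g)
  then obtain v where v: "on_G0 v" "homologous d (seg_chain d z0 (act g z0)) (edges d v)" by blast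
  have Q: "g \<in> QB1" "g * alphaB \<in> QB1" using alpha.hyps G0_QB1 G0.alpha by blast+
  have "homologous d (edges d v + edges d (frag_of g)) (seg_chain d z0 (act g z0) + seg_chain d (act g z0) (act (g * alphaB) z0))"
    using homologous_sym[OF v(2)] edge_seg_chain[OF Q(1), of d] by (intro homologous_add) (simp_all add: edges_hom)
  from homologous_trans[OF this seg_chain_add[OF z0_H act_QB1_H[OF Q(1) z0_H] act_QB1_H[OF Q(2) z0_H]]]
  have "homologous d (seg_chain d z0 (act (g * alphaB) z0)) (edges d (v + frag_of g))" unfolding edges_hom by (rule homologous_sym)
  then show ?case using on_G0_closed(2)[OF v(1) on_G0_closed(4)[OF alpha.hyps]] by blast
next
  case (z g)
  have "act (g * zB) z0 = act g z0"
    using act_QB1_mult[OF G0_QB1[OF z.hyps] gens_QB1(2) z0_H] zB_fixes by simp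
  then show ?case using z.IH by simp
qed

lemma QB1_orbit: assumes "g \<in> QB1" shows "\<exists>w\<in>G0. act g z0 = act w z0"
proof -
  obtain w where w: "w \<in> G0" "(qconj w * g) * iota = iota * (qconj w * g)" using G0_reduction[OF assms] by blast
  have wQ: "w \<in> QB1" using G0_QB1 w by blast
  have h: "qconj w * g \<in> QB1" by (intro QB1_mult QB1_qconj wQ assms)
  have "act (qconj w * g) z0 = z0" by (rule act_commuting_fixes_z0[OF h w(2)])
  then have "act w z0 = act (w * (qconj w * g)) z0" using act_QB1_mult[OF wQ h z0_H] by simp
  then show ?thesis using w(1) wQ by (intro bexI[of _ w]) simp_all
qed

text \<open>A choice of one lift for each point of the surface.\<close>

definition lift_pt :: "real \<Rightarrow> complex set \<Rightarrow> complex" where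
  "lift_pt d y = (SOME z. z \<in> hyp_plane \<and> proj d z = y)"

lemma lift_pt: assumes "z \<in> hyp_plane" shows "lift_pt d (proj d z) \<in> hyp_plane" "proj d (lift_pt d (proj d z)) = proj d z"
proof -
  have "z \<in> hyp_plane \<and> proj d z = proj d z" using assms by simp
  then have "lift_pt d (proj d z) \<in> hyp_plane \<and> proj d (lift_pt d (proj d z)) = proj d z" unfolding lift_pt_def by (rule someI)
  then show "lift_pt d (proj d z) \<in> hyp_plane" "proj d (lift_pt d (proj d z)) = proj d z" by simp_all
qed

text \<open>The linear extension of: from the base point to the chosen lift of a given point. On a simplex with
  end points \<open>a\<close> and \<open>b\<close> its value at the boundary is the correction for moving both ends to \<open>z0\<close>.\<close>

definition tails :: "real \<Rightarrow> complex set chain \<Rightarrow> complex set chain" where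
  "tails d = frag_extend (\<lambda>f. seg_chain d z0 (lift_pt d (f v0)))"

lemma tails_hom: "tails d 0 = 0" "tails d (a - b) = tails d a - tails d b"
  "tails d (frag_of (pt y)) = seg_chain d z0 (lift_pt d y)"
  by (simp_all add: tails_def frag_extend_diff)

text \<open>Let \<open>r\<close> be the chosen lift. A lifted simplex from \<open>x r(a)\<close> to \<open>y r(b)\<close> is homologous on the surface to
  the path from \<open>r(a)\<close> to \<open>z0\<close>, on to \<open>x\<^sup>-\<^sup>1 y z0\<close> and from there to \<open>x\<^sup>-\<^sup>1 y r(b)\<close>. The middle piece runs along
  edges, and the other two depend only on the end points on the surface.\<close>

lemma lifted_simplex_decomposition:
  assumes "singular_simplex 1 HP g"
  shows "\<exists>v. on_G0 v \<and> homologous d (frag_of (simplex_map 1 (proj d) g))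
    (edges d v + tails d (chain_boundary 1 (frag_of (simplex_map 1 (proj d) g))))"
proof -
  let ?a = "g v0" and ?b = "g v1"
  have H: "?a \<in> hyp_plane" "?b \<in> hyp_plane" using simplex_ends_H[OF assms] by simp_all
  let ?ra = "lift_pt d (proj d ?a)" and ?rb = "lift_pt d (proj d ?b)"
  note ra = lift_pt[OF H(1), of d] and rb = lift_pt[OF H(2), of d]
  obtain x where x: "x \<in> Gam d" "?a = act x ?ra" using proj_eq_D[OF ra(2)[symmetric]] by blast
  obtain y where y: "y \<in> Gam d" "?b = act y ?rb" using proj_eq_D[OF rb(2)[symmetric]] by blast
  define e where "e = qconj x * y"
  have eG: "e \<in> Gam d" unfolding e_def by (intro Gam_mult Gam_qconj x y)
  have Q: "x \<in> QB1" "y \<in> QB1" "e \<in> QB1" using x y eG Gam_QB1 by blast+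
  have eH: "act e z0 \<in> hyp_plane" "act e ?rb \<in> hyp_plane" using act_QB1_H[OF Q(3)] z0_H rb(1) by simp_all
  have xe: "act x (act e ?rb) = ?b"
  proof -
    have "act x (act e ?rb) = act (x * e) ?rb" using act_QB1_mult[OF Q(1,3) rb(1)] by simp
    also have "x * e = y" using Q by (simp add: e_def)
    finally show ?thesis using y(2) by simp
  qed
  have s0: "homologous d (frag_of (simplex_map 1 (proj d) g)) (seg_chain d ?a ?b)" using simplex_seg_chain[OF assms, of d] by simp
  have s1: "homologous d (seg_chain d ?a ?b) (seg_chain d ?ra (act e ?rb))"
    using seg_chain_Gam[OF x(1) ra(1) eH(2)] x(2) xe by simp
  obtain w where w: "w \<in> G0" "act e z0 = act w z0" using QB1_orbit[OF Q(3)] by blast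
  obtain v where v: "on_G0 v" "homologous d (seg_chain d z0 (act w z0)) (edges d v)" using G0_path[OF w(1)] by blast
  have s2: "homologous d (seg_chain d z0 (act e z0)) (edges d v)" using v(2) w(2) by simp
  have s3: "homologous d (seg_chain d (act e z0) (act e ?rb)) (seg_chain d z0 ?rb)" by (rule seg_chain_Gam[OF eG z0_H rb(1)])
  have s4: "homologous d (seg_chain d z0 ?ra + seg_chain d ?ra (act e ?rb)) (seg_chain d z0 (act e ?rb))" by (rule seg_chain_add[OF z0_H ra(1) eH(2)])
  have s5: "homologous d (seg_chain d z0 (act e ?rb)) (seg_chain d z0 (act e z0) + seg_chain d (act e z0) (act e ?rb))"
    by (rule homologous_sym[OF seg_chain_add[OF z0_H eH]])
  have s6: "homologous d (seg_chain d z0 ?ra + seg_chain d ?ra (act e ?rb)) (edges d v + seg_chain d z0 ?rb)"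
    by (rule homologous_trans[OF s4 homologous_trans[OF s5 homologous_add[OF s2 s3]]])
  have s7: "homologous d (seg_chain d ?ra (act e ?rb)) (edges d v + seg_chain d z0 ?rb - seg_chain d z0 ?ra)"
    using homologous_diff[OF s6 homologous_rel_refl[of 1 "surface d" "{}" "seg_chain d z0 ?ra"]] by simp
  have bd: "tails d (chain_boundary 1 (frag_of (simplex_map 1 (proj d) g))) = seg_chain d z0 ?rb - seg_chain d z0 ?ra"
    unfolding boundary_simplex tails_hom using v01 by (simp add: simplex_map_def)
  have "homologous d (frag_of (simplex_map 1 (proj d) g)) (edges d v + (seg_chain d z0 ?rb - seg_chain d z0 ?ra))"
    using homologous_trans[OF s0 homologous_trans[OF s1 s7]] by (simp add: add_diff_eq)
  then show ?thesis unfolding bd using v(1) by blast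
qed

text \<open>After subdivision all simplices are small and lift. The tails cancel because the cycle has boundary
  zero.\<close>

lemma cycle_homologous_to_edges:
  assumes d: "d \<in> Zs" "anorm d \<ge> 20" and c: "singular_relcycle 1 (surface d) {} c"
  shows "\<exists>v. on_G0 v \<and> homologous d c (edges d v)"
proof -
  let ?C = "(\<lambda>z. proj d ` small_ball z) ` hyp_plane"
  have C1: "openin (surface d) U" if "U \<in> ?C" for U using that open_proj openin_small_ball by blast
  have "z \<in> small_ball z" if "z \<in> hyp_plane" for z using that by (simp add: small_ball_def hyp_plane_iff)
  then have C2: "topspace (surface d) \<subseteq> \<Union> ?C" unfolding topspace_surface by blast
  obtain c' where c': "singular_relcycle 1 (surface d) {} c'" "homologous d c c'"
    "\<And>f. f \<in> Poly_Mapping.keys c' \<Longrightarrow> \<exists>V\<in>?C. f \<in> standard_simplex 1 \<rightarrow> V"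
    using small_homologous_rel_relcycle_exists[of ?C "surface d" 1 "{}" c] C1 C2 c by metis
  let ?S = "{f. singular_simplex 1 (surface d) f \<and> (\<exists>z\<in>hyp_plane. f \<in> standard_simplex 1 \<rightarrow> proj d ` small_ball z)}"
  have sub: "Poly_Mapping.keys c' \<subseteq> ?S"
  proof
    fix f assume f: "f \<in> Poly_Mapping.keys c'"
    have "singular_chain 1 (surface d) c'" using c'(1) by (simp add: singular_cycle)
    then have "singular_simplex 1 (surface d) f" using f by (auto simp: singular_chain_def)
    moreover have "\<exists>z\<in>hyp_plane. f \<in> standard_simplex 1 \<rightarrow> proj d ` small_ball z" using c'(3)[OF f] by blast
    ultimately show "f \<in> ?S" by simp
  qed
  have "\<exists>v. on_G0 v \<and> homologous d c' (edges d v + tails d (chain_boundary 1 c'))"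
    using sub
  proof (induction rule: frag_induction)
    case zero
    show ?case by (intro exI[of _ 0]) (simp add: on_G0_closed edges_hom tails_hom)
  next
    case (one f)
    then obtain z where z: "z \<in> hyp_plane" "f \<in> standard_simplex 1 \<rightarrow> proj d ` small_ball z" and f: "singular_simplex 1 (surface d) f" by blast
    obtain g where g: "singular_simplex 1 HP g" "simplex_map 1 (proj d) g = f"
      using small_simplex_lifts[OF d z(1) f z(2)] by blast
    show ?case using lifted_simplex_decomposition[OF g(1), of d] unfolding g(2) .
  next
    case (diff a b)
    obtain v where v: "on_G0 v" "homologous d a (edges d v + tails d (chain_boundary 1 a))" using diff by blast
    obtain w where w: "on_G0 w" "homologous d b (edges d w + tails d (chain_boundary 1 b))" using diff by blast
    have "homologous d (a - b) (edges d (v - w) + tails d (chain_boundary 1 (a - b)))"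
      using homologous_diff[OF v(2) w(2)] by (simp add: edges_hom tails_hom chain_boundary_diff algebra_simps)
    then show ?case using on_G0_closed(3)[OF v(1) w(1)] by blast
  qed
  moreover have "chain_boundary 1 c' = 0" using c'(1) by (simp add: singular_cycle)
  ultimately obtain v where "on_G0 v" "homologous d c' (edges d v)" by (auto simp: tails_hom)
  then show ?thesis using homologous_trans[OF c'(2)] by blast
qed

lemma seg_chain_triangle:
  assumes "a \<in> hyp_plane" "b \<in> hyp_plane" "c \<in> hyp_plane"
  shows "homologous d (seg_chain d a b + seg_chain d b c + seg_chain d c a) 0"
proof -
  have "homologous d (seg_chain d a b + seg_chain d b c + seg_chain d c a) (seg_chain d a c + seg_chain d c a)"
    by (intro homologous_add seg_chain_add assms homologous_rel_refl)
  then show ?thesis using seg_chain_add[OF assms(1,3,1), of d] seg_chain_refl[OF assms(1), of d] homologous_trans by blast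
qed

text \<open>The second rotation of order three modulo sign whose orbit of an edge is a triangle. As \<open>zB\<close> fixes \<open>z0\<close>,
  it maps \<open>z0\<close> to the same neighbour as \<open>alphaB\<close>, so both triangles share an edge.\<close>

definition yB :: bquat where "yB = alphaB * qconj zB"

lemma yB_QB1: "yB \<in> QB1" unfolding yB_def by (intro QB1_mult QB1_qconj gens_QB1)

lemma yB_cube: "yB * (yB * yB) = - 1"
proof -
  have t: "trd yB = 1" unfolding yB_def zB_BQ alphaB_BQ by (simp add: trd_def qconj_def times_bquat_def field_simps)
  have c: "qconj yB = 1 - yB" unfolding qconj_eq t by simp
  have "yB * (1 - yB) = 1" using QB1_inv(1)[OF yB_QB1] unfolding c .
  then have y2: "yB * yB = yB - 1" by (simp add: algebra_simps)
  show ?thesis by (simp add: y2 algebra_simps)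
qed

lemma act_yB: assumes "g \<in> QB1" shows "act (g * yB) z0 = act (g * alphaB) z0"
proof -
  have "act (qconj zB) z0 = z0" using act_qconj(1)[OF gens_QB1(2) z0_H] zB_fixes by simp
  then show ?thesis unfolding yB_def
    using act_QB1_mult[OF QB1_mult[OF assms gens_QB1(1)] QB1_qconj[OF gens_QB1(2)] z0_H] by (simp add: mult.assoc)
qed

text \<open>The third power of \<open>y\<close> is \<open>- 1\<close>, which acts trivially, so the three edges close up, and their lifts
  bound a triangle in the plane.\<close>

lemma edge_triangle:
  assumes g: "g \<in> QB1" and y: "y = alphaB \<or> y = yB"
  shows "homologous d (frag_of (edge d g) + frag_of (edge d (g * y)) + frag_of (edge d (g * y * y))) 0"
proof -
  have yQ: "y \<in> QB1" using y gens_QB1 yB_QB1 by blast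
  have Q: "g * y \<in> QB1" "g * y * y \<in> QB1" using QB1_mult g yQ by blast+
  have a: "act (h * alphaB) z0 = act (h * y) z0" if "h \<in> QB1" for h using y act_yB[OF that] by auto
  have "y * (y * y) = - 1" using y alphaB_cube yB_cube by blast
  then have "g * y * y * y = - g" by (simp add: mult.assoc)
  then have c: "act (g * y * y * y) z0 = act g z0" by simp
  have "homologous d (frag_of (edge d g) + frag_of (edge d (g * y)) + frag_of (edge d (g * y * y)))
     (seg_chain d (act g z0) (act (g * y) z0) + seg_chain d (act (g * y) z0) (act (g * y * y) z0) + seg_chain d (act (g * y * y) z0) (act g z0))"
    using edge_seg_chain[OF g, of d] edge_seg_chain[OF Q(1), of d] edge_seg_chain[OF Q(2), of d]
    unfolding a[OF g] a[OF Q(1)] a[OF Q(2)] c by (intro homologous_add)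
  then show ?thesis using seg_chain_triangle[OF act_QB1_H[OF g z0_H] act_QB1_H[OF Q(1) z0_H] act_QB1_H[OF Q(2) z0_H], of d] homologous_trans by blast
qed

section \<open>Counting independent cycles\<close>

text \<open>Elimination without fractions: more integer vectors than coordinates are linearly dependent.\<close>

lemma int_dependent:
  fixes F :: "'t \<Rightarrow> 's \<Rightarrow> int"
  assumes "finite S" "finite T" "card S < card T"
  shows "\<exists>c. (\<exists>t\<in>T. c t \<noteq> 0) \<and> (\<forall>s\<in>S. (\<Sum>t\<in>T. c t * F t s) = 0)"
  using assms
proof (induction S arbitrary: T F rule: finite_induct)
  case empty
  then have "T \<noteq> {}" by auto
  then show ?case by (intro exI[of _ "\<lambda>_. 1"]) auto
next
  case (insert a S)
  show ?case
  proof (cases "\<forall>t\<in>T. F t a = 0")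
    case True
    have "card S < card T" using insert by simp
    from insert.IH[OF insert.prems(1) this, of F] obtain c
      where c: "\<exists>t\<in>T. c t \<noteq> 0" "\<forall>s\<in>S. (\<Sum>t\<in>T. c t * F t s) = 0" by blast
    then show ?thesis using True by (intro exI[of _ c]) simp
  next
    case False
    then obtain t0 where t0: "t0 \<in> T" "F t0 a \<noteq> 0" by blast
    define T' where "T' = T - {t0}"
    have T': "finite T'" "t0 \<notin> T'" "T = insert t0 T'" using t0 insert.prems by (auto simp: T'_def)
    have "card S < card T'" using insert T' by simp
    from insert.IH[OF T'(1) this, of "\<lambda>t s. F t0 a * F t s - F t a * F t0 s"] obtain c
      where c: "\<exists>t\<in>T'. c t \<noteq> 0" "\<forall>s\<in>S. (\<Sum>t\<in>T'. c t * (F t0 a * F t s - F t a * F t0 s)) = 0" by blast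
    define e where "e t = (if t = t0 then - (\<Sum>t\<in>T'. c t * F t a) else F t0 a * c t)" for t
    have sum: "(\<Sum>t\<in>T. e t * F t s) = (\<Sum>t\<in>T'. c t * (F t0 a * F t s - F t a * F t0 s))" for s
    proof -
      have "(\<Sum>t\<in>T. e t * F t s) = e t0 * F t0 s + (\<Sum>t\<in>T'. e t * F t s)" unfolding T'(3) using T' by simp
      also have "(\<Sum>t\<in>T'. e t * F t s) = (\<Sum>t\<in>T'. F t0 a * c t * F t s)"
        by (rule sum.cong) (use T'(2) in \<open>auto simp: e_def\<close>)
      also have "e t0 * F t0 s = (\<Sum>t\<in>T'. - (c t * F t a * F t0 s))"
        by (simp add: e_def sum_distrib_right sum_negf)
      finally show ?thesis by (simp add: sum.distrib[symmetric] algebra_simps)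
    qed
    have "\<exists>t\<in>T. e t \<noteq> 0"
    proof -
      obtain t where "t \<in> T'" "c t \<noteq> 0" using c(1) by blast
      then have "t \<in> T" "e t \<noteq> 0" using T' t0 by (auto simp: e_def)
      then show ?thesis by blast
    qed
    moreover have "\<forall>s\<in>insert a S. (\<Sum>t\<in>T. e t * F t s) = 0" unfolding sum using c(2) by (auto simp: mult.commute)
    ultimately show ?thesis by blast
  qed
qed

lemma card_orbits3:
  assumes "finite S" shows "card S \<le> 3 * card ((\<lambda>s. {s, a s, a (a s)}) ` S)"
proof (rule card_le_fibres[OF assms])
  fix x
  let ?O = "\<lambda>s. {s, a s, a (a s)}"
  have "{y \<in> S. ?O y = ?O x} \<subseteq> ?O x" by blast
  then have "card {y \<in> S. ?O y = ?O x} \<le> card (?O x)" by (rule card_mono[rotated]) simp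
  also have "\<dots> \<le> 3" by (simp add: card_insert_if)
  finally show "card {y \<in> S. ?O y = ?O x} \<le> 3" .
qed

lemma orbit3_eq:
  assumes "a (a (a t)) = t" "s \<in> {t, a t, a (a t)}"
  shows "{t, a t, a (a t)} = {s, a s, a (a s)}"
  using assms(2) assms(1) by auto

lemma bij_betw_order3:
  assumes "\<And>s. s \<in> S \<Longrightarrow> a s \<in> S" "\<And>s. s \<in> S \<Longrightarrow> a (a (a s)) = s"
  shows "bij_betw a S S"
proof (rule bij_betw_byWitness[of _ "\<lambda>s. a (a s)"])
  show "\<forall>s\<in>S. a (a (a s)) = s" "\<forall>s\<in>S. a (a (a s)) = s" using assms(2) by simp_all
  show "a ` S \<subseteq> S" "(\<lambda>s. a (a s)) ` S \<subseteq> S" using assms(1) by (simp_all add: image_subset_iff)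
qed

text \<open>\<open>S\<close> is the set of oriented edges of a graph with vertex set \<open>vertex ` S\<close>, the edge \<open>s\<close> running from
  \<open>vertex s\<close> to \<open>vertex (a s)\<close>. The orbits of \<open>a\<close> and of \<open>b\<close> are triangles. The vectors \<open>V r\<close> are cycles
  that are independent modulo triangles. Together with the triangles (subject to a single
  relation, by connectedness) and the coboundaries of the vertices (again with a single relation,
  and orthogonal to all cycles) they are linearly independent, so their number is at most
  the number of edges \<open>n\<close>. With at least \<open>n/3\<close> triangles of each kind and \<open>n/4\<close> vertices, there remain
  at most \<open>n - (n/3 + (n/3 - 1) + (n/4 - 1))\<close> of the vectors \<open>V r\<close>.\<close>

lemma rank_count:
  fixes S :: "'s set" and a b z :: "'s \<Rightarrow> 's" and vertex :: "'s \<Rightarrow> 'v" and V :: "'r \<Rightarrow> 's \<Rightarrow> int"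
  assumes S: "finite S" "s0 \<in> S"
    and a: "\<And>s. s \<in> S \<Longrightarrow> a s \<in> S" "\<And>s. s \<in> S \<Longrightarrow> a (a (a s)) = s"
    and b: "\<And>s. s \<in> S \<Longrightarrow> b s \<in> S" "\<And>s. s \<in> S \<Longrightarrow> b (b (b s)) = s"
    and vab: "\<And>s. s \<in> S \<Longrightarrow> vertex (b s) = vertex (a s)" and vz: "\<And>s. s \<in> S \<Longrightarrow> vertex (z s) = vertex s"
    and v4: "card S \<le> 4 * card (vertex ` S)"
    and conn1: "\<And>f :: 's \<Rightarrow> int. (\<And>s. s \<in> S \<Longrightarrow> f (a s) = f s) \<Longrightarrow> (\<And>s. s \<in> S \<Longrightarrow> f (b s) = f s) \<Longrightarrow> (\<And>s. s \<in> S \<Longrightarrow> f s = f s0)"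
    and conn2: "\<And>f :: 's \<Rightarrow> int. (\<And>s. s \<in> S \<Longrightarrow> f (a s) = f s) \<Longrightarrow> (\<And>s. s \<in> S \<Longrightarrow> f (z s) = f s) \<Longrightarrow> (\<And>s. s \<in> S \<Longrightarrow> f s = f s0)"
    and R: "finite R"
    and cyc: "\<And>r mu. r \<in> R \<Longrightarrow> (\<Sum>s\<in>S. V r s * (mu (vertex (a s)) - mu (vertex s))) = 0"
    and ind: "\<And>n f g. (\<And>s. s \<in> S \<Longrightarrow> f (a s) = f s) \<Longrightarrow> (\<And>s. s \<in> S \<Longrightarrow> g (b s) = g s) \<Longrightarrow>
        (\<And>s. s \<in> S \<Longrightarrow> (\<Sum>r\<in>R. n r * V r s) = f s + g s) \<Longrightarrow> (\<And>r. r \<in> R \<Longrightarrow> n r = 0)"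
  shows "12 * card R \<le> card S + 24"
proof -
  let ?A = "\<lambda>s. {s, a s, a (a s)}" and ?B = "\<lambda>s. {s, b s, b (b s)}"
  define OA where "OA = ?A ` S"
  define OB where "OB = ?B ` S - {?B s0}"
  define W where "W = vertex ` S - {vertex s0}"
  have fin: "finite OA" "finite OB" "finite W" using S by (simp_all add: OA_def OB_def W_def)
  have cA: "card S \<le> 3 * card OA" unfolding OA_def by (rule card_orbits3[OF S(1)])
  have cB: "card S \<le> 3 * (card OB + 1)"
  proof -
    have "card OB = card (?B ` S) - 1" unfolding OB_def using S by (intro card_Diff_singleton) auto
    moreover have "card S \<le> 3 * card (?B ` S)" by (rule card_orbits3[OF S(1)])
    ultimately show ?thesis by simp
  qed
  have cW: "card S \<le> 4 * (card W + 1)"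
  proof -
    have "card W = card (vertex ` S) - 1" unfolding W_def using S by (intro card_Diff_singleton) auto
    then show ?thesis using v4 by simp
  qed
  define T where "T = (R <+> OA) <+> (OB <+> W)"
  have fT: "finite T" unfolding T_def using R fin by (intro finite_Plus)
  have cT: "card T = card R + card OA + (card OB + card W)"
    unfolding T_def using R fin by (simp add: card_Plus)
  define F :: "('r + 's set) + ('s set + 'v) \<Rightarrow> 's \<Rightarrow> int" where
    "F t s = (case t of Inl (Inl r) \<Rightarrow> V r s | Inl (Inr Q) \<Rightarrow> of_bool (s \<in> Q)
       | Inr (Inl Q) \<Rightarrow> of_bool (s \<in> Q) | Inr (Inr v) \<Rightarrow> of_bool (vertex (a s) = v) - of_bool (vertex s = v))" for t s
  have "card T \<le> card S"
  proof (rule ccontr)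
    assume "\<not> card T \<le> card S"
    then have "card S < card T" by simp
    from int_dependent[OF S(1) fT this, of F]
    obtain c where c: "\<exists>t\<in>T. c t \<noteq> 0" "\<forall>s\<in>S. (\<Sum>t\<in>T. c t * F t s) = 0" by (elim exE conjE)
    define n where "n r = c (Inl (Inl r))" for r
    define f where "f s = c (Inl (Inr (?A s)))" for s
    define g where "g s = (if ?B s \<in> OB then c (Inr (Inl (?B s))) else 0)" for s
    define mu where "mu v = (if v \<in> W then c (Inr (Inr v)) else 0)" for v
    have fa: "f (a s) = f s" if s: "s \<in> S" for s
    proof -
      have "?A (a s) = ?A s" by (simp add: a(2)[OF s] insert_commute)
      then show ?thesis by (simp only: f_def)
    qed
    have gb: "g (b s) = g s" if s: "s \<in> S" for s
    proof -
      have "?B (b s) = ?B s" by (simp add: b(2)[OF s] insert_commute)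
      then show ?thesis by (simp only: g_def)
    qed
    define w where "w s = mu (vertex (a s)) - mu (vertex s)" for s
    have eq: "(\<Sum>r\<in>R. n r * V r s) + f s + g s + w s = 0" if s: "s \<in> S" for s
    proof -
      have "(\<Sum>t\<in>T. c t * F t s) = (\<Sum>r\<in>R. n r * V r s) + (\<Sum>Q\<in>OA. c (Inl (Inr Q)) * of_bool (s \<in> Q))
         + ((\<Sum>Q\<in>OB. c (Inr (Inl Q)) * of_bool (s \<in> Q)) +
            (\<Sum>v\<in>W. c (Inr (Inr v)) * (of_bool (vertex (a s) = v) - of_bool (vertex s = v))))"
        unfolding T_def using R fin by (simp add: sum.Plus F_def n_def finite_Plus)
      moreover have "(\<Sum>Q\<in>OA. c (Inl (Inr Q)) * of_bool (s \<in> Q)) = f s"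
      proof -
        have "(\<Sum>Q\<in>OA. c (Inl (Inr Q)) * of_bool (s \<in> Q)) = (\<Sum>Q\<in>OA. if Q = ?A s then c (Inl (Inr Q)) else 0)"
        proof (rule sum.cong[OF refl])
          fix Q assume "Q \<in> OA"
          then obtain t where t: "t \<in> S" "Q = ?A t" unfolding OA_def by blast
          have "s \<in> Q \<longleftrightarrow> Q = ?A s"
          proof
            assume "s \<in> Q"
            then show "Q = ?A s" unfolding t(2) by (rule orbit3_eq[of a, OF a(2)[OF t(1)]])
          qed simp
          then show "c (Inl (Inr Q)) * of_bool (s \<in> Q) = (if Q = ?A s then c (Inl (Inr Q)) else 0)" by simp
        qed
        also have "\<dots> = f s" using fin(1) s by (simp add: f_def OA_def)
        finally show ?thesis .
      qed
      moreover have "(\<Sum>Q\<in>OB. c (Inr (Inl Q)) * of_bool (s \<in> Q)) = g s"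
      proof -
        have "(\<Sum>Q\<in>OB. c (Inr (Inl Q)) * of_bool (s \<in> Q)) = (\<Sum>Q\<in>OB. if Q = ?B s then c (Inr (Inl Q)) else 0)"
        proof (rule sum.cong[OF refl])
          fix Q assume "Q \<in> OB"
          then obtain t where t: "t \<in> S" "Q = ?B t" unfolding OB_def by blast
          have "s \<in> Q \<longleftrightarrow> Q = ?B s"
          proof
            assume "s \<in> Q"
            then show "Q = ?B s" unfolding t(2) by (rule orbit3_eq[of b, OF b(2)[OF t(1)]])
          qed simp
          then show "c (Inr (Inl Q)) * of_bool (s \<in> Q) = (if Q = ?B s then c (Inr (Inl Q)) else 0)" by simp
        qed
        also have "\<dots> = g s" using fin(2) by (simp add: g_def)
        finally show ?thesis .
      qed
      moreover have "(\<Sum>v\<in>W. c (Inr (Inr v)) * (of_bool (vertex (a s) = v) - of_bool (vertex s = v))) = w s"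
      proof -
        have d: "(\<Sum>v\<in>W. c (Inr (Inr v)) * of_bool (y = v)) = mu y" for y
        proof -
          have "(\<Sum>v\<in>W. c (Inr (Inr v)) * of_bool (y = v)) = (\<Sum>v\<in>W. if v = y then c (Inr (Inr v)) else 0)"
            by (rule sum.cong) auto
          then show ?thesis using fin(3) by (simp add: mu_def)
        qed
        show ?thesis unfolding w_def by (simp only: right_diff_distrib sum_subtractf d)
      qed
      ultimately show ?thesis using c(2) s by simp
    qed
    have bijA: "bij_betw a S S" by (rule bij_betw_order3[OF a])
    have bijB: "bij_betw b S S" by (rule bij_betw_order3[OF b])
    have of: "(\<Sum>s\<in>S. f s * w s) = 0"
    proof -
      have "(\<Sum>s\<in>S. f s * mu (vertex (a s))) = (\<Sum>s\<in>S. f (a s) * mu (vertex (a s)))" by (rule sum.cong) (simp_all add: fa)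
      also have "\<dots> = (\<Sum>s\<in>S. f s * mu (vertex s))" by (rule sum.reindex_bij_betw[OF bijA])
      finally show ?thesis by (simp add: w_def right_diff_distrib sum_subtractf)
    qed
    have og: "(\<Sum>s\<in>S. g s * w s) = 0"
    proof -
      have "(\<Sum>s\<in>S. g s * mu (vertex (a s))) = (\<Sum>s\<in>S. g (b s) * mu (vertex (b s)))" by (rule sum.cong) (simp_all add: gb vab)
      also have "\<dots> = (\<Sum>s\<in>S. g s * mu (vertex s))" by (rule sum.reindex_bij_betw[OF bijB])
      finally show ?thesis by (simp add: w_def right_diff_distrib sum_subtractf)
    qed
    have oV: "(\<Sum>s\<in>S. (\<Sum>r\<in>R. n r * V r s) * w s) = 0"
    proof -
      have "(\<Sum>s\<in>S. (\<Sum>r\<in>R. n r * V r s) * w s) = (\<Sum>r\<in>R. n r * (\<Sum>s\<in>S. V r s * w s))"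
        by (simp only: sum_distrib_right sum_distrib_left mult.assoc) (rule sum.swap)
      also have "\<dots> = 0" unfolding w_def by (rule sum.neutral) (simp add: cyc)
      finally show ?thesis .
    qed
    \<comment> \<open>The coboundary \<open>w\<close> is orthogonal to all other terms of the relation, hence to itself.\<close>
    have "(\<Sum>s\<in>S. w s * w s) = (\<Sum>s\<in>S. - ((\<Sum>r\<in>R. n r * V r s) * w s + f s * w s + g s * w s))"
    proof (rule sum.cong[OF refl])
      fix s assume "s \<in> S"
      then have "w s = - ((\<Sum>r\<in>R. n r * V r s) + f s + g s)" using eq[of s] by simp
      then have "w s * w s = - ((\<Sum>r\<in>R. n r * V r s) + f s + g s) * w s" by simp
      then show "w s * w s = - ((\<Sum>r\<in>R. n r * V r s) * w s + f s * w s + g s * w s)" by (simp add: algebra_simps)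
    qed
    also have "\<dots> = 0" by (simp only: sum_negf sum.distrib of og oV)
    finally have "(\<Sum>s\<in>S. w s * w s) = 0" .
    then have w0: "w s = 0" if "s \<in> S" for s
      using that S(1) by (simp add: sum_nonneg_eq_0_iff)
    have mu0: "mu (vertex s) = 0" if s: "s \<in> S" for s
    proof -
      have "mu (vertex s) = mu (vertex s0)"
        by (rule conn2[of "\<lambda>s. mu (vertex s)"]) (use w0 vz s in \<open>simp_all add: w_def\<close>)
      also have "\<dots> = 0" by (simp add: mu_def W_def)
      finally show ?thesis .
    qed
    have n0: "n r = 0" if r: "r \<in> R" for r
    proof (rule ind[of "\<lambda>s. - f s" "\<lambda>s. - g s" n r, OF _ _ _ r])
      show "(\<Sum>r\<in>R. n r * V r s) = - f s + - g s" if "s \<in> S" for s using eq[OF that] w0[OF that] by simp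
    qed (simp_all add: fa gb)
    have fg: "f s = - g s" if s: "s \<in> S" for s using eq[OF s] w0[OF s] n0 by simp
    have f0: "f s = 0" if s: "s \<in> S" for s
    proof -
      have "f s = f s0"
      proof (rule conn1[of f])
        fix t assume t: "t \<in> S"
        show "f (a t) = f t" by (rule fa[OF t])
        show "f (b t) = f t" using fg[OF t] fg[OF b(1)[OF t]] gb[OF t] by simp
      qed (rule s)
      also have "\<dots> = 0" using fg[OF S(2)] by (simp add: g_def OB_def)
      finally show ?thesis .
    qed
    have "c t = 0" if t: "t \<in> T" for t
    proof -
      from t consider (1) r where "r \<in> R" "t = Inl (Inl r)" | (2) Q where "Q \<in> OA" "t = Inl (Inr Q)"
        | (3) Q where "Q \<in> OB" "t = Inr (Inl Q)" | (4) v where "v \<in> W" "t = Inr (Inr v)"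
        unfolding T_def by (elim PlusE) blast+
      then show ?thesis
      proof cases
        case 1 then show ?thesis using n0 by (simp add: n_def)
      next
        case 2
        then obtain s where s: "s \<in> S" "Q = ?A s" unfolding OA_def by blast
        show ?thesis using f0[OF s(1)] unfolding f_def 2(2) s(2) .
      next
        case 3
        then obtain s where s: "s \<in> S" "Q = ?B s" unfolding OB_def by blast
        have "g s = 0" using f0[OF s(1)] fg[OF s(1)] by simp
        then show ?thesis using 3 unfolding g_def s(2) by simp
      next
        case 4
        then obtain s where s: "s \<in> S" "v = vertex s" unfolding W_def by blast
        show ?thesis using mu0[OF s(1)] 4 unfolding mu_def s(2) by simp
      qed
    qed
    then show False using c(1) by blast
  qed
  then have "12 * card R + 12 * card OA + 12 * card OB + 12 * card W \<le> 12 * card S" unfolding cT by simp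
  moreover have "4 * card S \<le> 12 * card OA" "4 * card S \<le> 12 * card OB + 12" "3 * card S \<le> 12 * card W + 12"
    using cA cB cW by simp_all
  ultimately show ?thesis by linarith
qed

section \<open>Classes in homology\<close>

text \<open>The class of a cycle in first homology.\<close>

abbreviation hclass :: "'a topology \<Rightarrow> 'a chain \<Rightarrow> 'a chain set" where
  "hclass X c \<equiv> homologous_rel_set 1 X {} c"

lemma H1_carrier: "carrier (homology_group 1 X) = hclass X ` {c. singular_relcycle 1 X {} c}"
  using carrier_relative_homology_group[of 1 X "{}"] by simp

lemma H1_one: "one (homology_group 1 X) = {c. singular_relboundary 1 X {} c}"
  using one_relative_homology_group[of 1 X "{}"] by simp

lemma H1_in: "singular_relcycle 1 X {} c \<Longrightarrow> hclass X c \<in> carrier (homology_group 1 X)"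
  unfolding H1_carrier by blast

lemma hclass_one_iff: "hclass X c = one (homology_group 1 X) \<longleftrightarrow> singular_relboundary 1 X {} c"
  unfolding H1_one by (rule homologous_rel_set_eq_relboundary)

lemma hclass_mult: assumes "singular_relcycle 1 X {} a" "singular_relcycle 1 X {} b"
  shows "hclass X a \<otimes>\<^bsub>homology_group 1 X\<^esub> hclass X b = hclass X (a + b)"
proof -
  let ?G = "relcycle_group 1 X {}" and ?N = "{c. singular_relboundary 1 X {} c}"
  have "(#>\<^bsub>?G\<^esub>) ?N \<in> hom ?G (?G Mod ?N)"
    by (rule normal.r_coset_hom_Mod[OF normal_subgroup_singular_relboundary_relcycle])
  from hom_mult[OF this, of a b] assms
  have "?N #>\<^bsub>?G\<^esub> (a \<otimes>\<^bsub>?G\<^esub> b) = (?N #>\<^bsub>?G\<^esub> a) \<otimes>\<^bsub>?G Mod ?N\<^esub> (?N #>\<^bsub>?G\<^esub> b)" by simp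
  then have "hclass X (a + b) = hclass X a \<otimes>\<^bsub>?G Mod ?N\<^esub> hclass X b"
    unfolding right_coset_singular_relboundary mult_relcycle_group .
  moreover have "homology_group 1 X = ?G Mod ?N" using nontrivial_relative_homology_group[of 1 X "{}"] by simp
  ultimately show ?thesis by simp
qed

lemma comm_group_H1: "comm_group (homology_group 1 X)"
  by (rule abelian_relative_homology_group)

lemma hclass_int_pow: assumes c: "singular_relcycle 1 X {} c"
  shows "hclass X c [^]\<^bsub>homology_group 1 X\<^esub> (k::int) = hclass X (frag_cmul k c)"
proof -
  let ?H = "homology_group 1 X"
  interpret H: comm_group ?H by (rule comm_group_H1)
  have nat: "hclass X c [^]\<^bsub>?H\<^esub> (m::nat) = hclass X (frag_cmul (int m) c)" for m
  proof (induction m)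
    case 0
    have "hclass X 0 = one ?H" unfolding hclass_one_iff by simp
    then show ?case by simp
  next
    case (Suc m)
    have "hclass X c [^]\<^bsub>?H\<^esub> Suc m = hclass X (frag_cmul (int m) c) \<otimes>\<^bsub>?H\<^esub> hclass X c" using Suc by simp
    also have "\<dots> = hclass X (frag_cmul (int m) c + c)" by (rule hclass_mult[OF singular_relcycle_cmul[OF c] c])
    also have "frag_cmul (int m) c + c = frag_cmul (int (Suc m)) c"
      using frag_cmul_distrib[of "int m" 1 c] by (simp add: add.commute)
    finally show ?case .
  qed
  show ?thesis
  proof (cases "k \<ge> 0")
    case True
    then obtain m where k: "k = int m" by (rule nonneg_int_cases)
    show ?thesis unfolding k int_pow_int by (rule nat)
  next
    case False
    define m where "m = nat (- k)"
    have k: "k = - int m" using False by (simp add: m_def)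
    let ?x = "hclass X (frag_cmul (int m) c)" and ?y = "hclass X (frag_cmul (- int m) c)"
    have cy: "singular_relcycle 1 X {} (frag_cmul (int m) c)" "singular_relcycle 1 X {} (frag_cmul (- int m) c)"
      by (intro singular_relcycle_cmul c)+
    have z: "frag_cmul (- int m) c + frag_cmul (int m) c = 0" using frag_cmul_distrib[of "- int m" "int m" c] by simp
    have o: "hclass X 0 = one ?H" unfolding hclass_one_iff by simp
    have "?y \<otimes>\<^bsub>?H\<^esub> ?x = one ?H" unfolding hclass_mult[OF cy(2,1)] z by (rule o)
    then have i: "inv\<^bsub>?H\<^esub> ?x = ?y" by (rule H.inv_equality[OF _ H1_in[OF cy(1)] H1_in[OF cy(2)]])
    have p: "hclass X c [^]\<^bsub>?H\<^esub> (- int m) = inv\<^bsub>?H\<^esub> (hclass X c [^]\<^bsub>?H\<^esub> m)"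
      by (rule H.int_pow_neg_int[OF H1_in[OF c]])
    have "inv\<^bsub>?H\<^esub> (hclass X c [^]\<^bsub>?H\<^esub> m) = inv\<^bsub>?H\<^esub> ?x" by (rule arg_cong[OF nat[of m]])
    from trans[OF p trans[OF this i]] show ?thesis by (simp only: k)
  qed
qed

lemma hclass_finprod:
  assumes "finite S" "\<forall>x\<in>S. singular_relcycle 1 X {} (ch x) \<and> x = hclass X (ch x)"
  shows "finprod (homology_group 1 X) (\<lambda>x. x [^]\<^bsub>homology_group 1 X\<^esub> (n x :: int)) S
      = hclass X (\<Sum>x\<in>S. frag_cmul (n x) (ch x))
    \<and> singular_relcycle 1 X {} (\<Sum>x\<in>S. frag_cmul (n x) (ch x))"
  using assms
proof (induction S rule: finite_induct)
  case empty
  interpret H: comm_group "homology_group 1 X" by (rule comm_group_H1)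
  have "hclass X 0 = one (homology_group 1 X)" unfolding hclass_one_iff by simp
  then show ?case by simp
next
  case (insert y S)
  let ?H = "homology_group 1 X"
  interpret H: comm_group ?H by (rule comm_group_H1)
  have IH: "finprod ?H (\<lambda>x. x [^]\<^bsub>?H\<^esub> n x) S = hclass X (\<Sum>x\<in>S. frag_cmul (n x) (ch x))"
    "singular_relcycle 1 X {} (\<Sum>x\<in>S. frag_cmul (n x) (ch x))" using insert by simp_all
  have cy: "singular_relcycle 1 X {} (ch y)" and ye: "y = hclass X (ch y)" using insert.prems by simp_all
  have car: "x [^]\<^bsub>?H\<^esub> n x \<in> carrier ?H" if "x \<in> insert y S" for x
  proof (rule H.int_pow_closed)
    show "x \<in> carrier ?H" using H1_in[of X "ch x"] insert.prems that by metis
  qed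
  have yp: "y [^]\<^bsub>?H\<^esub> n y = hclass X (frag_cmul (n y) (ch y))"
    using hclass_int_pow[OF cy, of "n y"] ye by simp
  have "finprod ?H (\<lambda>x. x [^]\<^bsub>?H\<^esub> n x) (insert y S) = y [^]\<^bsub>?H\<^esub> n y \<otimes>\<^bsub>?H\<^esub> finprod ?H (\<lambda>x. x [^]\<^bsub>?H\<^esub> n x) S"
    by (rule H.finprod_insert) (use insert.hyps car in \<open>simp_all add: Pi_iff\<close>)
  also have "\<dots> = hclass X (frag_cmul (n y) (ch y) + (\<Sum>x\<in>S. frag_cmul (n x) (ch x)))"
    unfolding yp IH(1) by (rule hclass_mult[OF singular_relcycle_cmul[OF cy] IH(2)])
  finally show ?case using insert.hyps IH(2) cy by (simp add: singular_relcycle_add singular_relcycle_cmul)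
qed

section \<open>The genus bound\<close>

text \<open>Congruence up to sign, since \<open>g\<close> and \<open>- g\<close> act alike. The classes of \<open>G0\<close>, collected in \<open>PM d\<close>, index the
  edges on the surface, and \<open>pm_rep\<close> picks representatives.\<close>

definition pm_cong :: "real \<Rightarrow> bquat \<Rightarrow> bquat \<Rightarrow> bool" where
  "pm_cong d x y \<longleftrightarrow> qdvd d (x - y) \<or> qdvd d (x + y)"

definition pm_class :: "real \<Rightarrow> bquat \<Rightarrow> bquat set" where "pm_class d g = {x \<in> QB. pm_cong d x g}"
definition PM :: "real \<Rightarrow> bquat set set" where "PM d = pm_class d ` G0"
definition pm_rep :: "real \<Rightarrow> bquat set \<Rightarrow> bquat" where "pm_rep d s = (SOME g. g \<in> G0 \<and> pm_class d g = s)"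

lemma pm_cong_refl: "pm_cong d x x" by (simp add: pm_cong_def)

lemma pm_cong_sym: "pm_cong d x y \<Longrightarrow> pm_cong d y x"
  unfolding pm_cong_def using qdvd_commute[of d x y] by (simp add: add.commute)

lemma pm_cong_trans: assumes "pm_cong d x y" "pm_cong d y z" shows "pm_cong d x z"
  using assms unfolding pm_cong_def
proof (elim disjE)
  assume "qdvd d (x - y)" "qdvd d (y - z)"
  then show "qdvd d (x - z) \<or> qdvd d (x + z)" using qdvd_add[of d "x - y" "y - z"] by simp
next
  assume "qdvd d (x - y)" "qdvd d (y + z)"
  then show "qdvd d (x - z) \<or> qdvd d (x + z)" using qdvd_add[of d "x - y" "y + z"] by simp
next
  assume "qdvd d (x + y)" "qdvd d (y - z)"
  then show "qdvd d (x - z) \<or> qdvd d (x + z)" using qdvd_diff[of d "x + y" "y - z"] by simp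
next
  assume "qdvd d (x + y)" "qdvd d (y + z)"
  then show "qdvd d (x - z) \<or> qdvd d (x + z)" using qdvd_diff[of d "x + y" "y + z"] by simp
qed

lemma pm_class_eq_iff: assumes "g \<in> QB" "h \<in> QB" shows "pm_class d g = pm_class d h \<longleftrightarrow> pm_cong d g h"
proof
  assume "pm_class d g = pm_class d h"
  moreover have "g \<in> pm_class d g" using assms(1) pm_cong_refl[of d g] by (simp add: pm_class_def)
  ultimately have "g \<in> pm_class d h" by simp
  then show "pm_cong d g h" by (simp add: pm_class_def)
next
  assume gh: "pm_cong d g h"
  have "pm_cong d x g \<longleftrightarrow> pm_cong d x h" for x
    using pm_cong_trans[of d x g h] pm_cong_trans[of d x h g] pm_cong_sym[OF gh] gh by blast
  then show "pm_class d g = pm_class d h" unfolding pm_class_def by simp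
qed

lemma G0_QB: "g \<in> G0 \<Longrightarrow> g \<in> QB" using G0_QB1 QB1_D by blast

lemma pm_cong_mult: assumes "pm_cong d g h" "y \<in> QB" shows "pm_cong d (g * y) (h * y)"
  using assms(1) qdvd_mult(1)[OF _ assms(2), of d "g - h"] qdvd_mult(1)[OF _ assms(2), of d "g + h"]
  unfolding pm_cong_def left_diff_distrib distrib_right by blast

lemma pm_rep: assumes "s \<in> PM d" shows "pm_rep d s \<in> G0" "pm_class d (pm_rep d s) = s"
proof -
  obtain g where "g \<in> G0 \<and> pm_class d g = s" using assms unfolding PM_def by blast
  then have "pm_rep d s \<in> G0 \<and> pm_class d (pm_rep d s) = s" unfolding pm_rep_def by (rule someI)
  then show "pm_rep d s \<in> G0" "pm_class d (pm_rep d s) = s" by simp_all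
qed

lemma pm_class_PM: "g \<in> G0 \<Longrightarrow> pm_class d g \<in> PM d" unfolding PM_def by blast

lemma pm_rep_pm_class: assumes "g \<in> G0" shows "pm_cong d (pm_rep d (pm_class d g)) g" "pm_rep d (pm_class d g) \<in> G0"
proof -
  note r = pm_rep[OF pm_class_PM[OF assms], of d]
  show "pm_rep d (pm_class d g) \<in> G0" by (rule r(1))
  show "pm_cong d (pm_rep d (pm_class d g)) g" using r(2) pm_class_eq_iff[OF G0_QB[OF r(1)] G0_QB[OF assms]] by blast
qed

lemma PM_card: assumes "d \<in> Zs" "d \<noteq> 0" shows "finite (PM d)" "card (PM d) \<le> idx d"
proof -
  have sub: "PM d \<subseteq> pm_class d ` (redQ d ` QB1)"
  proof
    fix s assume "s \<in> PM d"
    then obtain g where g: "g \<in> G0" "s = pm_class d g" unfolding PM_def by blast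
    have gQ: "g \<in> QB" using G0_QB g by blast
    have "pm_class d (redQ d g) = pm_class d g" unfolding pm_class_eq_iff[OF redQ(1)[OF gQ] gQ] pm_cong_def using redQ(2)[OF gQ] by simp
    then show "s \<in> pm_class d ` (redQ d ` QB1)" using g G0_QB1 by blast
  qed
  have f: "finite (redQ d ` QB1)" by (rule finite_idx[OF assms])
  show "finite (PM d)" by (rule finite_subset[OF sub]) (use f in simp)
  have "card (PM d) \<le> card (pm_class d ` (redQ d ` QB1))" by (rule card_mono[OF _ sub]) (use f in simp)
  also have "\<dots> \<le> idx d" unfolding idx_def by (rule card_image_le[OF f])
  finally show "card (PM d) \<le> idx d" .
qed

text \<open>Right multiplication by \<open>y\<close>, the simplex and the starting vertex on classes. Right multiplication by
  \<open>alphaB\<close> or \<open>yB\<close> goes round a triangle, that by \<open>zB\<close> turns around a vertex.\<close>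

definition rmul :: "real \<Rightarrow> bquat \<Rightarrow> bquat set \<Rightarrow> bquat set" where "rmul d y s = pm_class d (pm_rep d s * y)"
definition pm_edge :: "real \<Rightarrow> bquat set \<Rightarrow> (nat \<Rightarrow> real) \<Rightarrow> complex set" where "pm_edge d s = edge d (pm_rep d s)"
definition vertex :: "real \<Rightarrow> bquat set \<Rightarrow> complex set" where "vertex d s = proj d (act (pm_rep d s) z0)"

lemma rmul_pm_class: assumes "g \<in> G0" "y \<in> QB" shows "rmul d y (pm_class d g) = pm_class d (g * y)"
  unfolding rmul_def
  using pm_class_eq_iff[OF QB_mult[OF G0_QB[OF pm_rep_pm_class(2)[OF assms(1)]] assms(2)] QB_mult[OF G0_QB[OF assms(1)] assms(2)]]
    pm_cong_mult[OF pm_rep_pm_class(1)[OF assms(1)] assms(2)] by blast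

lemma pm_cong_Gam: assumes "g \<in> QB1" "h \<in> QB1" "pm_cong d g h"
  shows "\<exists>x\<in>Gam d. g = x * h \<or> g = x * - h"
proof -
  have "qdvd d (g - h) \<or> qdvd d (g - (- h))" using assms(3) by (simp add: pm_cong_def)
  then show ?thesis
  proof
    assume "qdvd d (g - h)"
    then have "g * qconj h \<in> Gam d" using Gam_iff assms by blast
    moreover have "g = (g * qconj h) * h" using assms by (simp add: mult.assoc)
    ultimately show ?thesis by blast
  next
    assume "qdvd d (g - (- h))"
    then have "g * qconj (- h) \<in> Gam d" using Gam_iff[OF assms(1) QB1_uminus[OF assms(2)]] by blast
    moreover have "g = (g * qconj (- h)) * - h" using assms by (simp add: mult.assoc)
    ultimately show ?thesis by blast
  qed
qed

lemma pm_cong_edge: assumes "g \<in> QB1" "h \<in> QB1" "pm_cong d g h"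
  shows "edge d g = edge d h" "proj d (act g z0) = proj d (act h z0)"
proof -
  obtain x where x: "x \<in> Gam d" "g = x * h \<or> g = x * - h" using pm_cong_Gam[OF assms] by blast
  have h': "- h \<in> QB1" using QB1_uminus assms by blast
  show "edge d g = edge d h"
    using x(2) by (elim disjE) (simp_all only: edge_cong(1)[OF assms(2) x(1)] edge_cong(1)[OF h' x(1)] edge_cong(2)[OF assms(2) x(1)])
  have "proj d (act (x * h) z0) = proj d (act h z0)" if "h \<in> QB1" for h
    using act_QB1_mult[OF Gam_QB1[OF x(1)] that z0_H] proj_act[OF x(1) act_QB1_H[OF that z0_H]] by simp
  note e = this[OF assms(2)] this[OF h']
  show "proj d (act g z0) = proj d (act h z0)" using x(2) by (elim disjE) (simp_all only: e act_uminus)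
qed

lemma pm_edge_pm_class: "g \<in> G0 \<Longrightarrow> pm_edge d (pm_class d g) = edge d g"
  unfolding pm_edge_def by (rule pm_cong_edge(1)) (use pm_rep_pm_class G0_QB1 in blast)+

lemma vertex_pm_class: "g \<in> G0 \<Longrightarrow> vertex d (pm_class d g) = proj d (act g z0)"
  unfolding vertex_def by (rule pm_cong_edge(2)) (use pm_rep_pm_class G0_QB1 in blast)+

lemma G0_yB: "yB \<in> G0" unfolding yB_def by (intro G0_mult G0_qconj G0_gens)

lemma PM_cases: assumes "s \<in> PM d" obtains g where "g \<in> G0" "s = pm_class d g"
  using assms unfolding PM_def by blast

lemma rmul_PM: "s \<in> PM d \<Longrightarrow> y \<in> G0 \<Longrightarrow> rmul d y s \<in> PM d"
  unfolding rmul_def using pm_rep(1) G0_mult pm_class_PM by blast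

lemma rmul_cube: assumes "s \<in> PM d" "y \<in> G0" "y * (y * y) = - 1" shows "rmul d y (rmul d y (rmul d y s)) = s"
proof -
  obtain g where g: "g \<in> G0" "s = pm_class d g" using assms(1) by (rule PM_cases)
  have yQ: "y \<in> QB" using G0_QB assms by blast
  have "rmul d y (rmul d y (rmul d y s)) = pm_class d (g * y * y * y)"
    unfolding g(2) using rmul_pm_class[OF _ yQ] G0_mult g assms(2) by simp
  also have "g * y * y * y = - g" using assms(3) by (simp add: mult.assoc)
  also have "pm_class d (- g) = pm_class d g"
    unfolding pm_class_eq_iff[OF QB_uminus[OF G0_QB[OF g(1)]] G0_QB[OF g(1)]] pm_cong_def by simp
  finally show ?thesis using g by simp
qed

text \<open>The iota_centralizer of the base point is generated by \<open>zB\<close>, which has order four modulo sign, so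
  at most four residues give the same vertex.\<close>

lemma vertex_fibres: assumes "d \<in> Zs" "d \<noteq> 0" shows "card (PM d) \<le> 4 * card (vertex d ` PM d)"
proof (rule card_le_fibres[OF PM_card(1)[OF assms]])
  fix s assume "s \<in> PM d"
  then obtain g where g: "g \<in> G0" "s = pm_class d g" by (rule PM_cases)
  have gQ: "g \<in> QB1" using g G0_QB1 by blast
  let ?K = "{1, zB, zB * zB, zB * (zB * zB)}"
  have KQ: "k \<in> QB" if "k \<in> ?K" for k
  proof -
    have "k \<in> G0" using that G0.one G0_gens G0_mult by auto
    then show ?thesis by (rule G0_QB)
  qed
  have sub: "{t \<in> PM d. vertex d t = vertex d s} \<subseteq> (\<lambda>k. pm_class d (g * k)) ` ?K"
  proof
    fix t assume "t \<in> {t \<in> PM d. vertex d t = vertex d s}"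
    then have t: "t \<in> PM d" "vertex d t = vertex d s" by simp_all
    obtain h where h: "h \<in> G0" "t = pm_class d h" using t(1) by (rule PM_cases)
    have hQ: "h \<in> QB1" using h G0_QB1 by blast
    have "proj d (act h z0) = proj d (act g z0)" using t(2) vertex_pm_class[OF h(1)] vertex_pm_class[OF g(1)] h(2) g(2) by simp
    then obtain x where x: "x \<in> Gam d" "act h z0 = act x (act g z0)" using proj_eq_D by blast
    have xQ: "x \<in> QB1" using Gam_QB1 x by blast
    have xg: "x * g \<in> QB1" using QB1_mult xQ gQ by blast
    define k where "k = qconj (x * g) * h"
    have kQ: "k \<in> QB1" unfolding k_def using QB1_mult QB1_qconj xg hQ by blast
    have "act k z0 = act (qconj (x * g)) (act h z0)" unfolding k_def by (rule act_QB1_mult[OF QB1_qconj[OF xg] hQ z0_H])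
    also have "\<dots> = act (qconj (x * g)) (act (x * g) z0)" using x(2) act_QB1_mult[OF xQ gQ z0_H] by simp
    also have "\<dots> = z0" by (rule act_qconj(1)[OF xg z0_H])
    finally have "k * iota = iota * k" by (rule act_fixes_z0[OF kQ])
    then obtain k' where k': "k' \<in> ?K" "k = k' \<or> k = - k'" using iota_centralizer[OF kQ] by blast
    have he: "h = x * g * k" unfolding k_def using xg by simp
    have "qdvd d ((x - 1) * (g * k'))"
      by (rule qdvd_mult(1)) (use x(1) QB_mult QB1_D(1)[OF gQ] KQ[OF k'(1)] in \<open>simp_all add: Gam_def\<close>)
    then have q: "qdvd d (x * g * k' - g * k')" by (simp add: left_diff_distrib mult.assoc)
    have "pm_cong d h (g * k')"
    proof (cases "k = k'")
      case True then show ?thesis using q unfolding pm_cong_def he by simp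
    next
      case False
      then have "h + g * k' = - (x * g * k' - g * k')" using k'(2) he by simp
      then have "qdvd d (h + g * k')" using qdvd_uminus[OF q] by simp
      then show ?thesis unfolding pm_cong_def by simp
    qed
    then have "pm_class d h = pm_class d (g * k')"
      using pm_class_eq_iff[OF QB1_D(1)[OF hQ] QB_mult[OF QB1_D(1)[OF gQ] KQ[OF k'(1)]]] by simp
    then show "t \<in> (\<lambda>k. pm_class d (g * k)) ` ?K" using h(2) k'(1) by blast
  qed
  have "card {t \<in> PM d. vertex d t = vertex d s} \<le> card ((\<lambda>k. pm_class d (g * k)) ` ?K)" by (rule card_mono[OF _ sub]) simp
  also have "\<dots> \<le> card ?K" by (rule card_image_le) simp
  also have "\<dots> \<le> 4" by (simp add: card_insert_if)
  finally show "card {t \<in> PM d. vertex d t = vertex d s} \<le> 4" .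
qed

text \<open>The chain of edges with given weights.\<close>

definition edge_chain :: "real \<Rightarrow> (bquat set \<Rightarrow> int) \<Rightarrow> complex set chain" where
  "edge_chain d V = (\<Sum>s\<in>PM d. frag_cmul (V s) (frag_of (pm_edge d s)))"

lemma frag_cmul_sum_left: "finite A \<Longrightarrow> (\<Sum>i\<in>A. frag_cmul (f i) c) = frag_cmul (\<Sum>i\<in>A. f i) c"
  by (induction A rule: finite_induct) (simp_all add: frag_cmul_distrib)

lemma frag_cmul_sum_right: "finite A \<Longrightarrow> frag_cmul k (\<Sum>i\<in>A. f i) = (\<Sum>i\<in>A. frag_cmul k (f i))"
  by (induction A rule: finite_induct) (simp_all add: frag_cmul_distrib2)

lemma edge_chain_add: "edge_chain d (\<lambda>s. f s + g s) = edge_chain d f + edge_chain d g"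
  unfolding edge_chain_def by (simp add: frag_cmul_distrib sum.distrib)

lemma edge_chain_cmul: assumes "d \<in> Zs" "d \<noteq> 0" shows "edge_chain d (\<lambda>s. k * f s) = frag_cmul k (edge_chain d f)"
  unfolding edge_chain_def using PM_card(1)[OF assms] by (simp add: frag_cmul_sum_right)

lemma edge_chain_zero: "edge_chain d (\<lambda>s. 0) = 0" unfolding edge_chain_def by simp

lemma edge_chain_sum: assumes "d \<in> Zs" "d \<noteq> 0" "finite R"
  shows "edge_chain d (\<lambda>s. \<Sum>r\<in>R. n r * V r s) = (\<Sum>r\<in>R. frag_cmul (n r) (edge_chain d (V r)))"
  using assms(3) by (induction R rule: finite_induct) (simp_all add: edge_chain_zero edge_chain_add edge_chain_cmul[OF assms(1,2)])

lemma edges_edge_chain: assumes d: "d \<in> Zs" "d \<noteq> 0" and v: "on_G0 v"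
  shows "edges d v = edge_chain d (\<lambda>s. \<Sum>g\<in>{g \<in> Poly_Mapping.keys v. pm_class d g = s}. Poly_Mapping.lookup v g)"
proof -
  let ?K = "Poly_Mapping.keys v"
  have K: "g \<in> G0" if "g \<in> ?K" for g using v that unfolding on_G0_def by blast
  have "edges d v = (\<Sum>g\<in>?K. frag_cmul (Poly_Mapping.lookup v g) (frag_of (edge d g)))"
    unfolding edges_def frag_extend_def ..
  also have "\<dots> = (\<Sum>s\<in>PM d. \<Sum>g\<in>{g \<in> ?K. pm_class d g = s}. frag_cmul (Poly_Mapping.lookup v g) (frag_of (edge d g)))"
    by (rule sum.group[symmetric]) (use PM_card(1)[OF d] K pm_class_PM in auto)
  also have "\<dots> = edge_chain d (\<lambda>s. \<Sum>g\<in>{g \<in> ?K. pm_class d g = s}. Poly_Mapping.lookup v g)"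
    unfolding edge_chain_def
  proof (rule sum.cong[OF refl])
    fix s
    have "(\<Sum>g\<in>{g \<in> ?K. pm_class d g = s}. frag_cmul (Poly_Mapping.lookup v g) (frag_of (edge d g)))
      = (\<Sum>g\<in>{g \<in> ?K. pm_class d g = s}. frag_cmul (Poly_Mapping.lookup v g) (frag_of (pm_edge d s)))"
    proof (rule sum.cong[OF refl])
      fix g assume "g \<in> {g \<in> ?K. pm_class d g = s}"
      then have "pm_edge d s = edge d g" using pm_edge_pm_class[OF K, of g d] by simp
      then show "frag_cmul (Poly_Mapping.lookup v g) (frag_of (edge d g)) = frag_cmul (Poly_Mapping.lookup v g) (frag_of (pm_edge d s))"
        by simp
    qed
    then show "(\<Sum>g\<in>{g \<in> ?K. pm_class d g = s}. frag_cmul (Poly_Mapping.lookup v g) (frag_of (edge d g)))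
      = frag_cmul (\<Sum>g\<in>{g \<in> ?K. pm_class d g = s}. Poly_Mapping.lookup v g) (frag_of (pm_edge d s))"
      by (simp add: frag_cmul_sum_left)
  qed
  finally show ?thesis .
qed

lemma pm_edge_boundary: assumes "s \<in> PM d"
  shows "chain_boundary 1 (frag_of (pm_edge d s)) = frag_of (pt (vertex d (rmul d alphaB s))) - frag_of (pt (vertex d s))"
proof -
  have r: "pm_rep d s \<in> G0" using pm_rep assms by blast
  show ?thesis unfolding pm_edge_def edge_ends[OF G0_QB1[OF r]] rmul_def vertex_pm_class[OF G0.alpha[OF r]] unfolding vertex_def ..
qed

text \<open>Evaluate the boundary of the cycle, which is zero, against a function \<open>mu\<close> on the vertices.\<close>

lemma edge_cycle_orthogonal_coboundary:
  assumes d: "d \<in> Zs" "d \<noteq> 0" and V: "chain_boundary 1 (edge_chain d V) = 0"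
  shows "(\<Sum>s\<in>PM d. V s * (mu (vertex d (rmul d alphaB s)) - mu (vertex d s))) = (0::int)"
proof -
  \<comment> \<open>Sends the 0-simplex at \<open>y\<close> to \<open>mu y\<close>, with the integers as free abelian group on one generator.\<close>
  define Psi where "Psi = frag_extend (\<lambda>f :: (nat \<Rightarrow> real) \<Rightarrow> complex set. frag_cmul (mu (f v0)) (frag_of ()))"
  have Psi_pt: "Psi (frag_of (pt y)) = frag_cmul (mu y) (frag_of ())" for y unfolding Psi_def by simp
  have "chain_boundary 1 (edge_chain d V) = (\<Sum>s\<in>PM d. frag_cmul (V s) (frag_of (pt (vertex d (rmul d alphaB s))) - frag_of (pt (vertex d s))))"
    unfolding edge_chain_def chain_boundary_sum comp_def chain_boundary_cmul by (rule sum.cong) (simp_all only: pm_edge_boundary)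
  then have "Psi (\<Sum>s\<in>PM d. frag_cmul (V s) (frag_of (pt (vertex d (rmul d alphaB s))) - frag_of (pt (vertex d s)))) = 0"
    using V by (simp add: Psi_def)
  moreover have "Psi (\<Sum>s\<in>PM d. frag_cmul (V s) (frag_of (pt (vertex d (rmul d alphaB s))) - frag_of (pt (vertex d s))))
      = (\<Sum>s\<in>PM d. Psi (frag_cmul (V s) (frag_of (pt (vertex d (rmul d alphaB s))) - frag_of (pt (vertex d s)))))"
    unfolding Psi_def frag_extend_sum[OF PM_card(1)[OF d]] comp_def ..
  ultimately have "(\<Sum>s\<in>PM d. Psi (frag_cmul (V s) (frag_of (pt (vertex d (rmul d alphaB s))) - frag_of (pt (vertex d s))))) = 0"
    by (simp only:)
  then have "(\<Sum>s\<in>PM d. frag_cmul (V s) (frag_cmul (mu (vertex d (rmul d alphaB s))) (frag_of ()) - frag_cmul (mu (vertex d s)) (frag_of ()))) = 0"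
    by (simp add: Psi_def frag_extend_cmul frag_extend_diff)
  then have "Poly_Mapping.lookup (\<Sum>s\<in>PM d. frag_cmul (V s) (frag_cmul (mu (vertex d (rmul d alphaB s))) (frag_of ()) - frag_cmul (mu (vertex d s)) (frag_of ()))) () = 0"
    by simp
  then show ?thesis by (simp add: lookup_sum lookup_minus)
qed

lemma relboundary_sum:
  assumes "finite A" "\<forall>i\<in>A. singular_relboundary 1 X {} (f i)"
  shows "singular_relboundary 1 X {} (\<Sum>i\<in>A. f i)"
  using assms by (induction A rule: finite_induct) (simp_all add: singular_relboundary_add)

lemma homologous_0: "homologous d c 0 \<longleftrightarrow> singular_relboundary 1 (surface d) {} c"
  by (simp add: homologous_rel_def)

text \<open>Summing the triangles of all edges with the given weights counts each edge three times, once for each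
  position in its triangle. That is why three times the chain bounds.\<close>

lemma invariant_edge_chain_null:
  assumes d: "d \<in> Zs" "d \<noteq> 0" and y: "y = alphaB \<or> y = yB" and f: "\<And>s. s \<in> PM d \<Longrightarrow> f (rmul d y s) = f s"
  shows "singular_relboundary 1 (surface d) {} (frag_cmul 3 (edge_chain d f))"
proof -
  have yG: "y \<in> G0" using y G0_gens G0_yB by blast
  have y3: "y * (y * y) = - 1" using y alphaB_cube yB_cube by blast
  have bij: "bij_betw (rmul d y) (PM d) (PM d)"
    by (rule bij_betw_order3[OF rmul_PM[OF _ yG] rmul_cube[OF _ yG y3]])
  let ?E = "\<lambda>s. frag_of (pm_edge d s)"
  have shift: "(\<Sum>s\<in>PM d. frag_cmul (f s) (G (rmul d y s))) = (\<Sum>s\<in>PM d. frag_cmul (f s) (G s))" for G :: "bquat set \<Rightarrow> complex set chain"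
  proof -
    have "(\<Sum>s\<in>PM d. frag_cmul (f s) (G (rmul d y s))) = (\<Sum>s\<in>PM d. frag_cmul (f (rmul d y s)) (G (rmul d y s)))"
      by (rule sum.cong) (simp_all add: f)
    also have "\<dots> = (\<Sum>s\<in>PM d. frag_cmul (f s) (G s))" by (rule sum.reindex_bij_betw[OF bij])
    finally show ?thesis .
  qed
  have e1: "(\<Sum>s\<in>PM d. frag_cmul (f s) (?E (rmul d y s))) = edge_chain d f" unfolding shift[of ?E] edge_chain_def ..
  have e2: "(\<Sum>s\<in>PM d. frag_cmul (f s) (?E (rmul d y (rmul d y s)))) = edge_chain d f" unfolding shift[of "\<lambda>s. ?E (rmul d y s)"] e1 ..
  have "(\<Sum>s\<in>PM d. frag_cmul (f s) (?E s + ?E (rmul d y s) + ?E (rmul d y (rmul d y s)))) = edge_chain d f + edge_chain d f + edge_chain d f"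
    by (simp add: frag_cmul_distrib2 sum.distrib e1 e2) (simp add: edge_chain_def)
  also have "\<dots> = frag_cmul 3 (edge_chain d f)"
    using frag_cmul_distrib[of 1 1 "edge_chain d f"] frag_cmul_distrib[of 2 1 "edge_chain d f"] by simp
  finally have e: "frag_cmul 3 (edge_chain d f) = (\<Sum>s\<in>PM d. frag_cmul (f s) (?E s + ?E (rmul d y s) + ?E (rmul d y (rmul d y s))))" by simp
  show ?thesis unfolding e
  proof (rule relboundary_sum[OF PM_card(1)[OF d]], intro ballI singular_relboundary_cmul)
    fix s assume "s \<in> PM d"
    then obtain g where g: "g \<in> G0" "s = pm_class d g" by (rule PM_cases)
    have yQ: "y \<in> QB" using G0_QB yG by blast
    have G: "g * y \<in> G0" "g * y * y \<in> G0" using G0_mult g yG by blast+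
    have s1: "rmul d y s = pm_class d (g * y)" unfolding g(2) by (rule rmul_pm_class[OF g(1) yQ])
    have s2: "rmul d y (rmul d y s) = pm_class d (g * y * y)" unfolding s1 by (rule rmul_pm_class[OF G(1) yQ])
    have "homologous d (?E s + ?E (rmul d y s) + ?E (rmul d y (rmul d y s))) 0"
      unfolding s2 unfolding s1 unfolding g(2) pm_edge_pm_class[OF g(1)] pm_edge_pm_class[OF G(1)] pm_edge_pm_class[OF G(2)]
      by (rule edge_triangle[OF G0_QB1[OF g(1)] y])
    then show "singular_relboundary 1 (surface d) {} (?E s + ?E (rmul d y s) + ?E (rmul d y (rmul d y s)))" unfolding homologous_0 .
  qed
qed

lemma edge_chain_chain: "singular_chain 1 (surface d) (edge_chain d V)"
  unfolding edge_chain_def pm_edge_def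
  by (intro singular_chain_sum singular_chain_cmul, unfold singular_chain_of, rule edge_simplex, rule G0_QB1, rule pm_rep)

lemma H1_class_edge_chain:
  assumes d: "d \<in> Zs" "anorm d \<ge> 20" and x: "x \<in> carrier (homology_group 1 (surface d))"
  shows "\<exists>V. x = hclass (surface d) (edge_chain d V) \<and> chain_boundary 1 (edge_chain d V) = 0"
proof -
  have d0: "d \<noteq> 0" using d(2) by (auto simp: anorm_def)
  obtain c where c: "singular_relcycle 1 (surface d) {} c" "x = hclass (surface d) c" using x unfolding H1_carrier by blast
  obtain v where v: "on_G0 v" "homologous d c (edges d v)" using cycle_homologous_to_edges[OF d c(1)] by blast
  obtain V where V: "edges d v = edge_chain d V" using edges_edge_chain[OF d(1) d0 v(1)] by blast
  have "x = hclass (surface d) (edge_chain d V)" unfolding c(2) homologous_rel_set_eq using v(2) V by simp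
  moreover have "chain_boundary 1 (edge_chain d V) = 0"
  proof -
    have "singular_relcycle 1 (surface d) {} (edge_chain d V)" using homologous_rel_singular_relcycle[OF v(2)] c(1) V by simp
    then show ?thesis by (simp add: singular_cycle)
  qed
  ultimately show ?thesis by blast
qed

lemma connected_alpha_z:
  fixes f :: "bquat set \<Rightarrow> int"
  assumes "\<forall>s\<in>PM d. f (rmul d alphaB s) = f s" "\<forall>s\<in>PM d. f (rmul d zB s) = f s" "g \<in> G0"
  shows "f (pm_class d g) = f (pm_class d 1)"
  using assms(3)
proof induction
  case one show ?case ..
next
  case (alpha g)
  then show ?case using rmul_pm_class[OF alpha.hyps G0_QB[OF G0_gens(1)], of d] assms(1) pm_class_PM[OF alpha.hyps, of d] by metis
next
  case (z g)
  then show ?case using rmul_pm_class[OF z.hyps G0_QB[OF G0_gens(2)], of d] assms(2) pm_class_PM[OF z.hyps, of d] by metis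
qed

text \<open>Connectedness across faces follows from the one across vertices, because \<open>zB = qconj yB * alphaB\<close>.\<close>

lemma connected_alpha_y:
  fixes f :: "bquat set \<Rightarrow> int"
  assumes a: "\<forall>s\<in>PM d. f (rmul d alphaB s) = f s" and b: "\<forall>s\<in>PM d. f (rmul d yB s) = f s" and g: "g \<in> G0"
  shows "f (pm_class d g) = f (pm_class d 1)"
proof (rule connected_alpha_z[OF a _ g], rule ballI)
  fix s assume "s \<in> PM d"
  then obtain g where g: "g \<in> G0" "s = pm_class d g" by (rule PM_cases)
  define h where "h = g * qconj yB"
  have hG: "h \<in> G0" unfolding h_def by (intro G0_mult G0_qconj G0_yB g)
  have "h * yB = g" unfolding h_def using yB_QB1 by (simp add: mult.assoc)
  then have "f (pm_class d g) = f (pm_class d h)"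
    using b rmul_pm_class[OF hG G0_QB[OF G0_yB], of d] pm_class_PM[OF hG, of d] by metis
  moreover have "h * alphaB = g * zB"
  proof -
    have "qconj yB * alphaB = zB" unfolding yB_def qconj_mult using gens_QB1(1) by (simp add: mult.assoc)
    then show ?thesis unfolding h_def by (simp add: mult.assoc)
  qed
  then have "f (pm_class d (g * zB)) = f (pm_class d h)"
    using a rmul_pm_class[OF hG G0_QB[OF G0_gens(1)], of d] pm_class_PM[OF hG, of d] by metis
  ultimately show "f (rmul d zB s) = f s" unfolding g(2) using rmul_pm_class[OF g(1) G0_QB[OF G0_gens(2)], of d] by simp
qed

text \<open>Independence in homology passes to the weights: a relation modulo functions invariant under \<open>alphaB\<close> or
  \<open>yB\<close> bounds after multiplication by three.\<close>

lemma independent_card: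
  assumes d: "d \<in> Zs" "anorm d \<ge> 20" and R: "finite R" "int_independent (homology_group 1 (surface d)) R"
  shows "12 * card R \<le> card (PM d) + 24"
proof -
  have d0: "d \<noteq> 0" using d(2) by (auto simp: anorm_def)
  let ?H = "homology_group 1 (surface d)"
  have RC: "R \<subseteq> carrier ?H" using R(2) by (simp add: int_independent_def)
  have "\<forall>x\<in>R. \<exists>V. x = hclass (surface d) (edge_chain d V) \<and> chain_boundary 1 (edge_chain d V) = 0"
    by (intro ballI H1_class_edge_chain[OF d] subsetD[OF RC])
  from bchoice[OF this]
  obtain V where V: "\<forall>x\<in>R. x = hclass (surface d) (edge_chain d (V x)) \<and> chain_boundary 1 (edge_chain d (V x)) = 0" by (elim exE)
  have Vc: "\<forall>x\<in>R. singular_relcycle 1 (surface d) {} (edge_chain d (V x)) \<and> x = hclass (surface d) (edge_chain d (V x))"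
    using V edge_chain_chain by (simp add: singular_cycle)
  show ?thesis
  proof (rule rank_count[of "PM d" "pm_class d 1" "rmul d alphaB" "rmul d yB" "vertex d" "rmul d zB" R V])
    show "finite (PM d)" by (rule PM_card(1)[OF d(1) d0])
    show "pm_class d 1 \<in> PM d" by (rule pm_class_PM[OF G0.one])
    show "rmul d alphaB s \<in> PM d" if "s \<in> PM d" for s by (rule rmul_PM[OF that G0_gens(1)])
    show "rmul d yB s \<in> PM d" if "s \<in> PM d" for s by (rule rmul_PM[OF that G0_yB])
    show "rmul d alphaB (rmul d alphaB (rmul d alphaB s)) = s" if "s \<in> PM d" for s
      by (rule rmul_cube[OF that G0_gens(1) alphaB_cube])
    show "rmul d yB (rmul d yB (rmul d yB s)) = s" if "s \<in> PM d" for s by (rule rmul_cube[OF that G0_yB yB_cube])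
    show "vertex d (rmul d yB s) = vertex d (rmul d alphaB s)" if "s \<in> PM d" for s
      using vertex_pm_class[OF G0_mult[OF pm_rep(1)[OF that] G0_yB]] vertex_pm_class[OF G0.alpha[OF pm_rep(1)[OF that]]] act_yB[OF G0_QB1[OF pm_rep(1)[OF that]]]
      by (simp add: rmul_def)
    show "vertex d (rmul d zB s) = vertex d s" if "s \<in> PM d" for s
      using vertex_pm_class[OF G0.z[OF pm_rep(1)[OF that]]] act_QB1_mult[OF G0_QB1[OF pm_rep(1)[OF that]] gens_QB1(2) z0_H] zB_fixes
      by (simp add: rmul_def vertex_def)
    show "card (PM d) \<le> 4 * card (vertex d ` PM d)" by (rule vertex_fibres[OF d(1) d0])
    show "finite R" by (rule R(1))
  next
    fix f :: "bquat set \<Rightarrow> int" and s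
    assume f: "\<And>s. s \<in> PM d \<Longrightarrow> f (rmul d alphaB s) = f s" "\<And>s. s \<in> PM d \<Longrightarrow> f (rmul d yB s) = f s" and s: "s \<in> PM d"
    have f': "\<forall>s\<in>PM d. f (rmul d alphaB s) = f s" "\<forall>s\<in>PM d. f (rmul d yB s) = f s" using f by simp_all
    obtain g where g: "g \<in> G0" "s = pm_class d g" using s by (rule PM_cases)
    show "f s = f (pm_class d 1)" unfolding g(2) by (rule connected_alpha_y[OF f' g(1)])
  next
    fix f :: "bquat set \<Rightarrow> int" and s
    assume f: "\<And>s. s \<in> PM d \<Longrightarrow> f (rmul d alphaB s) = f s" "\<And>s. s \<in> PM d \<Longrightarrow> f (rmul d zB s) = f s" and s: "s \<in> PM d"
    have f': "\<forall>s\<in>PM d. f (rmul d alphaB s) = f s" "\<forall>s\<in>PM d. f (rmul d zB s) = f s" using f by simp_all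
    obtain g where g: "g \<in> G0" "s = pm_class d g" using s by (rule PM_cases)
    show "f s = f (pm_class d 1)" unfolding g(2) by (rule connected_alpha_z[OF f' g(1)])
  next
    fix r and mu :: "complex set \<Rightarrow> int" assume "r \<in> R"
    then have "chain_boundary 1 (edge_chain d (V r)) = 0" using V by blast
    then show "(\<Sum>s\<in>PM d. V r s * (mu (vertex d (rmul d alphaB s)) - mu (vertex d s))) = 0"
      by (rule edge_cycle_orthogonal_coboundary[OF d(1) d0])
  next
    fix n f g r
    assume f: "\<And>s. s \<in> PM d \<Longrightarrow> f (rmul d alphaB s) = f s" and g: "\<And>s. s \<in> PM d \<Longrightarrow> g (rmul d yB s) = g s"
      and e: "\<And>s. s \<in> PM d \<Longrightarrow> (\<Sum>r\<in>R. n r * V r s) = f s + g s" and r: "r \<in> R"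
    have "edge_chain d (\<lambda>s. \<Sum>r\<in>R. n r * V r s) = edge_chain d (\<lambda>s. f s + g s)"
      unfolding edge_chain_def by (rule sum.cong) (simp_all add: e)
    then have e1: "(\<Sum>r\<in>R. frag_cmul (n r) (edge_chain d (V r))) = edge_chain d f + edge_chain d g"
      unfolding edge_chain_sum[OF d(1) d0 R(1)] edge_chain_add .
    have "(\<Sum>r\<in>R. frag_cmul (3 * n r) (edge_chain d (V r))) = frag_cmul 3 (edge_chain d f) + frag_cmul 3 (edge_chain d g)"
      using arg_cong[OF e1, of "frag_cmul 3"] R(1) by (simp add: frag_cmul_sum_right frag_cmul_distrib2)
    moreover have "singular_relboundary 1 (surface d) {} (frag_cmul 3 (edge_chain d f) + frag_cmul 3 (edge_chain d g))"
      by (rule singular_relboundary_add)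
        (rule invariant_edge_chain_null[OF d(1) d0, of alphaB], simp, erule f, rule invariant_edge_chain_null[OF d(1) d0, of yB], simp, erule g)
    ultimately have "hclass (surface d) (\<Sum>r\<in>R. frag_cmul (3 * n r) (edge_chain d (V r))) = one ?H" unfolding hclass_one_iff by simp
    then have "finprod ?H (\<lambda>x. x [^]\<^bsub>?H\<^esub> (3 * n x)) R = one ?H"
      using hclass_finprod[OF R(1) Vc, of "\<lambda>x. 3 * n x"] by simp
    moreover have "\<forall>k :: complex set chain set \<Rightarrow> int. finprod ?H (\<lambda>x. x [^]\<^bsub>?H\<^esub> k x) R = one ?H \<longrightarrow> (\<forall>x\<in>R. k x = 0)"
      using R(2) unfolding int_independent_def by (rule conjunct2)
    ultimately have "\<forall>x\<in>R. 3 * n x = 0" by (rule mp[OF spec[where x = "\<lambda>x. 3 * n x"], rotated])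
    then show "n r = 0" using r by simp
  qed
qed

lemma genus_bound:
  assumes d: "d \<in> Zs" "anorm d \<ge> 20"
  shows "24 * genus (surface d) \<le> idx d + 24"
proof -
  have d0: "d \<noteq> 0" using d(2) by (auto simp: anorm_def)
  let ?H = "homology_group 1 (surface d)" and ?B = "(idx d + 24) div 12"
  have "abelian_rank ?H \<le> ?B"
    unfolding abelian_rank_def
  proof (rule cSup_least)
    have "int_independent ?H {}" by (simp add: int_independent_def)
    then show "{card S |S. finite S \<and> int_independent ?H S} \<noteq> {}" by blast
  next
    fix k assume "k \<in> {card S |S. finite S \<and> int_independent ?H S}"
    then obtain S where S: "k = card S" "finite S" "int_independent ?H S" by blast
    have "12 * k \<le> idx d + 24"
      using independent_card[OF d S(2,3)] PM_card(2)[OF d(1) d0] S(1) by linarith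
    then show "k \<le> ?B" by (simp add: less_eq_div_iff_mult_less_eq mult.commute)
  qed
  then have "genus (surface d) \<le> ?B div 2" unfolding genus_def by (rule div_le_mono)
  then show ?thesis by (simp add: div_mult2_eq[symmetric] less_eq_div_iff_mult_less_eq mult.commute)
qed

section \<open>The systolic inequality\<close>

lemma systolic_inequality:
  assumes d: "d \<in> Zs" "anorm d \<ge> 20"
  shows "systole (matB ` Gam d) > 4 / 3 * ln (real (genus (surface d)))"
proof -
  have d0: "d \<noteq> 0" using d(2) by (auto simp: anorm_def)
  define N where "N = anorm d"
  define g where "g = real (genus (surface d))"
  have N: "N \<ge> 20" using d(2) by (simp add: N_def)
  define P where "P = N\<^sup>2 / 4 - 3"
  define G where "G = N ^ 3 / 12 + 1"
  have N2: "400 \<le> N\<^sup>2" using power_mono[OF N, of 2] by simp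
  have N3: "8000 \<le> N ^ 3" using power_mono[OF N, of 3] by simp
  have P97: "P \<ge> 97" unfolding P_def using N2 by simp
  have s: "2 * ln P \<le> systole (matB ` Gam d)" unfolding P_def N_def by (rule systole_bound[OF d])
  have "real (24 * genus (surface d)) \<le> real (idx d + 24)" using genus_bound[OF d] by (simp only: of_nat_le_iff)
  then have "24 * g \<le> real (idx d) + 24" by (simp add: g_def)
  also have "\<dots> \<le> 2 * N ^ 3 + 24" using idx_le[OF d(1) d0] by (simp add: N_def)
  finally have gG: "g \<le> G" unfolding G_def by (simp add: field_simps)
  have "N ^ 3 / 12 > 0" using N3 by linarith
  then have G1: "G > 1" unfolding G_def by linarith
  have lnP: "ln P > 0" using P97 by simp
  \<comment> \<open>For \<open>N \<ge> 20\<close> one has \<open>G \<le> N\<^sup>3/11\<close> and \<open>P \<ge> 6 N\<^sup>2/25\<close>, and \<open>1/121 < (6/25)\<^sup>3\<close>.\<close>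
  have key: "G\<^sup>2 < P ^ 3"
  proof -
    have "G \<le> N ^ 3 / 11" unfolding G_def using N3 by (simp add: field_simps)
    then have "G\<^sup>2 \<le> (N ^ 3 / 11)\<^sup>2" using G1 by (intro power_mono) simp_all
    also have "\<dots> = N ^ 6 / 121" by (simp add: power_divide flip: power_mult)
    also have "\<dots> < N ^ 6 * (6 / 25) ^ 3" using N by (simp add: field_simps power_divide)
    also have "N ^ 6 = (N\<^sup>2) ^ 3" by (simp flip: power_mult)
    also have "(N\<^sup>2) ^ 3 * (6 / 25) ^ 3 = (N\<^sup>2 * (6 / 25)) ^ 3" by (rule power_mult_distrib[symmetric])
    also have "\<dots> \<le> P ^ 3"
    proof (rule power_mono)
      show "N\<^sup>2 * (6 / 25) \<le> P" unfolding P_def using N2 by (simp add: field_simps)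
    qed simp
    finally show ?thesis .
  qed
  \<comment> \<open>A surface of genus zero is covered by the convention \<open>ln 0 = 0\<close>.\<close>
  have "ln g \<le> ln G \<or> ln g \<le> 0"
  proof (cases "g > 0")
    case True then show ?thesis using gG by simp
  next
    case False
    then have "g = 0" by (simp add: g_def)
    then show ?thesis by simp
  qed
  moreover have "ln G > 0" using G1 by simp
  ultimately have lg: "ln g \<le> ln G" by linarith
  have "ln (G\<^sup>2) < ln (P ^ 3)" using key G1 P97 by (subst ln_less_cancel_iff) simp_all
  then have "2 * ln G < 3 * ln P" using G1 P97 by (simp add: ln_realpow)
  then have "4 / 3 * ln g < 2 * ln P" using lg by (simp add: field_simps)
  then show ?thesis using s by (simp add: g_def)
qed

text \<open>A generator of norm at most 19 divides its norm and hence \<open>fact 19\<close>. So the ideal is a union of residue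
  classes modulo \<open>fact 19\<close>, of which there are finitely many.\<close>

lemma finite_small_ideals:
  "finite {I. \<exists>d\<in>Zs. d \<noteq> 0 \<and> I = {x. odvd d x} \<and> anorm d < 20}"
proof -
  define K where "K = real (fact 19)"
  have K: "K \<in> Zs" "K \<noteq> 0" unfolding K_def using Zs_int[of "fact 19"] by simp_all
  let ?A = "{I. \<exists>d\<in>Zs. d \<noteq> 0 \<and> I = {x. odvd d x} \<and> anorm d < 20}"
  have Kd: "odvd d K" if d: "d \<in> Zs" "d \<noteq> 0" "anorm d < 20" for d
  proof -
    obtain n where n: "anorm d = real n" using d(1) by (rule anorm_nat)
    have "n \<noteq> 0" "n < 20" using n anorm_ge_1[OF d(1,2)] d(3) by auto
    then have "n dvd fact 19" by (intro dvd_fact) simp_all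
    then obtain m where m: "fact 19 = n * m" by blast
    have "odvd d (d * conj2 d)" by (rule odvd_multI[OF conj2_Zs[OF d(1)]])
    then have "odvd d (real n)" using n odvd_uminus[of d "d * conj2 d"] by (auto simp: anorm_def abs_if split: if_splits)
    then have "odvd d (real n * real m)" using odvd_mult[OF _ Zs_int[of "int m"]] by simp
    then show ?thesis unfolding K_def m by simp
  qed
  have mem: "x \<in> I \<longleftrightarrow> x \<in> Zs \<and> redO K x \<in> I \<inter> RO K" if I: "I \<in> ?A" for I x
  proof -
    obtain d where d: "d \<in> Zs" "d \<noteq> 0" "I = {x. odvd d x}" "anorm d < 20" using I by blast
    show ?thesis
    proof (cases "x \<in> Zs")
      case True
      have "odvd d (redO K x - x)" by (rule odvd_trans[OF Kd[OF d(1,2,4)] redO(2)[OF True]])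
      then have "odvd d (redO K x) \<longleftrightarrow> odvd d x"
        using odvd_add[of d "redO K x - x" x] odvd_diff[of d "redO K x" "redO K x - x"] by auto
      then show ?thesis using True d(3) redO_RO by simp
    next
      case False
      then show ?thesis using d odvd_Zs by auto
    qed
  qed
  have "inj_on (\<lambda>I. I \<inter> RO K) ?A"
  proof (rule inj_onI)
    fix I J assume I: "I \<in> ?A" and J: "J \<in> ?A" and e: "I \<inter> RO K = J \<inter> RO K"
    have "x \<in> I \<longleftrightarrow> x \<in> J" for x unfolding mem[OF I, of x] mem[OF J, of x] e ..
    then show "I = J" by blast
  qed
  moreover have "finite ((\<lambda>I. I \<inter> RO K) ` ?A)"
    by (rule finite_subset[of _ "Pow (RO K)"]) (use RO_card(1)[OF K] in auto)
  ultimately show ?thesis by (rule finite_imageD[rotated])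
qed

theorem theorem1p2:
  shows "finite {I. ideal I OK \<and> I \<noteq> {0} \<and>
           \<not> (systole (Gamma_B I) > 4 / 3 * ln (real (genus (hyp_quotient (Gamma_B I)))))}"
proof (rule finite_subset[OF _ finite_small_ideals], rule subsetI)
  fix I assume "I \<in> {I. ideal I OK \<and> I \<noteq> {0} \<and>
           \<not> (systole (Gamma_B I) > 4 / 3 * ln (real (genus (hyp_quotient (Gamma_B I)))))}"
  then have I: "ideal I OK" "I \<noteq> {0}"
    and no: "\<not> (systole (Gamma_B I) > 4 / 3 * ln (real (genus (hyp_quotient (Gamma_B I)))))" by simp_all
  obtain d where d: "d \<in> Zs" "d \<noteq> 0" "I = {x. odvd d x}" using ideal_OK_principal[OF I] by blast
  have G: "Gamma_B I = matB ` Gam d" unfolding Gamma_B_def QB1_cong_eq[OF d(1,3)] ..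
  have "anorm d < 20"
  proof (rule ccontr)
    assume "\<not> anorm d < 20"
    then have "anorm d \<ge> 20" by simp
    from systolic_inequality[OF d(1) this] no show False unfolding G by simp
  qed
  then show "I \<in> {I. \<exists>d\<in>Zs. d \<noteq> 0 \<and> I = {x. odvd d x} \<and> anorm d < 20}" using d by blast
qed

end
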